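(* Assume that $h_{\max}=\max_{x\in\Omega}h<1$, and set $h_{\min}:=\min_{x\in\Omega}h$. Then there exists a constant $c_{\rm hc}$ with $1>c_{\rm hc}>0$, independent of $h$ and $p$, such that, for all $w\in H^1(I;H^1_-(\Omega)\cap H^2(\Omega,\mathcal T))$, $$|||w|||^2\ \ge\ \kappa\,\|w\|_A^2,\qquad\text{with}\qquad \kappa\equiv\kappa(h,p):=c_{\rm hc}\,h_{\min}^4\,p^{-8}.$$
   Context: Domain and mesh. $\Omega\subset\mathbb R^2$ is a polygonal domain with coordinates $(x,y)$ and unit outward normal $\mathbf n=(n_1,n_2)$ (on $\partial T$, $\mathbf n$ denotes the unit outward normal to $T$); $I=(0,t_f]$, $t_f>0$. $\partial_0\Omega:=\{(x,y)\in\partial\Omega: n_1\neq0\}$, $\partial_-\Omega:=\{(x,y)\in\partial\Omega\setminus\partial_0\Omega: xn_2<0\}$, assumed to have positive one-dimensional Hausdorff measure, and $\partial_+\Omega:=\{(x,y)\in\partial\Omega\setminus\partial_0\Omega: xn_2\ge0\}$. $H^1_-(\Omega):=\{v\in H^1(\Omega): v|_{\partial_-\Omega}=0\}$. $\mathcal T$ is a shape-regular, locally quasi-uniform triangulation of $\Omega$ into open triangles $T$, $h_T=\mathrm{diam}(T)$, and $h$ is the mesh function $h|_T=h_T$. $H^2(\Omega,\mathcal T)$ is the broken Sobolev space of functions $v$ with $v|_T\in H^2(T)$ for all $T\in\mathcal T$; $\nabla_{\mathcal T}$ is the elementwise (spatial) gradient. For $T\in\mathcal T$, $\partial_-T$ and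 $\partial_+T$ are the parts of $\partial T$ where $xn_2<0$ and $xn_2\ge0$. The polynomial degree is $p\ge1$. $\|\cdot\|_\omega$ is the $L_2(\omega)$ norm, the subscript being omitted for $\omega=\Omega$. Parameters. $C_{INV}>0$ and $C_{inv}>0$ depend only on the shape-regularity of the mesh and are the constants in $\|\nabla v\|_T\le C_{INV}p^2h_T^{-1}\|v\|_T$ and $\|v\|_{\partial T}\le C_{inv}p\,h_T^{-1/2}\|v\|_T$ for polynomials $v$ of total degree at most $p$ on $T$. Elementwise, $$\delta|_T=\delta_T=\max\left\{\frac{C_{inv}^2p^2\|xn_2\|_{L_\infty(\partial_-T)}}{h_T},\ \frac{2\|n_1\|_{L_\infty(\partial T)}^2C_{inv}^4p^4}{3h_T^2}\right\},\qquad \tau|_T=\frac{h_T^2}{4C_{INV}^2p^4},$$ $\alpha=(8\delta)^{-1}$, $\beta=(24\delta^2)^{-1}$, $\gamma=(64\delta^3)^{-1}$, and $A=\begin{pmatrix}\alpha&\beta\\ \beta&\gamma\end{pmatrix}$. Norms. $\|w\|_A^2:=\|w\|^2+\|\sqrt A\nabla w\|^2$ and $$|||w|||^2:=\tfrac12\|w_x\|^2+\|\sqrt{\gamma\delta}\,w_y\|^2+\tfrac12\|\sqrt\tau(w_t+xw_y)\|^2+\|\sqrt A\nabla_{\mathcal T}w_x\|^2+\|\sqrt{xn_2}\,w\|_{\partial_+\Omega}^2+\sum_{T\in\mathcal T}\|\sqrt{xn_2A}\,\nabla w\|_{\partial_+T}^2,$$ where $\|\sqrt{xn_2A}\,\nabla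 w\|_{\partial_+T}^2=\int_{\partial_+T}xn_2\,\nabla w\cdot A\nabla w\,ds$. Both sides of the claimed inequality are evaluated at (almost every) $t\in I$. *)

theory Defs
  imports "HOL-Analysis.Analysis"
begin

section \<open>One-dimensional Hausdorff measure\<close>

definition hausdorff_pre :: "real \<Rightarrow> 'a::metric_space set \<Rightarrow> ennreal" where
  "hausdorff_pre \<epsilon> A =
     (INF U\<in>{U::nat \<Rightarrow> 'a set. A \<subseteq> (\<Union>i. U i) \<and> (\<forall>i. bounded (U i) \<and> diameter (U i) \<le> \<epsilon>)}.
        \<Sum>i. ennreal (diameter (U i)))"

definition hausdorff_outer :: "'a::metric_space set \<Rightarrow> ennreal" where
  "hausdorff_outer A = (SUP \<epsilon>\<in>{0<..}. hausdorff_pre \<epsilon> A)"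

text \<open>The measure lives on the Caratheodory-measurable sets. Lemma \<open>emeasure_hausdorff\<close> shows that
  \<^const>\<open>measure_of\<close> does not degenerate, and \<open>borel_hausdorff\<close> that all Borel sets are measurable.\<close>

definition hausdorff :: "'a::metric_space measure" where
  "hausdorff = measure_of UNIV (lambda_system UNIV UNIV hausdorff_outer) hausdorff_outer"

lemma hausdorff_pre_mono: "A \<subseteq> B \<Longrightarrow> hausdorff_pre \<epsilon> A \<le> hausdorff_pre \<epsilon> B"
  unfolding hausdorff_pre_def by (intro INF_superset_mono) auto

lemma hausdorff_pre_antimono: "\<epsilon> \<le> \<epsilon>' \<Longrightarrow> hausdorff_pre \<epsilon>' A \<le> hausdorff_pre \<epsilon> A"
  unfolding hausdorff_pre_def by (intro INF_superset_mono) (auto intro: order_trans)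

lemma hausdorff_outer_mono: "A \<subseteq> B \<Longrightarrow> hausdorff_outer A \<le> hausdorff_outer B"
  unfolding hausdorff_outer_def by (intro SUP_mono') (rule hausdorff_pre_mono)

lemma hausdorff_pre_le_outer: "0 < \<epsilon> \<Longrightarrow> hausdorff_pre \<epsilon> A \<le> hausdorff_outer A"
  unfolding hausdorff_outer_def by (intro SUP_upper) auto

lemma hausdorff_outer_empty [simp]: "hausdorff_outer ({}::'a::metric_space set) = 0"
proof -
  have "hausdorff_pre \<epsilon> ({}::'a set) = 0" if "0 < \<epsilon>" for \<epsilon> :: real
  proof -
    have "hausdorff_pre \<epsilon> ({}::'a set) \<le> (\<Sum>i::nat. ennreal (diameter ({}::'a set)))"
      unfolding hausdorff_pre_def
      using that by (intro INF_lower[where i = "\<lambda>_. {}" , THEN order_trans]) auto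
    then show ?thesis by simp
  qed
  then show ?thesis unfolding hausdorff_outer_def by (simp cong: SUP_cong_simp)
qed

lemma hausdorff_pre_UN:
  fixes A :: "nat \<Rightarrow> 'a::metric_space set"
  shows "hausdorff_pre \<epsilon> (\<Union>i. A i) \<le> (\<Sum>i. hausdorff_pre \<epsilon> (A i))"
proof (rule ennreal_le_epsilon)
  fix e :: real assume e: "0 < e" and fin: "(\<Sum>n. hausdorff_pre \<epsilon> (A n)) < top"
  let ?P = "\<lambda>n U. A n \<subseteq> (\<Union>i::nat. U i) \<and> (\<forall>i. bounded (U i) \<and> diameter (U i) \<le> \<epsilon>)
      \<and> (\<Sum>i. ennreal (diameter (U i))) \<le> hausdorff_pre \<epsilon> (A n) + e * (1/2)^Suc n"
  have "\<exists>U. ?P n U" for n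
  proof -
    have "hausdorff_pre \<epsilon> (A n) < hausdorff_pre \<epsilon> (A n) + e * (1/2)^Suc n"
      using e fin by (auto simp add: less_top dest!: ennreal_suminf_lessD)
    then show ?thesis
      unfolding hausdorff_pre_def INF_less_iff by (auto intro: less_imp_le)
  qed
  then obtain U where U: "\<And>n. ?P n (U n)" by metis
  define V where "V = case_prod U \<circ> prod_decode"
  have "(\<Union>i. A i) \<subseteq> (\<Union>i. V i)"
    using U by (auto simp add: V_def subset_eq) (metis prod.case prod_encode_inverse)
  moreover have "bounded (V i) \<and> diameter (V i) \<le> \<epsilon>" for i
    using U by (auto simp add: V_def split_def)
  ultimately have "hausdorff_pre \<epsilon> (\<Union>i. A i) \<le> (\<Sum>i. ennreal (diameter (V i)))"
    unfolding hausdorff_pre_def by (intro INF_lower) auto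
  also have "\<dots> = (\<Sum>i. (case_prod (\<lambda>n i. ennreal (diameter (U n i)))) (prod_decode i))"
    by (simp add: V_def split_def)
  also have "\<dots> = (\<Sum>n. \<Sum>i. ennreal (diameter (U n i)))"
    by (intro suminf_ennreal_2dimen) auto
  also have "\<dots> \<le> (\<Sum>n. hausdorff_pre \<epsilon> (A n) + e * (1/2) ^ Suc n)"
    using U by (intro suminf_le allI) auto
  also have "\<dots> = (\<Sum>n. hausdorff_pre \<epsilon> (A n)) + (\<Sum>n. ennreal e * ennreal ((1/2) ^ Suc n))"
    using e by (subst suminf_add[symmetric])
      (auto simp del: ennreal_suminf_cmult simp add: ennreal_mult[symmetric])
  also have "\<dots> = (\<Sum>n. hausdorff_pre \<epsilon> (A n)) + e"
    unfolding ennreal_suminf_cmult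
    by (subst suminf_ennreal_eq[OF zero_le_power power_half_series]) auto
  finally show "hausdorff_pre \<epsilon> (\<Union>i. A i) \<le> (\<Sum>n. hausdorff_pre \<epsilon> (A n)) + e" .
qed

lemma hausdorff_outer_UN: "hausdorff_outer (\<Union>i::nat. A i) \<le> (\<Sum>i. hausdorff_outer (A i))"
proof -
  have "hausdorff_pre \<epsilon> (\<Union>i. A i) \<le> (\<Sum>i. hausdorff_outer (A i))" if "0 < \<epsilon>" for \<epsilon>
    by (rule order_trans[OF hausdorff_pre_UN])
       (intro suminf_le allI hausdorff_pre_le_outer that summableI)
  then show ?thesis by (subst hausdorff_outer_def) (auto intro: SUP_least)
qed

lemma hausdorff_outer_Un: "hausdorff_outer (A \<union> B) \<le> hausdorff_outer A + hausdorff_outer B"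
proof -
  define C where "C = (\<lambda>i::nat. if i = 0 then A else if i = 1 then B else {})"
  have "(\<Union>i. C i) = A \<union> B" by (auto simp: C_def split: if_splits)
  then have "hausdorff_outer (A \<union> B) \<le> (\<Sum>i. hausdorff_outer (C i))"
    using hausdorff_outer_UN[of C] by simp
  also have "\<dots> = (\<Sum>i\<in>{0,1}. hausdorff_outer (C i))"
    by (rule suminf_finite) (auto simp: C_def)
  finally show ?thesis by (simp add: C_def)
qed

lemma outer_measure_space_hausdorff: "outer_measure_space UNIV hausdorff_outer"
  by (auto simp: outer_measure_space_def positive_def increasing_def countably_subadditive_def
      intro: hausdorff_outer_mono hausdorff_outer_UN)

lemma measure_space_hausdorff:
  "measure_space UNIV (lambda_system UNIV UNIV hausdorff_outer) hausdorff_outer"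
  using sigma_algebra.caratheodory_lemma[OF sigma_algebra_Pow, of UNIV hausdorff_outer]
    outer_measure_space_hausdorff by simp

lemma sets_hausdorff: "sets hausdorff = lambda_system UNIV UNIV hausdorff_outer"
  unfolding hausdorff_def
  by (rule sigma_algebra.sets_measure_of_eq) (use measure_space_hausdorff measure_space_def in blast)

lemma emeasure_hausdorff: "A \<in> sets hausdorff \<Longrightarrow> emeasure hausdorff A = hausdorff_outer A"
  unfolding sets_hausdorff unfolding hausdorff_def
  using measure_space_hausdorff by (auto simp: measure_space_def intro: emeasure_measure_of_sigma)

lemma space_hausdorff [simp]: "space hausdorff = UNIV"
  by (simp add: hausdorff_def space_measure_of_conv)

lemma hausdorff_outer_metric:
  fixes A B :: "'a::metric_space set"
  assumes d: "0 < d" "\<And>x y. x \<in> A \<Longrightarrow> y \<in> B \<Longrightarrow> d \<le> dist x y"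
  shows "hausdorff_outer A + hausdorff_outer B \<le> hausdorff_outer (A \<union> B)"
proof -
  have *: "hausdorff_pre \<epsilon> A + hausdorff_pre \<epsilon> B \<le> hausdorff_pre \<epsilon> (A \<union> B)"
    if \<epsilon>: "0 < \<epsilon>" "\<epsilon> < d" for \<epsilon>
  proof -
    have "hausdorff_pre \<epsilon> A + hausdorff_pre \<epsilon> B \<le> (\<Sum>i. ennreal (diameter (U i)))"
      if U: "A \<union> B \<subseteq> (\<Union>i. U i)" "\<And>i. bounded (U i)" "\<And>i. diameter (U i) \<le> \<epsilon>"
      for U :: "nat \<Rightarrow> 'a set"
    proof -
      define V where "V = (\<lambda>S i. if U i \<inter> S = {} then {} else U i)"
      have V: "hausdorff_pre \<epsilon> S \<le> (\<Sum>i. ennreal (diameter (V S i)))" if "S \<subseteq> A \<union> B" for S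
        unfolding hausdorff_pre_def
      proof (intro INF_lower CollectI conjI allI)
        show "S \<subseteq> (\<Union>i. V S i)" using that U(1) by (fastforce simp: V_def)
      qed (use U \<epsilon> in \<open>auto simp: V_def\<close>)
      have "ennreal (diameter (V A i)) + ennreal (diameter (V B i)) \<le> ennreal (diameter (U i))" for i
      proof -
        have "U i \<inter> A = {} \<or> U i \<inter> B = {}"
        proof (rule ccontr)
          assume "\<not> ?thesis"
          then obtain x y where "x \<in> U i" "x \<in> A" "y \<in> U i" "y \<in> B" by auto
          then have "d \<le> dist x y" "dist x y \<le> diameter (U i)"
            using d diameter_bounded_bound[OF U(2)] by auto
          then show False using U(3)[of i] \<epsilon> by simp
        qed
        then show ?thesis by (auto simp: V_def)
      qed
      then have "(\<Sum>i. ennreal (diameter (V A i)) + ennreal (diameter (V B i)))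
          \<le> (\<Sum>i. ennreal (diameter (U i)))"
        by (intro suminf_le allI summableI)
      then show ?thesis
        using V[of A] V[of B] by (simp add: suminf_add[symmetric]) (meson add_mono order_trans)
    qed
    then show ?thesis
      unfolding hausdorff_pre_def[of \<epsilon> "A \<union> B"] by (intro INF_greatest) auto
  qed
  have "hausdorff_outer A + hausdorff_outer B
      = (SUP \<epsilon>\<in>{0<..}. hausdorff_pre \<epsilon> A + hausdorff_pre \<epsilon> B)"
    unfolding hausdorff_outer_def
  proof (rule SUP_add_directed_ennreal[symmetric])
    fix i j :: real assume "i \<in> {0<..}" "j \<in> {0<..}"
    then show "\<exists>k\<in>{0<..}. hausdorff_pre i A + hausdorff_pre j B
        \<le> hausdorff_pre k A + hausdorff_pre k B"
      by (intro bexI[of _ "min i j"] add_mono hausdorff_pre_antimono) auto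
  qed
  also have "\<dots> \<le> hausdorff_outer (A \<union> B)"
  proof (rule SUP_least)
    fix \<epsilon> :: real assume "\<epsilon> \<in> {0<..}"
    then have \<epsilon>: "0 < min \<epsilon> (d/2)" "min \<epsilon> (d/2) < d" using d(1) by auto
    have "hausdorff_pre \<epsilon> A + hausdorff_pre \<epsilon> B
        \<le> hausdorff_pre (min \<epsilon> (d/2)) A + hausdorff_pre (min \<epsilon> (d/2)) B"
      by (intro add_mono hausdorff_pre_antimono) auto
    also have "\<dots> \<le> hausdorff_outer (A \<union> B)"
      using *[OF \<epsilon>] hausdorff_pre_le_outer[OF \<epsilon>(1)] by (rule order_trans)
    finally show "hausdorff_pre \<epsilon> A + hausdorff_pre \<epsilon> B \<le> hausdorff_outer (A \<union> B)" .
  qed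
  finally show ?thesis .
qed

lemma closed_hausdorff:
  fixes F :: "'a::metric_space set"
  assumes "closed F"
  shows "F \<in> sets hausdorff"
proof -
  let ?m = "hausdorff_outer :: 'a set \<Rightarrow> ennreal"
  have "?m (F \<inter> A) + ?m (A - F) \<le> ?m A" if "F \<noteq> {}" and fin: "?m A < top" for A
  proof -
    define r where "r = (\<lambda>n::nat. 1 / (real n + 1))"
    define E where "E = (\<lambda>n. {x\<in>A. r n \<le> infdist x F})"
    define D where "D = (\<lambda>n. {x\<in>A. r (Suc n) \<le> infdist x F \<and> infdist x F < r n})"
    have r: "0 < r n" "r (Suc n) < r n" for n by (auto simp: r_def field_simps)
    have r_mono: "r m \<le> r n" if "n \<le> m" for m n
      using that by (auto simp: r_def field_simps)
    have gap: "r n - r m \<le> dist x y" if "r n \<le> infdist x F" "infdist y F < r m" for n m x y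
      using that infdist_triangle[of x F y] by simp
    have alternating: "(\<Sum>i<n. ?m (D (2 * i + k))) \<le> ?m (\<Union>i<n. D (2 * i + k))" for n k
    proof (induction n)
      case (Suc n)
      have "?m (\<Union>i<n. D (2 * i + k)) + ?m (D (2 * n + k))
          \<le> ?m ((\<Union>i<n. D (2 * i + k)) \<union> D (2 * n + k))"
      proof (cases n)
        case (Suc n')
        have "r (2 * n + k - 1) - r (2 * n + k) \<le> dist x y"
          if xy: "x \<in> (\<Union>i<n. D (2 * i + k))" "y \<in> D (2 * n + k)" for x y
        proof -
          obtain i where i: "i < n" "x \<in> D (2 * i + k)" using xy by blast
          then have "r (2 * n + k - 1) \<le> r (Suc (2 * i + k))" by (intro r_mono) auto
          then show ?thesis using i xy gap[of "2 * n + k - 1" x y "2 * n + k"] by (auto simp: D_def)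
        qed
        moreover have "0 < r (2 * n + k - 1) - r (2 * n + k)"
          using r(2)[of "2 * n + k - 1"] Suc by simp
        ultimately show ?thesis by (rule hausdorff_outer_metric[rotated])
      qed simp
      then have "(\<Sum>i<n. ?m (D (2 * i + k))) + ?m (D (2 * n + k))
          \<le> ?m ((\<Union>i<n. D (2 * i + k)) \<union> D (2 * n + k))"
        by (rule order_trans[OF add_right_mono[OF Suc.IH]])
      then show ?case by (simp add: lessThan_Suc Un_commute add.commute)
    qed simp
    have D_le: "(\<Sum>i. ?m (D (2 * i + k))) \<le> ?m A" for k
      by (intro suminf_le_const summableI order_trans[OF alternating] hausdorff_outer_mono)
         (auto simp: D_def)
    have tail: "(\<Sum>i. ?m (D (2 * (i + n) + 0))) + (\<Sum>i. ?m (D (2 * (i + n) + 1))) + ?m (E (2 * n))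
        \<ge> ?m (A - F)" for n
    proof -
      have "A - F \<subseteq> (\<Union>i. D (2 * (i + n) + 0)) \<union> (\<Union>i. D (2 * (i + n) + 1)) \<union> E (2 * n)"
      proof
        fix x assume x: "x \<in> A - F"
        then have "0 < infdist x F"
          using \<open>closed F\<close> \<open>F \<noteq> {}\<close> infdist_pos_not_in_closed by blast
        then obtain k where "r k < infdist x F"
          using reals_Archimedean[of "infdist x F"] unfolding r_def
          by (auto simp: inverse_eq_divide add.commute)
        then have ex: "\<exists>k. r k \<le> infdist x F" by (auto intro: less_imp_le)
        define k where "k = (LEAST k. r k \<le> infdist x F)"
        have k: "r k \<le> infdist x F" unfolding k_def using ex by (rule LeastI_ex)
        show "x \<in> (\<Union>i. D (2 * (i + n) + 0)) \<union> (\<Union>i. D (2 * (i + n) + 1)) \<union> E (2 * n)"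
        proof (cases "k \<le> 2 * n")
          case True
          then show ?thesis using k r_mono[OF True] x by (auto simp: E_def)
        next
          case False
          then obtain l where l: "k = Suc l" "2 * n \<le> l" by (cases k) auto
          have "infdist x F < r l"
            using not_less_Least[of l "\<lambda>k. r k \<le> infdist x F"] l(1) k_def by auto
          then have xl: "x \<in> D l" using k l x by (auto simp: D_def)
          obtain i where "l = 2 * (i + n) + 0 \<or> l = 2 * (i + n) + 1"
          proof
            have "l mod 2 = 0 \<or> l mod 2 = 1" "l = 2 * (l div 2) + l mod 2" "n \<le> l div 2"
              using l(2) by auto
            then show "l = 2 * (l div 2 - n + n) + 0 \<or> l = 2 * (l div 2 - n + n) + 1"
              by auto
          qed
          then show ?thesis using xl by blast
        qed
      qed
      then have "?m (A - F) \<le> ?m (\<Union>i. D (2 * (i + n) + 0)) + ?m (\<Union>i. D (2 * (i + n) + 1)) + ?m (E (2 * n))"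
        by (rule order_trans[OF hausdorff_outer_mono]) (rule order_trans[OF hausdorff_outer_Un add_right_mono[OF hausdorff_outer_Un]])
      also have "\<dots> \<le> (\<Sum>i. ?m (D (2 * (i + n) + 0))) + (\<Sum>i. ?m (D (2 * (i + n) + 1))) + ?m (E (2 * n))"
        by (intro add_mono hausdorff_outer_UN order_refl)
      finally show ?thesis .
    qed
    have EF: "?m (F \<inter> A) + ?m (E n) \<le> ?m A" for n
    proof -
      have "?m (E n) + ?m (F \<inter> A) \<le> ?m (E n \<union> (F \<inter> A))"
        using r(1)
      proof (rule hausdorff_outer_metric)
        fix x y assume "x \<in> E n" "y \<in> F \<inter> A"
        then show "r n \<le> dist x y" using infdist_le[of y F x] by (auto simp: E_def)
      qed
      also have "\<dots> \<le> ?m A" by (rule hausdorff_outer_mono) (auto simp: E_def)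
      finally show ?thesis by (simp add: add.commute)
    qed
    have bound: "?m (F \<inter> A) + ?m (A - F)
        \<le> ?m A + ((\<Sum>i. ?m (D (2 * (i + n) + 0))) + (\<Sum>i. ?m (D (2 * (i + n) + 1))))" for n
    proof -
      have "?m (F \<inter> A) + ?m (A - F) \<le> ?m (F \<inter> A) +
          ((\<Sum>i. ?m (D (2 * (i + n) + 0))) + (\<Sum>i. ?m (D (2 * (i + n) + 1))) + ?m (E (2 * n)))"
        by (intro add_left_mono tail)
      also have "\<dots> = (?m (F \<inter> A) + ?m (E (2 * n))) +
          ((\<Sum>i. ?m (D (2 * (i + n) + 0))) + (\<Sum>i. ?m (D (2 * (i + n) + 1))))"
        by (simp add: ac_simps)
      also have "\<dots> \<le> ?m A + ((\<Sum>i. ?m (D (2 * (i + n) + 0))) + (\<Sum>i. ?m (D (2 * (i + n) + 1))))"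
        by (intro add_right_mono EF)
      finally show ?thesis .
    qed
    have lim0: "(\<lambda>n. \<Sum>i. ?m (D (2 * (i + n) + k))) \<longlonglongrightarrow> 0" for k
    proof -
      define f where "f = (\<lambda>i. ?m (D (2 * i + k)))"
      have finf: "(\<Sum>i. f i) < top" using D_le[of k] fin by (simp add: f_def le_less_trans)
      have fi: "f i < top" for i using finf by (auto dest: ennreal_suminf_lessD)
      have eq: "(\<Sum>i. f (i + n)) = (\<Sum>i. f i) - (\<Sum>i<n. f i)" for n
        using suminf_offset[OF summableI, of f n] fi
        by (simp add: add.commute ennreal_add_diff_cancel_left less_top[symmetric])
      have "(\<lambda>n. (\<Sum>i. f i) - (\<Sum>i<n. f i)) \<longlonglongrightarrow> (\<Sum>i. f i) - (\<Sum>i. f i)"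
        by (intro tendsto_diff_ennreal tendsto_const summable_LIMSEQ summableI)
           (use finf in auto)
      then show ?thesis using finf eq by (simp add: f_def)
    qed
    have "(\<lambda>n. ?m A + ((\<Sum>i. ?m (D (2 * (i + n) + 0))) + (\<Sum>i. ?m (D (2 * (i + n) + 1)))))
        \<longlonglongrightarrow> ?m A + (0 + 0)"
      by (intro tendsto_add tendsto_const lim0)
    then show ?thesis
      using bound by (intro LIMSEQ_le_const[where a = "?m (F \<inter> A) + ?m (A - F)"]) auto
  qed
  then have le: "?m (F \<inter> A) + ?m (A - F) \<le> ?m A" for A
    by (cases "F = {} \<or> ?m A = top") (auto simp: less_top)
  moreover have "?m A \<le> ?m (F \<inter> A) + ?m (A - F)" for A
    using hausdorff_outer_Un[of "F \<inter> A" "A - F"] by (simp add: Int_commute Int_Diff_Un)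
  ultimately show ?thesis
    unfolding sets_hausdorff lambda_system_def
    by (auto simp: Diff_eq Int_commute intro!: antisym)
qed

lemma borel_hausdorff: "sets borel \<subseteq> sets hausdorff"
  unfolding borel_eq_closed
  using closed_hausdorff sets.sigma_sets_subset[of "Collect closed" hausdorff] by auto

section \<open>Domain and boundary\<close>

text \<open>Points of the plane are pairs \<open>(x, y)\<close>.\<close>

type_synonym pt = "real \<times> real"

definition polygonal_domain :: "pt set \<Rightarrow> bool" where
  "polygonal_domain \<Omega> \<longleftrightarrow> \<Omega> \<noteq> {} \<and> open \<Omega> \<and> connected \<Omega> \<and> bounded \<Omega> \<and>
     interior (closure \<Omega>) = \<Omega> \<and>
     (\<exists>S. finite S \<and> (\<forall>s\<in>S. \<exists>a b. s = closed_segment a b) \<and> frontier \<Omega> = \<Union>S)"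

text \<open>On a polygon an outward normal exists exactly where the boundary is locally a straight line,
  i.e. everywhere except at the finitely many corners.\<close>

definition is_normal :: "pt set \<Rightarrow> pt \<Rightarrow> pt \<Rightarrow> bool" where
  "is_normal G z n \<longleftrightarrow> norm n = 1 \<and>
     (\<exists>r>0. G \<inter> ball z r = {u\<in>ball z r. inner (u - z) n < 0})"

definition normal_at :: "pt set \<Rightarrow> pt \<Rightarrow> pt" where
  "normal_at G z = (THE n. is_normal G z n)"

abbreviation n1 :: "pt set \<Rightarrow> pt \<Rightarrow> real" where "n1 G z \<equiv> fst (normal_at G z)"
abbreviation n2 :: "pt set \<Rightarrow> pt \<Rightarrow> real" where "n2 G z \<equiv> snd (normal_at G z)"

definition regular_boundary :: "pt set \<Rightarrow> pt set" where
  "regular_boundary G = {z\<in>frontier G. \<exists>n. is_normal G z n}"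

definition boundary_zero :: "pt set \<Rightarrow> pt set" where
  "boundary_zero \<Omega> = {z\<in>regular_boundary \<Omega>. n1 \<Omega> z \<noteq> 0}"

definition boundary_minus :: "pt set \<Rightarrow> pt set" where
  "boundary_minus \<Omega> = {z\<in>regular_boundary \<Omega> - boundary_zero \<Omega>. fst z * n2 \<Omega> z < 0}"

definition boundary_plus :: "pt set \<Rightarrow> pt set" where
  "boundary_plus \<Omega> = {z\<in>regular_boundary \<Omega> - boundary_zero \<Omega>. fst z * n2 \<Omega> z \<ge> 0}"

text \<open>For mesh elements the parts with \<open>n\<^sub>1 \<noteq> 0\<close> are not removed.\<close>

definition elem_minus :: "pt set \<Rightarrow> pt set" where
  "elem_minus T = {z\<in>regular_boundary T. fst z * n2 T z < 0}"

definition elem_plus :: "pt set \<Rightarrow> pt set" where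
  "elem_plus T = {z\<in>regular_boundary T. fst z * n2 T z \<ge> 0}"

section \<open>Lebesgue and Sobolev spaces\<close>

definition L2 :: "'a measure \<Rightarrow> ('a \<Rightarrow> real) set" where
  "L2 M = {f. f \<in> borel_measurable M \<and> integrable M (\<lambda>z. (f z)\<^sup>2)}"

definition L2norm :: "'a measure \<Rightarrow> ('a \<Rightarrow> real) \<Rightarrow> real" where
  "L2norm M f = sqrt (LINT z|M. (f z)\<^sup>2)"

definition Linf_norm :: "'a measure \<Rightarrow> ('a \<Rightarrow> real) \<Rightarrow> real" where
  "Linf_norm M f = Inf {C. 0 \<le> C \<and> (AE z in M. \<bar>f z\<bar> \<le> C)}"

abbreviation arc :: "pt set \<Rightarrow> pt measure" where
  "arc S \<equiv> restrict_space hausdorff S"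

definition pdiff :: "'a::euclidean_space \<Rightarrow> ('a \<Rightarrow> real) \<Rightarrow> 'a \<Rightarrow> real" where
  "pdiff e f z = frechet_derivative f (at z) e"

primrec Ck :: "nat \<Rightarrow> ('a::euclidean_space \<Rightarrow> real) \<Rightarrow> bool" where
  "Ck 0 f = continuous_on UNIV f"
| "Ck (Suc k) f = ((\<forall>z. f differentiable (at z)) \<and> (\<forall>e\<in>Basis. Ck k (pdiff e f)))"

definition C_inf :: "('a::euclidean_space \<Rightarrow> real) set" where
  "C_inf = {f. \<forall>k. Ck k f}"

definition test_funs :: "'a::euclidean_space set \<Rightarrow> ('a \<Rightarrow> real) set" where
  "test_funs G = {\<phi>\<in>C_inf. compact (closure {z. \<phi> z \<noteq> 0}) \<and> closure {z. \<phi> z \<noteq> 0} \<subseteq> G}"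

definition is_weak_deriv :: "pt set \<Rightarrow> pt \<Rightarrow> (pt \<Rightarrow> real) \<Rightarrow> (pt \<Rightarrow> real) \<Rightarrow> bool" where
  "is_weak_deriv G e v g \<longleftrightarrow> g \<in> L2 (lebesgue_on G) \<and>
     (\<forall>\<phi>\<in>test_funs G. (LINT z|lebesgue_on G. v z * pdiff e \<phi> z)
        = - (LINT z|lebesgue_on G. g z * \<phi> z))"

text \<open>Weak derivatives are unique up to null sets, so the choice of representative is immaterial.\<close>

definition wderiv :: "pt set \<Rightarrow> pt \<Rightarrow> (pt \<Rightarrow> real) \<Rightarrow> pt \<Rightarrow> real" where
  "wderiv G e v = (SOME g. is_weak_deriv G e v g)"

abbreviation wdx :: "pt set \<Rightarrow> (pt \<Rightarrow> real) \<Rightarrow> pt \<Rightarrow> real" where "wdx G \<equiv> wderiv G (1, 0)"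
abbreviation wdy :: "pt set \<Rightarrow> (pt \<Rightarrow> real) \<Rightarrow> pt \<Rightarrow> real" where "wdy G \<equiv> wderiv G (0, 1)"

definition grad :: "pt set \<Rightarrow> (pt \<Rightarrow> real) \<Rightarrow> pt \<Rightarrow> pt" where
  "grad G v z = (wdx G v z, wdy G v z)"

definition H1 :: "pt set \<Rightarrow> (pt \<Rightarrow> real) set" where
  "H1 G = {v\<in>L2 (lebesgue_on G). \<forall>e\<in>Basis. \<exists>g. is_weak_deriv G e v g}"

definition H2 :: "pt set \<Rightarrow> (pt \<Rightarrow> real) set" where
  "H2 G = {v\<in>H1 G. \<forall>e\<in>Basis. wderiv G e v \<in> H1 G}"

definition H1_norm :: "pt set \<Rightarrow> (pt \<Rightarrow> real) \<Rightarrow> real" where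
  "H1_norm G v = sqrt ((L2norm (lebesgue_on G) v)\<^sup>2
     + (\<Sum>e\<in>Basis. (L2norm (lebesgue_on G) (wderiv G e v))\<^sup>2))"

definition H2_norm :: "pt set \<Rightarrow> (pt \<Rightarrow> real) \<Rightarrow> real" where
  "H2_norm G v = sqrt ((H1_norm G v)\<^sup>2
     + (\<Sum>e\<in>Basis. \<Sum>e'\<in>Basis. (L2norm (lebesgue_on G) (wderiv G e' (wderiv G e v)))\<^sup>2))"

text \<open>The trace is the continuous extension of the restriction map
  to the frontier of \<open>G\<close> on functions smooth up to the boundary.\<close>

definition is_trace :: "pt set \<Rightarrow> (pt \<Rightarrow> real) \<Rightarrow> (pt \<Rightarrow> real) \<Rightarrow> bool" where
  "is_trace G v g \<longleftrightarrow> v \<in> H1 G \<and> g \<in> L2 (arc (frontier G)) \<and>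
     (\<exists>\<phi>::nat \<Rightarrow> pt \<Rightarrow> real. (\<forall>k. \<phi> k \<in> C_inf) \<and>
        (\<lambda>k. L2norm (lebesgue_on G) (\<lambda>z. \<phi> k z - v z)) \<longlonglongrightarrow> 0 \<and>
        (\<forall>e\<in>Basis. (\<lambda>k. L2norm (lebesgue_on G) (\<lambda>z. pdiff e (\<phi> k) z - wderiv G e v z)) \<longlonglongrightarrow> 0) \<and>
        (\<lambda>k. L2norm (arc (frontier G)) (\<lambda>z. \<phi> k z - g z)) \<longlonglongrightarrow> 0)"

definition btrace :: "pt set \<Rightarrow> (pt \<Rightarrow> real) \<Rightarrow> pt \<Rightarrow> real" where
  "btrace G v = (SOME g. is_trace G v g)"

definition grad_trace :: "pt set \<Rightarrow> (pt \<Rightarrow> real) \<Rightarrow> pt \<Rightarrow> pt" where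
  "grad_trace G v z = (btrace G (wdx G v) z, btrace G (wdy G v) z)"

definition H1_minus :: "pt set \<Rightarrow> (pt \<Rightarrow> real) set" where
  "H1_minus \<Omega> = {v\<in>H1 \<Omega>. \<exists>g. is_trace \<Omega> v g \<and> (AE z in arc (boundary_minus \<Omega>). g z = 0)}"

section \<open>Meshes\<close>

definition open_triangle :: "pt set \<Rightarrow> bool" where
  "open_triangle T \<longleftrightarrow> (\<exists>K. 2 simplex K \<and> T = interior K)"

text \<open>Conformity (closed triangles meet in common faces only) is part of the library's
  \<^const>\<open>triangulation\<close>.\<close>

definition mesh_of :: "pt set \<Rightarrow> pt set set \<Rightarrow> bool" where
  "mesh_of \<Omega> \<T> \<longleftrightarrow> finite \<T> \<and> (\<forall>T\<in>\<T>. open_triangle T) \<and> triangulation (closure ` \<T>) \<and>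
     (\<Union>T\<in>\<T>. closure T) = closure \<Omega>"

definition incircle_diameter :: "pt set \<Rightarrow> real" where
  "incircle_diameter T = 2 * Sup {r. 0 < r \<and> (\<exists>z. ball z r \<subseteq> T)}"

definition shape_regular :: "real \<Rightarrow> pt set \<Rightarrow> bool" where
  "shape_regular \<sigma> T \<longleftrightarrow> diameter T \<le> \<sigma> * incircle_diameter T"

definition locally_quasi_uniform :: "real \<Rightarrow> pt set set \<Rightarrow> bool" where
  "locally_quasi_uniform \<mu> \<T> \<longleftrightarrow>
     (\<forall>T\<in>\<T>. \<forall>T'\<in>\<T>. (\<exists>a b. a \<noteq> b \<and> closed_segment a b \<subseteq> closure T \<inter> closure T')
        \<longrightarrow> diameter T \<le> \<mu> * diameter T')"

definition h_max :: "pt set set \<Rightarrow> real" where "h_max \<T> = Max (diameter ` \<T>)"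
definition h_min :: "pt set set \<Rightarrow> real" where "h_min \<T> = Min (diameter ` \<T>)"

definition H2_broken :: "pt set set \<Rightarrow> (pt \<Rightarrow> real) set" where
  "H2_broken \<T> = {v. \<forall>T\<in>\<T>. v \<in> H2 T}"

definition H2_broken_norm :: "pt set set \<Rightarrow> (pt \<Rightarrow> real) \<Rightarrow> real" where
  "H2_broken_norm \<T> v = sqrt (\<Sum>T\<in>\<T>. (H2_norm T v)\<^sup>2)"

text \<open>Mesh functions and elementwise gradients vanish on the mesh skeleton, a null set.\<close>

definition mesh_fun :: "pt set set \<Rightarrow> (pt set \<Rightarrow> real) \<Rightarrow> pt \<Rightarrow> real" where
  "mesh_fun \<T> f z = (\<Sum>T\<in>\<T>. indicator T z * f T)"

definition broken_grad :: "pt set set \<Rightarrow> (pt \<Rightarrow> real) \<Rightarrow> pt \<Rightarrow> pt" where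
  "broken_grad \<T> v z = (\<Sum>T\<in>\<T>. indicator T z *\<^sub>R grad T v z)"

definition poly_le :: "nat \<Rightarrow> (pt \<Rightarrow> real) set" where
  "poly_le p = {v. \<exists>c::nat \<Rightarrow> nat \<Rightarrow> real. \<forall>x y.
     v (x, y) = (\<Sum>i\<le>p. \<Sum>j\<le>p - i. c i j * x ^ i * y ^ j)}"

definition inverse_estimates :: "real \<Rightarrow> real \<Rightarrow> real \<Rightarrow> bool" where
  "inverse_estimates \<sigma> C_INV C_inv \<longleftrightarrow>
     (\<forall>T p v. open_triangle T \<and> shape_regular \<sigma> T \<and> 1 \<le> p \<and> v \<in> poly_le p \<longrightarrow>
        sqrt (\<Sum>e\<in>Basis. (L2norm (lebesgue_on T) (pdiff e v))\<^sup>2)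
          \<le> C_INV * (real p)\<^sup>2 * inverse (diameter T) * L2norm (lebesgue_on T) v \<and>
        L2norm (arc (frontier T)) v
          \<le> C_inv * real p * inverse (sqrt (diameter T)) * L2norm (lebesgue_on T) v)"

section \<open>Parameters and norms\<close>

definition delta :: "real \<Rightarrow> nat \<Rightarrow> pt set \<Rightarrow> real" where
  "delta C_inv p T = max
     (C_inv\<^sup>2 * (real p)\<^sup>2 * Linf_norm (arc (elem_minus T)) (\<lambda>z. fst z * n2 T z) / diameter T)
     (2 * (Linf_norm (arc (frontier T)) (n1 T))\<^sup>2 * C_inv ^ 4 * real p ^ 4 / (3 * (diameter T)\<^sup>2))"

definition tau :: "real \<Rightarrow> nat \<Rightarrow> pt set \<Rightarrow> real" where
  "tau C_INV p T = (diameter T)\<^sup>2 / (4 * C_INV\<^sup>2 * real p ^ 4)"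

definition alpha :: "real \<Rightarrow> real" where "alpha d = inverse (8 * d)"
definition beta :: "real \<Rightarrow> real" where "beta d = inverse (24 * d\<^sup>2)"
definition gamma :: "real \<Rightarrow> real" where "gamma d = inverse (64 * d ^ 3)"

definition A_mat :: "real \<Rightarrow> pt \<Rightarrow> pt" where
  "A_mat d \<xi> = (alpha d * fst \<xi> + beta d * snd \<xi>, beta d * fst \<xi> + gamma d * snd \<xi>)"

text \<open>Here \<open>|\<surd>A \<xi>|\<^sup>2 = \<xi> \<bullet> A \<xi>\<close> for the symmetric square root of \<open>A\<close>.\<close>

definition norm_A_sq :: "pt set \<Rightarrow> pt set set \<Rightarrow> real \<Rightarrow> nat \<Rightarrow> (pt \<Rightarrow> real) \<Rightarrow> real" where
  "norm_A_sq \<Omega> \<T> C_inv p w =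
     (let \<delta> = mesh_fun \<T> (delta C_inv p) in
      (L2norm (lebesgue_on \<Omega>) w)\<^sup>2
      + (LINT z|lebesgue_on \<Omega>. inner (grad \<Omega> w z) (A_mat (\<delta> z) (grad \<Omega> w z))))"

text \<open>The last two arguments are the values \<open>w(t)\<close> and \<open>w\<^sub>t(t)\<close>.\<close>

definition triple_norm_sq ::
  "pt set \<Rightarrow> pt set set \<Rightarrow> real \<Rightarrow> real \<Rightarrow> nat \<Rightarrow> (pt \<Rightarrow> real) \<Rightarrow> (pt \<Rightarrow> real) \<Rightarrow> real" where
  "triple_norm_sq \<Omega> \<T> C_INV C_inv p w w_t =
     (let \<delta> = mesh_fun \<T> (delta C_inv p); \<tau> = mesh_fun \<T> (tau C_INV p) in
      1/2 * (L2norm (lebesgue_on \<Omega>) (wdx \<Omega> w))\<^sup>2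
      + (L2norm (lebesgue_on \<Omega>) (\<lambda>z. sqrt (gamma (\<delta> z) * \<delta> z) * wdy \<Omega> w z))\<^sup>2
      + 1/2 * (L2norm (lebesgue_on \<Omega>) (\<lambda>z. sqrt (\<tau> z) * (w_t z + fst z * wdy \<Omega> w z)))\<^sup>2
      + (LINT z|lebesgue_on \<Omega>. inner (broken_grad \<T> (wdx \<Omega> w) z)
           (A_mat (\<delta> z) (broken_grad \<T> (wdx \<Omega> w) z)))
      + (L2norm (arc (boundary_plus \<Omega>)) (\<lambda>z. sqrt (fst z * n2 \<Omega> z) * btrace \<Omega> w z))\<^sup>2
      + (\<Sum>T\<in>\<T>. LINT z|arc (elem_plus T). fst z * n2 T z *
           inner (grad_trace T w z) (A_mat (delta C_inv p T) (grad_trace T w z))))"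

section \<open>Bochner-Sobolev functions of time\<close>

text \<open>Bochner integration for functions on \<open>I\<close> with values in a space \<open>X\<close> of real functions
  that is seminormed by \<open>N\<close>. Elements with \<open>N\<close>-distance zero represent the same element of the
  normed space. The relation \<open>step_fun I X s J\<close> says that \<open>s\<close> is an \<open>X\<close>-valued simple function
  with integral \<open>J\<close>.\<close>

definition step_fun ::
  "real set \<Rightarrow> ('a \<Rightarrow> real) set \<Rightarrow> (real \<Rightarrow> 'a \<Rightarrow> real) \<Rightarrow> ('a \<Rightarrow> real) \<Rightarrow> bool" where
  "step_fun I X s J \<longleftrightarrow> (\<exists>(m::nat) B v.
     (\<forall>k<m. B k \<in> sets lebesgue \<and> B k \<subseteq> I \<and> emeasure lebesgue (B k) < \<infinity> \<and> v k \<in> X) \<and>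
     s = (\<lambda>t z. \<Sum>k<m. indicator (B k) t * v k z) \<and>
     J = (\<lambda>z. \<Sum>k<m. measure lebesgue (B k) * v k z))"

definition strongly_measurable ::
  "real set \<Rightarrow> ('a \<Rightarrow> real) set \<Rightarrow> (('a \<Rightarrow> real) \<Rightarrow> real) \<Rightarrow> (real \<Rightarrow> 'a \<Rightarrow> real) \<Rightarrow> bool" where
  "strongly_measurable I X N f \<longleftrightarrow> (AE t in lebesgue_on I. f t \<in> X) \<and>
     (\<exists>s::nat \<Rightarrow> _. (\<forall>k. \<exists>J. step_fun I X (s k) J) \<and>
        (AE t in lebesgue_on I. (\<lambda>k. N (\<lambda>z. s k t z - f t z)) \<longlonglongrightarrow> 0))"

definition has_X_integral :: "real set \<Rightarrow> ('a \<Rightarrow> real) set \<Rightarrow> (('a \<Rightarrow> real) \<Rightarrow> real) \<Rightarrow>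
    (real \<Rightarrow> 'a \<Rightarrow> real) \<Rightarrow> ('a \<Rightarrow> real) \<Rightarrow> bool" where
  "has_X_integral I X N f J \<longleftrightarrow> strongly_measurable I X N f \<and> J \<in> X \<and>
     (\<exists>(s::nat \<Rightarrow> _) Js. (\<forall>k. step_fun I X (s k) (Js k)) \<and>
        (\<lambda>k. \<integral>\<^sup>+t. ennreal (N (\<lambda>z. s k t z - f t z)) \<partial>lebesgue_on I) \<longlonglongrightarrow> 0 \<and>
        (\<lambda>k. N (\<lambda>z. Js k z - J z)) \<longlonglongrightarrow> 0)"

definition bochner_L2 :: "real set \<Rightarrow> ('a \<Rightarrow> real) set \<Rightarrow> (('a \<Rightarrow> real) \<Rightarrow> real) \<Rightarrow>
    (real \<Rightarrow> 'a \<Rightarrow> real) \<Rightarrow> bool" where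
  "bochner_L2 I X N f \<longleftrightarrow> strongly_measurable I X N f \<and>
     integrable (lebesgue_on I) (\<lambda>t. (N (f t))\<^sup>2)"

text \<open>\<open>bochner_H1 I X N w w\<^sub>t\<close>: \<open>w\<close> belongs to \<open>H\<^sup>1(I; X)\<close> with weak derivative \<open>w\<^sub>t\<close>.\<close>

definition bochner_H1 :: "real set \<Rightarrow> ('a \<Rightarrow> real) set \<Rightarrow> (('a \<Rightarrow> real) \<Rightarrow> real) \<Rightarrow>
    (real \<Rightarrow> 'a \<Rightarrow> real) \<Rightarrow> (real \<Rightarrow> 'a \<Rightarrow> real) \<Rightarrow> bool" where
  "bochner_H1 I X N w w_t \<longleftrightarrow> bochner_L2 I X N w \<and> bochner_L2 I X N w_t \<and>
     (\<forall>\<phi>\<in>test_funs (interior I). \<exists>J.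
        has_X_integral I X N (\<lambda>t z. deriv \<phi> t * w t z) J \<and>
        has_X_integral I X N (\<lambda>t z. - \<phi> t * w_t t z) J)"

definition X_space :: "pt set \<Rightarrow> pt set set \<Rightarrow> (pt \<Rightarrow> real) set" where
  "X_space \<Omega> \<T> = H1_minus \<Omega> \<inter> H2_broken \<T>"

definition X_norm :: "pt set \<Rightarrow> pt set set \<Rightarrow> (pt \<Rightarrow> real) \<Rightarrow> real" where
  "X_norm \<Omega> \<T> v = sqrt ((H1_norm \<Omega> v)\<^sup>2 + (H2_broken_norm \<T> v)\<^sup>2)"

end

theory Submission
  imports Defs
begin

text \<open>The triple norm controls the square norm of \<open>w\<^sub>x\<close> directly, and that of \<open>w\<^sub>y\<close> with the weight
  \<open>\<gamma>\<delta> = 1/(64\<delta>\<^sup>2)\<close>. Since \<open>x\<close> and the normals are bounded, \<open>\<delta> \<le> M p\<^sup>4 / h_min\<^sup>2\<close>, so this weight is at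
  least a multiple of \<open>h_min\<^sup>4 / p\<^sup>8\<close>. On the other side, the \<open>A\<close>-weighted norm of the gradient is at
  most a multiple of its plain norm because \<open>\<delta>\<close> is bounded below: on a shape-regular triangle \<open>\<bar>n\<^sub>1\<bar>\<close>
  is bounded below on a set of positive length. The norm of \<open>w\<close> itself is absorbed by a
  Poincare-Friedrichs inequality for functions vanishing on the inflow boundary, which by the
  definition of the trace is only needed for smooth functions.\<close>

section \<open>Smooth functions along lines and under homotheties\<close>

text \<open>The constant must be fixed before the mesh, whereas the Poincare-Friedrichs inequality
  is derived with the help of a triangulation. One arbitrary triangulation of \<Omega> suffices for
  it, since the resulting inequality mentions \<Omega> alone; if \<Omega> has no triangulation, the
  claim is vacuous. The frontier is only known to be a finite union of segments, so control of the
  L2 norm is transported by explicit estimates instead of a compactness argument. Connectedness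
  alone gives no uniform constant near the boundary; finitely many convex triangles do. The boundary
  condition enters through the smooth functions approximating the trace: on a piece of the inflow
  boundary they tend to 0 in L2. Only the y-derivative forces the factor h_min^4 p^-8; as this
  factor is at most 1, the fixed weight 1/2 of the x-derivative can absorb it too.\<close>

abbreviation grad_sq :: "(pt \<Rightarrow> real) \<Rightarrow> pt \<Rightarrow> real" where
  "grad_sq \<phi> z \<equiv> (pdiff (1, 0) \<phi> z)\<^sup>2 + (pdiff (0, 1) \<phi> z)\<^sup>2"

lemma Basis_ptI: "(1, 0) \<in> (Basis :: pt set)" "(0, 1) \<in> (Basis :: pt set)"
  by (auto simp: Basis_prod_def)

lemma C_inf_differentiable: "\<phi> \<in> C_inf \<Longrightarrow> \<phi> differentiable (at z)"
  by (auto simp: C_inf_def dest!: spec[of _ "Suc 0"])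

lemma C_inf_continuous: "\<phi> \<in> C_inf \<Longrightarrow> continuous_on UNIV \<phi>"
  by (metis C_inf_def Ck.simps(1) mem_Collect_eq)

lemma C_inf_continuous_pdiff: "\<phi> \<in> C_inf \<Longrightarrow> e \<in> Basis \<Longrightarrow> continuous_on UNIV (pdiff e \<phi>)"
  by (auto simp: C_inf_def dest!: spec[of _ "Suc 0"])

lemma C_inf_measurable: "\<phi> \<in> C_inf \<Longrightarrow> \<phi> \<in> borel_measurable borel"
  by (intro borel_measurable_continuous_onI C_inf_continuous)

lemma C_inf_pdiff_measurable:
  fixes \<phi> :: "pt \<Rightarrow> real"
  assumes "\<phi> \<in> C_inf"
  shows "pdiff (1, 0) \<phi> \<in> borel_measurable borel" and "pdiff (0, 1) \<phi> \<in> borel_measurable borel"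
  by (auto intro!: borel_measurable_continuous_onI C_inf_continuous_pdiff[OF assms] Basis_ptI)

lemma C_inf_has_derivative:
  fixes \<phi> :: "pt \<Rightarrow> real"
  assumes "\<phi> \<in> C_inf"
  shows "(\<phi> has_derivative (\<lambda>d. fst d * pdiff (1, 0) \<phi> z + snd d * pdiff (0, 1) \<phi> z)) (at z)"
proof -
  let ?D = "frechet_derivative \<phi> (at z)"
  have D: "(\<phi> has_derivative ?D) (at z)"
    using C_inf_differentiable[OF assms] frechet_derivative_works by blast
  then have lin: "linear ?D" by (rule has_derivative_linear)
  have "?D d = fst d * pdiff (1, 0) \<phi> z + snd d * pdiff (0, 1) \<phi> z" for d
  proof -
    have "d = fst d *\<^sub>R (1, 0) + snd d *\<^sub>R (0, 1)" by (simp add: prod_eq_iff)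
    then have "?D d = ?D (fst d *\<^sub>R (1, 0) + snd d *\<^sub>R (0, 1))" by simp
    also have "\<dots> = fst d * ?D (1, 0) + snd d * ?D (0, 1)"
      by (simp only: linear_add[OF lin] linear_scale[OF lin] real_scaleR_def)
    finally show ?thesis by (simp add: pdiff_def)
  qed
  then have "?D = (\<lambda>d. fst d * pdiff (1, 0) \<phi> z + snd d * pdiff (0, 1) \<phi> z)" by (rule ext)
  then show ?thesis using D by simp
qed

text \<open>This is the Cauchy-Schwarz inequality for \<open>f'\<close> and 1, obtained by
  integrating the square of \<open>f' - m\<close>, where \<open>m\<close> is the mean slope.\<close>

lemma square_diff_le_integral_derivative:
  fixes f f' :: "real \<Rightarrow> real"
  assumes ab: "a < b" and f: "\<And>t. (f has_real_derivative f' t) (at t)"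
    and cont: "continuous_on UNIV f'"
  shows "(f b - f a)\<^sup>2 \<le> (b - a) * integral {a..b} (\<lambda>t. (f' t)\<^sup>2)"
proof -
  define m where "m = (f b - f a) / (b - a)"
  have FTC: "(f' has_integral (f b - f a)) {a..b}"
    using ab f by (intro fundamental_theorem_of_calculus)
      (auto simp: has_real_derivative_iff_has_vector_derivative[symmetric] intro: DERIV_subset)
  have cont': "continuous_on {a..b} f'" using cont continuous_on_subset by blast
  have sq: "((\<lambda>t. (f' t)\<^sup>2) has_integral integral {a..b} (\<lambda>t. (f' t)\<^sup>2)) {a..b}"
    by (intro integrable_integral integrable_continuous_real continuous_intros cont')
  have "((\<lambda>t. (f' t)\<^sup>2 - 2 * m * f' t + m\<^sup>2) has_integral
      (integral {a..b} (\<lambda>t. (f' t)\<^sup>2) - 2 * m * (f b - f a) + (b - a) *\<^sub>R m\<^sup>2)) {a..b}"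
    using ab by (intro has_integral_add has_integral_diff has_integral_mult_right sq FTC has_integral_const_real[THEN has_integral_eq_rhs]) auto
  then have "0 \<le> integral {a..b} (\<lambda>t. (f' t)\<^sup>2) - 2 * m * (f b - f a) + (b - a) *\<^sub>R m\<^sup>2"
  proof (rule has_integral_nonneg)
    show "0 \<le> (f' t)\<^sup>2 - 2 * m * f' t + m\<^sup>2" for t
      using zero_le_power2[of "f' t - m"] by (simp add: power2_diff algebra_simps)
  qed
  moreover have "(b - a) * m\<^sup>2 = m * (f b - f a)" "m * (f b - f a) = (f b - f a)\<^sup>2 / (b - a)"
    using ab by (auto simp: m_def power2_eq_square)
  ultimately have "(f b - f a)\<^sup>2 / (b - a) \<le> integral {a..b} (\<lambda>t. (f' t)\<^sup>2)" by simp
  then show ?thesis using ab by (simp add: field_simps)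
qed

text \<open>The increment along the line is estimated by the derivative, and the end value by twice
  the square of the start value plus twice that of the increment. Nonnegative integrals are used so
  that the estimate can be integrated over families of lines, with the order of integration
  exchanged freely.\<close>

lemma C_inf_square_le_on_line:
  fixes \<phi> :: "pt \<Rightarrow> real"
  assumes \<phi>: "\<phi> \<in> C_inf" and ab: "a < b"
  shows "ennreal ((\<phi> (p + b *\<^sub>R d))\<^sup>2) \<le> 2 * ennreal ((\<phi> (p + a *\<^sub>R d))\<^sup>2) +
    ennreal (2 * (b - a) * (norm d)\<^sup>2) *
      (\<integral>\<^sup>+t. ennreal (grad_sq \<phi> (p + t *\<^sub>R d)) * indicator {a..b} t \<partial>lborel)"
proof -
  define f where "f t = \<phi> (p + t *\<^sub>R d)" for t
  define f' where "f' t = fst d * pdiff (1, 0) \<phi> (p + t *\<^sub>R d) + snd d * pdiff (0, 1) \<phi> (p + t *\<^sub>R d)" for t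
  have cont_pd: "continuous_on UNIV (\<lambda>t. pdiff e \<phi> (p + t *\<^sub>R d))" if "e \<in> Basis" for e
    by (rule continuous_on_compose2[OF C_inf_continuous_pdiff[OF \<phi> that]])
      (auto intro!: continuous_intros)
  have cont: "continuous_on UNIV f'"
    unfolding f'_def by (intro continuous_intros cont_pd Basis_ptI)
  have cont_g: "continuous_on UNIV (\<lambda>t. grad_sq \<phi> (p + t *\<^sub>R d))"
    by (intro continuous_intros cont_pd Basis_ptI)
  have f: "(f has_real_derivative f' t) (at t)" for t
  proof -
    have "((\<lambda>t. \<phi> (p + t *\<^sub>R d)) has_derivative
      (\<lambda>s. fst (s *\<^sub>R d) * pdiff (1, 0) \<phi> (p + t *\<^sub>R d) + snd (s *\<^sub>R d) * pdiff (0, 1) \<phi> (p + t *\<^sub>R d))) (at t)"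
      by (rule has_derivative_compose[OF _ C_inf_has_derivative[OF \<phi>]]) (auto intro!: derivative_eq_intros)
    then show ?thesis unfolding has_field_derivative_def f_def f'_def
      by (rule has_derivative_eq_rhs) (auto simp: algebra_simps)
  qed
  have int_g: "(\<lambda>t. grad_sq \<phi> (p + t *\<^sub>R d)) integrable_on {a..b}"
    using cont_g by (intro integrable_continuous_real) (auto intro: continuous_on_subset)
  have "(f b - f a)\<^sup>2 \<le> (b - a) * integral {a..b} (\<lambda>t. (f' t)\<^sup>2)"
    by (rule square_diff_le_integral_derivative[OF ab f cont])
  also have "integral {a..b} (\<lambda>t. (f' t)\<^sup>2) \<le> integral {a..b} (\<lambda>t. (norm d)\<^sup>2 * grad_sq \<phi> (p + t *\<^sub>R d))"
  proof (rule integral_le)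
    show "(\<lambda>t. (f' t)\<^sup>2) integrable_on {a..b}"
      by (intro integrable_continuous_real continuous_intros continuous_on_subset[OF cont]) auto
    show "(\<lambda>t. (norm d)\<^sup>2 * grad_sq \<phi> (p + t *\<^sub>R d)) integrable_on {a..b}"
      by (rule integrable_on_mult_right[OF int_g])
    show "(f' t)\<^sup>2 \<le> (norm d)\<^sup>2 * grad_sq \<phi> (p + t *\<^sub>R d)" for t
    proof -
      \<comment> \<open>Lagrange's identity: this square is the defect in the Cauchy-Schwarz
        inequality for \<open>d\<close> and the gradient.\<close>
      have "0 \<le> (fst d * pdiff (0, 1) \<phi> (p + t *\<^sub>R d) - snd d * pdiff (1, 0) \<phi> (p + t *\<^sub>R d))\<^sup>2" by simp
      moreover have "(norm d)\<^sup>2 = (fst d)\<^sup>2 + (snd d)\<^sup>2" by (cases d) (simp add: norm_Pair)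
      ultimately show ?thesis unfolding f'_def by (simp add: power2_eq_square algebra_simps)
    qed
  qed
  also have "\<dots> = (norm d)\<^sup>2 * integral {a..b} (\<lambda>t. grad_sq \<phi> (p + t *\<^sub>R d))" by simp
  finally have 1: "(f b - f a)\<^sup>2 \<le> (b - a) * ((norm d)\<^sup>2 * integral {a..b} (\<lambda>t. grad_sq \<phi> (p + t *\<^sub>R d)))"
    using ab by simp
  have "0 \<le> (f b - 2 * f a)\<^sup>2" by simp
  then have "(f b)\<^sup>2 \<le> 2 * (f a)\<^sup>2 + 2 * (f b - f a)\<^sup>2"
    by (simp add: power2_eq_square algebra_simps)
  with 1 have 2: "(f b)\<^sup>2 \<le> 2 * (f a)\<^sup>2 + 2 * (b - a) * (norm d)\<^sup>2 * integral {a..b} (\<lambda>t. grad_sq \<phi> (p + t *\<^sub>R d))"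
    by (simp only: mult.assoc)
  have "(\<integral>\<^sup>+t. ennreal (grad_sq \<phi> (p + t *\<^sub>R d)) * indicator {a..b} t \<partial>lborel)
     = ennreal (integral {a..b} (\<lambda>t. grad_sq \<phi> (p + t *\<^sub>R d)))"
  proof -
    have "(\<integral>\<^sup>+t. ennreal (indicator {a..b} t *\<^sub>R grad_sq \<phi> (p + t *\<^sub>R d)) \<partial>lborel)
     = ennreal (integral {a..b} (\<lambda>t. grad_sq \<phi> (p + t *\<^sub>R d)))"
    proof (rule nn_integral_has_integral_lborel)
      show "(\<lambda>t. indicator {a..b} t *\<^sub>R grad_sq \<phi> (p + t *\<^sub>R d)) \<in> borel_measurable borel"
        using borel_measurable_continuous_onI[OF cont_g] by measurable
      have "((\<lambda>t. if t \<in> {a..b} then grad_sq \<phi> (p + t *\<^sub>R d) else 0) has_integral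
          integral {a..b} (\<lambda>t. grad_sq \<phi> (p + t *\<^sub>R d))) UNIV"
        using integrable_integral[OF int_g] by (simp only: has_integral_restrict_UNIV)
      then show "((\<lambda>t. indicator {a..b} t *\<^sub>R grad_sq \<phi> (p + t *\<^sub>R d)) has_integral
          integral {a..b} (\<lambda>t. grad_sq \<phi> (p + t *\<^sub>R d))) UNIV"
        by (rule has_integral_eq[rotated]) (auto simp: indicator_def)
    qed (auto simp: indicator_def)
    then show ?thesis by (rule trans[rotated]) (auto intro!: nn_integral_cong simp: indicator_def)
  qed
  moreover have "0 \<le> integral {a..b} (\<lambda>t. grad_sq \<phi> (p + t *\<^sub>R d))"
    using int_g by (rule integral_nonneg) auto
  ultimately show ?thesis
    using ennreal_leI[OF 2] ab unfolding f_def
    by (simp add: ennreal_plus ennreal_mult)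
qed

lemma nn_integral_homothety:
  fixes f :: "pt \<Rightarrow> ennreal"
  assumes [measurable]: "f \<in> borel_measurable borel" and t: "0 < t"
  shows "(\<integral>\<^sup>+z. f (a + t *\<^sub>R (z - a)) \<partial>lborel) = ennreal (inverse (t\<^sup>2)) * (\<integral>\<^sup>+z. f z \<partial>lborel)"
proof -
  have "(\<integral>\<^sup>+z. f z \<partial>lborel) =
     (\<integral>\<^sup>+z. f z \<partial>density (distr lborel borel (\<lambda>z. (a - t *\<^sub>R a) + t *\<^sub>R z)) (\<lambda>_. ennreal (\<bar>t\<bar>^DIM(pt))))"
    using lborel_affine[of t "a - t *\<^sub>R a"] t by simp
  also have "\<dots> = ennreal (t\<^sup>2) * (\<integral>\<^sup>+z. f (a + t *\<^sub>R (z - a)) \<partial>lborel)"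
    using t by (simp add: nn_integral_density nn_integral_distr nn_integral_cmult algebra_simps power2_eq_square)
  finally show ?thesis using t
    by (simp add: mult.assoc[symmetric] ennreal_mult[symmetric])
qed

text \<open>Integrate the line estimate along the homothety rays from \<open>a + \<lambda>(z - a)\<close> to \<open>z\<close>; stopping
  at ratio \<open>\<lambda>\<close> keeps the Jacobians \<open>t\<^sup>-\<^sup>2\<close> bounded.\<close>

lemma nn_integral_square_le_homothety:
  fixes \<phi> :: "pt \<Rightarrow> real"
  assumes \<phi>: "\<phi> \<in> C_inf" and l: "0 < l" "l < 1"
    and D: "convex D" "D \<in> sets borel" "a \<in> D" "\<And>z. z \<in> D \<Longrightarrow> norm (z - a) \<le> d"
    and B: "B \<in> sets borel" "\<And>z. z \<in> D \<Longrightarrow> a + l *\<^sub>R (z - a) \<in> B"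
  shows "(\<integral>\<^sup>+z. ennreal ((\<phi> z)\<^sup>2) * indicator D z \<partial>lborel) \<le>
     ennreal (2 * inverse (l\<^sup>2)) * (\<integral>\<^sup>+z. ennreal ((\<phi> z)\<^sup>2) * indicator B z \<partial>lborel) +
     ennreal (2 * d\<^sup>2 * inverse (l\<^sup>2)) * (\<integral>\<^sup>+z. ennreal (grad_sq \<phi> z) * indicator D z \<partial>lborel)"
proof -
  note [measurable] = D(2) B(1) C_inf_measurable[OF \<phi>] C_inf_pdiff_measurable[OF \<phi>]
  let ?G = "\<integral>\<^sup>+z. ennreal (grad_sq \<phi> z) * indicator D z \<partial>lborel"
  define S where "S = (\<lambda>t z. a + t *\<^sub>R (z - a))"
  have [measurable]: "(\<lambda>(z, t). S t z) \<in> borel \<Otimes>\<^sub>M borel \<rightarrow>\<^sub>M borel" "S t \<in> borel \<rightarrow>\<^sub>M borel" for t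
    unfolding S_def by measurable
  have S: "S t z \<in> D" if "z \<in> D" "0 \<le> t" "t \<le> 1" for t z
    using convexD[OF D(1) D(3) that(1), of "1 - t" t] that
    by (simp add: S_def algebra_simps)
  let ?h = "\<lambda>z t. ennreal (grad_sq \<phi> (S t z)) * indicator {l..1} t * indicator D z"
  have pt: "ennreal ((\<phi> z)\<^sup>2) * indicator D z \<le> 2 * (ennreal ((\<phi> (S l z))\<^sup>2) * indicator B (S l z)) +
     ennreal (2 * d\<^sup>2) * (\<integral>\<^sup>+t. ?h z t \<partial>lborel)" for z
  proof (cases "z \<in> D")
    case True
    have "ennreal ((\<phi> z)\<^sup>2) \<le> 2 * ennreal ((\<phi> (S l z))\<^sup>2) + ennreal (2 * (1 - l) * (norm (z - a))\<^sup>2) *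
      (\<integral>\<^sup>+t. ennreal (grad_sq \<phi> (S t z)) * indicator {l..1} t \<partial>lborel)"
      using C_inf_square_le_on_line[OF \<phi> l(2), of a "z - a"] by (simp add: S_def)
    also have "\<dots> \<le> 2 * ennreal ((\<phi> (S l z))\<^sup>2) + ennreal (2 * d\<^sup>2) *
      (\<integral>\<^sup>+t. ennreal (grad_sq \<phi> (S t z)) * indicator {l..1} t \<partial>lborel)"
    proof (intro add_left_mono mult_right_mono ennreal_leI)
      have "(1 - l) * (norm (z - a))\<^sup>2 \<le> 1 * d\<^sup>2"
        using l D(4)[OF True] by (intro mult_mono power_mono) auto
      then show "2 * (1 - l) * (norm (z - a))\<^sup>2 \<le> 2 * d\<^sup>2" by (simp only: mult.assoc)
    qed auto
    finally show ?thesis using True B(2)[OF True] by (simp add: S_def)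
  qed auto
  \<comment> \<open>Tonelli moves the ray parameter outside. For fixed \<open>t\<close> the
    homothety maps \<open>D\<close> into itself, because \<open>D\<close> is convex and contains the
    centre, so the substitution costs only the Jacobian.\<close>
  have "(\<integral>\<^sup>+z. \<integral>\<^sup>+t. ?h z t \<partial>lborel \<partial>lborel) = (\<integral>\<^sup>+t. \<integral>\<^sup>+z. ?h z t \<partial>lborel \<partial>lborel)"
    by (rule lborel_pair.Fubini') measurable
  also have "\<dots> \<le> (\<integral>\<^sup>+t. ennreal (inverse (l\<^sup>2)) * ?G * indicator {l..1} t \<partial>lborel)"
  proof (rule nn_integral_mono)
    fix t :: real
    show "(\<integral>\<^sup>+z. ?h z t \<partial>lborel) \<le> ennreal (inverse (l\<^sup>2)) * ?G * indicator {l..1} t"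
    proof (cases "t \<in> {l..1}")
      case True
      have "(\<integral>\<^sup>+z. ?h z t \<partial>lborel) \<le> (\<integral>\<^sup>+z. ennreal (grad_sq \<phi> (S t z)) * indicator D (S t z) \<partial>lborel)"
        using S[of _ t] True l by (intro nn_integral_mono) (auto simp: indicator_def)
      also have "\<dots> = ennreal (inverse (t\<^sup>2)) * ?G"
        using nn_integral_homothety[of "\<lambda>z. ennreal (grad_sq \<phi> z) * indicator D z" t a] l(1) True
        by (simp add: S_def)
      also have "\<dots> \<le> ennreal (inverse (l\<^sup>2)) * ?G"
        using True l(1) by (intro mult_right_mono ennreal_leI le_imp_inverse_le power_mono) auto
      finally show ?thesis using True by simp
    qed simp
  qed
  also have "\<dots> = ennreal (inverse (l\<^sup>2)) * ?G * ennreal (1 - l)"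
    using l by (simp add: nn_integral_cmult)
  also have "\<dots> \<le> ennreal (inverse (l\<^sup>2)) * ?G * 1"
    using l by (intro mult_left_mono) (auto simp: ennreal_1[symmetric] simp del: ennreal_1)
  finally have F: "(\<integral>\<^sup>+z. \<integral>\<^sup>+t. ?h z t \<partial>lborel \<partial>lborel) \<le> ennreal (inverse (l\<^sup>2)) * ?G" by simp
  have "(\<integral>\<^sup>+z. ennreal ((\<phi> z)\<^sup>2) * indicator D z \<partial>lborel) \<le>
    (\<integral>\<^sup>+z. 2 * (ennreal ((\<phi> (S l z))\<^sup>2) * indicator B (S l z)) +
       ennreal (2 * d\<^sup>2) * (\<integral>\<^sup>+t. ?h z t \<partial>lborel) \<partial>lborel)"
    by (rule nn_integral_mono) (rule pt)
  also have "\<dots> = 2 * (\<integral>\<^sup>+z. ennreal ((\<phi> (S l z))\<^sup>2) * indicator B (S l z) \<partial>lborel) +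
       ennreal (2 * d\<^sup>2) * (\<integral>\<^sup>+z. \<integral>\<^sup>+t. ?h z t \<partial>lborel \<partial>lborel)"
    by (simp add: nn_integral_add nn_integral_cmult)
  also have "(\<integral>\<^sup>+z. ennreal ((\<phi> (S l z))\<^sup>2) * indicator B (S l z) \<partial>lborel) =
      ennreal (inverse (l\<^sup>2)) * (\<integral>\<^sup>+z. ennreal ((\<phi> z)\<^sup>2) * indicator B z \<partial>lborel)"
    using nn_integral_homothety[of "\<lambda>z. ennreal ((\<phi> z)\<^sup>2) * indicator B z" l a] l(1)
    by (simp add: S_def)
  also have "2 * (ennreal (inverse (l\<^sup>2)) * (\<integral>\<^sup>+z. ennreal ((\<phi> z)\<^sup>2) * indicator B z \<partial>lborel)) +
      ennreal (2 * d\<^sup>2) * (\<integral>\<^sup>+z. \<integral>\<^sup>+t. ?h z t \<partial>lborel \<partial>lborel) \<le>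
      2 * (ennreal (inverse (l\<^sup>2)) * (\<integral>\<^sup>+z. ennreal ((\<phi> z)\<^sup>2) * indicator B z \<partial>lborel)) +
      ennreal (2 * d\<^sup>2) * (ennreal (inverse (l\<^sup>2)) * ?G)"
    by (intro add_left_mono mult_left_mono F) simp
  also have "\<dots> = ennreal (2 * inverse (l\<^sup>2)) * (\<integral>\<^sup>+z. ennreal ((\<phi> z)\<^sup>2) * indicator B z \<partial>lborel) +
      ennreal (2 * d\<^sup>2 * inverse (l\<^sup>2)) * ?G"
    by (simp add: ennreal_mult mult.assoc)
  finally show ?thesis .
qed

section \<open>Propagating \<open>L\<^sub>2\<close> bounds through the domain\<close>

text \<open>The constant is quantified before \<phi> but otherwise hidden: every propagation step
  replaces it by a larger one, and only its independence of \<phi> matters. The second term is the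
  L2 mass on the horizontal segment \<open>J \<times> {y0}\<close>, later a piece of the inflow
  boundary.\<close>

definition controlled :: "pt set \<Rightarrow> real set \<Rightarrow> real \<Rightarrow> pt set \<Rightarrow> bool" where
  "controlled \<Omega> J y0 A \<longleftrightarrow> (\<exists>C\<ge>0. \<forall>\<phi>\<in>C_inf.
     (\<integral>\<^sup>+z. ennreal ((\<phi> z)\<^sup>2) * indicator A z \<partial>lborel) \<le>
       ennreal C * ((\<integral>\<^sup>+z. ennreal (grad_sq \<phi> z) * indicator \<Omega> z \<partial>lborel) +
         (\<integral>\<^sup>+x. ennreal ((\<phi> (x, y0))\<^sup>2) * indicator J x \<partial>lborel)))"

lemma controlled_mono:
  assumes "controlled \<Omega> J y0 A" "B \<subseteq> A"
  shows "controlled \<Omega> J y0 B"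
proof -
  have "(\<integral>\<^sup>+z. ennreal ((\<phi> z)\<^sup>2) * indicator B z \<partial>lborel) \<le>
      (\<integral>\<^sup>+z. ennreal ((\<phi> z)\<^sup>2) * indicator A z \<partial>lborel)" for \<phi> :: "pt \<Rightarrow> real"
    using assms(2) by (intro nn_integral_mono) (auto simp: indicator_def)
  then show ?thesis using assms(1) unfolding controlled_def by (meson order_trans)
qed

text \<open>A homothety about \<open>a\<close> with small ratio squeezes the bounded set
  \<open>D\<close> into the ball where control is already available. The rays from \<open>a\<close>
  stay in \<open>D\<close> by convexity, so only the gradient inside \<Omega> is paid for.\<close>

lemma controlled_convex:
  assumes D: "convex D" "open D" "bounded D" "D \<subseteq> \<Omega>" and \<Omega>: "\<Omega> \<in> sets borel"
    and a: "a \<in> D" "0 < r" "controlled \<Omega> J y0 (ball a r)"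
  shows "controlled \<Omega> J y0 D"
proof -
  obtain d where d: "0 < d" "\<And>z. z \<in> D \<Longrightarrow> norm (z - a) \<le> d"
  proof -
    obtain b where b: "0 < b" "\<And>z. z \<in> D \<Longrightarrow> norm z \<le> b" using D(3) by (auto simp: bounded_pos)
    then have "norm (z - a) \<le> b + norm a" if "z \<in> D" for z
      using norm_triangle_ineq4[of z a] b(2)[OF that] by linarith
    then show ?thesis using that[of "b + norm a"] b(1) by (simp add: add_pos_nonneg)
  qed
  \<comment> \<open>The entry \<open>r / (2 * d)\<close> makes the image lie within distance r/2 of
    \<open>a\<close>; the entry 1/2 keeps the ratio below 1.\<close>
  define l where "l = min (1/2) (r / (2 * d))"
  have l: "0 < l" "l < 1" using d a by (auto simp: l_def)
  have "l * d < r"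
  proof -
    have "l * d \<le> r / (2 * d) * d" using d by (intro mult_right_mono) (auto simp: l_def)
    then show ?thesis using d a by simp
  qed
  then have B: "a + l *\<^sub>R (z - a) \<in> ball a r" if "z \<in> D" for z
    using le_less_trans[OF _ \<open>l * d < r\<close>] l mult_left_mono[OF d(2)[OF that], of l] by (simp add: dist_norm less_le_trans)
  obtain C where C: "0 \<le> C" "\<And>\<phi>. \<phi> \<in> C_inf \<Longrightarrow>
     (\<integral>\<^sup>+z. ennreal ((\<phi> z)\<^sup>2) * indicator (ball a r) z \<partial>lborel) \<le>
       ennreal C * ((\<integral>\<^sup>+z. ennreal (grad_sq \<phi> z) * indicator \<Omega> z \<partial>lborel) +
         (\<integral>\<^sup>+x. ennreal ((\<phi> (x, y0))\<^sup>2) * indicator J x \<partial>lborel))"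
    using a(3) unfolding controlled_def by blast
  show ?thesis unfolding controlled_def
  proof (intro exI[of _ "2 * inverse (l\<^sup>2) * C + 2 * d\<^sup>2 * inverse (l\<^sup>2)"] conjI ballI)
    fix \<phi> :: "pt \<Rightarrow> real" assume \<phi>: "\<phi> \<in> C_inf"
    let ?E = "(\<integral>\<^sup>+z. ennreal (grad_sq \<phi> z) * indicator \<Omega> z \<partial>lborel) +
         (\<integral>\<^sup>+x. ennreal ((\<phi> (x, y0))\<^sup>2) * indicator J x \<partial>lborel)"
    have "(\<integral>\<^sup>+z. ennreal (grad_sq \<phi> z) * indicator D z \<partial>lborel) \<le>
       (\<integral>\<^sup>+z. ennreal (grad_sq \<phi> z) * indicator \<Omega> z \<partial>lborel)"
      using D(4) by (intro nn_integral_mono) (auto simp: indicator_def)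
    also have "\<dots> \<le> ?E" by simp
    finally have G: "(\<integral>\<^sup>+z. ennreal (grad_sq \<phi> z) * indicator D z \<partial>lborel) \<le> ?E" .
    have "(\<integral>\<^sup>+z. ennreal ((\<phi> z)\<^sup>2) * indicator D z \<partial>lborel) \<le>
      ennreal (2 * inverse (l\<^sup>2)) * (\<integral>\<^sup>+z. ennreal ((\<phi> z)\<^sup>2) * indicator (ball a r) z \<partial>lborel) +
      ennreal (2 * d\<^sup>2 * inverse (l\<^sup>2)) * (\<integral>\<^sup>+z. ennreal (grad_sq \<phi> z) * indicator D z \<partial>lborel)"
      using D(2) by (intro nn_integral_square_le_homothety[where a = a] \<phi> l D(1) a(1) d(2) B) auto
    also have "\<dots> \<le> ennreal (2 * inverse (l\<^sup>2)) * (ennreal C * ?E) + ennreal (2 * d\<^sup>2 * inverse (l\<^sup>2)) * ?E"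
      by (intro add_mono mult_left_mono C(2) \<phi> G) auto
    also have "\<dots> = ennreal (2 * inverse (l\<^sup>2) * C + 2 * d\<^sup>2 * inverse (l\<^sup>2)) * ?E"
      using C(1) by (simp add: ennreal_plus ennreal_mult distrib_right mult.assoc)
    finally show "(\<integral>\<^sup>+z. ennreal ((\<phi> z)\<^sup>2) * indicator D z \<partial>lborel) \<le> \<dots>" .
  qed (use C in auto)
qed

text \<open>The points with a controlled neighbourhood form a clopen subset of \<Omega>. It is
  closed because a ball around a limit point, taken inside \<Omega>, contains a controlled point and
  is convex, so control spreads to the whole ball. The constant depends on \<open>z\<close>.\<close>

lemma controlled_connected:
  assumes \<Omega>: "open \<Omega>" "connected \<Omega>"
    and a: "a \<in> \<Omega>" "0 < r" "controlled \<Omega> J y0 (ball a r)"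
    and z: "z \<in> \<Omega>"
  obtains \<rho> where "0 < \<rho>" "controlled \<Omega> J y0 (ball z \<rho>)"
proof -
  define U where "U = {z\<in>\<Omega>. \<exists>\<rho>>0. controlled \<Omega> J y0 (ball z \<rho>)}"
  have opn: "\<exists>e>0. \<forall>x'\<in>\<Omega>. dist x' x < e \<longrightarrow> x' \<in> U" if xU: "x \<in> U" for x
  proof -
    obtain \<rho> where \<rho>: "0 < \<rho>" "controlled \<Omega> J y0 (ball x \<rho>)" using xU unfolding U_def by blast
    show ?thesis
    proof (intro exI[of _ "\<rho> / 2"] conjI ballI impI)
      fix x' assume x': "x' \<in> \<Omega>" "dist x' x < \<rho> / 2"
      have "ball x' (\<rho> / 2) \<subseteq> ball x \<rho>"
      proof
        fix u assume "u \<in> ball x' (\<rho> / 2)"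
        then show "u \<in> ball x \<rho>"
          using x'(2) dist_triangle[of x u x'] by (simp add: dist_commute)
      qed
      then have "controlled \<Omega> J y0 (ball x' (\<rho> / 2))" by (rule controlled_mono[OF \<rho>(2)])
      moreover have "0 < \<rho> / 2" using \<rho>(1) by simp
      ultimately show "x' \<in> U" using x'(1) unfolding U_def by blast
    qed (use \<rho> in auto)
  qed
  have cl: "x \<in> U" if x: "x \<in> \<Omega>" "\<And>e. e > 0 \<Longrightarrow> \<exists>x'\<in>U. dist x' x < e" for x
  proof -
    obtain e where e: "0 < e" "ball x e \<subseteq> \<Omega>" using \<Omega>(1) x(1) open_contains_ball by blast
    obtain x' where x': "x' \<in> U" "dist x' x < e" using x(2)[OF e(1)] by blast
    obtain \<rho> where "0 < \<rho>" "controlled \<Omega> J y0 (ball x' \<rho>)" using x'(1) unfolding U_def by blast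
    then have "controlled \<Omega> J y0 (ball x e)"
      using x'(2) e \<Omega>(1)
      by (intro controlled_convex[where D = "ball x e" and a = x' and r = \<rho>])
        (simp_all add: dist_commute)
    then show ?thesis using x(1) e(1) unfolding U_def by blast
  qed
  have "openin (top_of_set \<Omega>) U"
    unfolding openin_euclidean_subtopology_iff
  proof
    show "U \<subseteq> \<Omega>" unfolding U_def by blast
  qed (use opn in blast)
  moreover have "closedin (top_of_set \<Omega>) U"
    unfolding closedin_limpt
  proof (intro conjI allI impI)
    fix x assume "x islimpt U \<and> x \<in> \<Omega>"
    then show "x \<in> U" by (intro cl) (meson islimpt_approachable)+
  next
    show "U \<subseteq> \<Omega>" unfolding U_def by blast
  qed
  moreover have "a \<in> U" using a unfolding U_def by blast
  ultimately have "U = \<Omega>" using \<Omega>(2) unfolding connected_clopen by blast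
  then show ?thesis using z that unfolding U_def by blast
qed

text \<open>The constants of the finitely many pieces add up. Allowing a negligible remainder lets
  the open triangles replace the whole domain.\<close>

lemma controlled_finite_UN:
  assumes "finite I" "\<And>i. i \<in> I \<Longrightarrow> controlled \<Omega> J y0 (A i)" "\<And>i. i \<in> I \<Longrightarrow> A i \<in> sets borel"
    and N: "negligible (B - (\<Union>i\<in>I. A i))"
  shows "controlled \<Omega> J y0 B"
proof -
  have "\<forall>i\<in>I. \<exists>c. 0 \<le> c \<and> (\<forall>\<phi>\<in>C_inf.
     (\<integral>\<^sup>+z. ennreal ((\<phi> z)\<^sup>2) * indicator (A i) z \<partial>lborel) \<le>
       ennreal c * ((\<integral>\<^sup>+z. ennreal (grad_sq \<phi> z) * indicator \<Omega> z \<partial>lborel) +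
         (\<integral>\<^sup>+x. ennreal ((\<phi> (x, y0))\<^sup>2) * indicator J x \<partial>lborel)))"
    using assms(2) unfolding controlled_def by blast
  from bchoice[OF this] obtain C where C': "\<forall>i\<in>I. 0 \<le> C i \<and> (\<forall>\<phi>\<in>C_inf.
     (\<integral>\<^sup>+z. ennreal ((\<phi> z)\<^sup>2) * indicator (A i) z \<partial>lborel) \<le>
       ennreal (C i) * ((\<integral>\<^sup>+z. ennreal (grad_sq \<phi> z) * indicator \<Omega> z \<partial>lborel) +
         (\<integral>\<^sup>+x. ennreal ((\<phi> (x, y0))\<^sup>2) * indicator J x \<partial>lborel)))" ..
  then have C: "\<And>i. i \<in> I \<Longrightarrow> 0 \<le> C i" "\<And>i \<phi>. i \<in> I \<Longrightarrow> \<phi> \<in> C_inf \<Longrightarrow>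
     (\<integral>\<^sup>+z. ennreal ((\<phi> z)\<^sup>2) * indicator (A i) z \<partial>lborel) \<le>
       ennreal (C i) * ((\<integral>\<^sup>+z. ennreal (grad_sq \<phi> z) * indicator \<Omega> z \<partial>lborel) +
         (\<integral>\<^sup>+x. ennreal ((\<phi> (x, y0))\<^sup>2) * indicator J x \<partial>lborel))"
    by (meson bspec conjunct1, meson bspec conjunct2)
  show ?thesis unfolding controlled_def
  proof (intro exI[of _ "\<Sum>i\<in>I. C i"] conjI ballI)
    fix \<phi> :: "pt \<Rightarrow> real" assume \<phi>: "\<phi> \<in> C_inf"
    note [measurable] = C_inf_measurable[OF \<phi>] assms(3)
    let ?E = "(\<integral>\<^sup>+z. ennreal (grad_sq \<phi> z) * indicator \<Omega> z \<partial>lborel) +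
         (\<integral>\<^sup>+x. ennreal ((\<phi> (x, y0))\<^sup>2) * indicator J x \<partial>lborel)"
    have "AE z in lebesgue. z \<notin> B - (\<Union>i\<in>I. A i)"
      using N unfolding negligible_iff_null_sets by (rule AE_not_in)
    then have ae: "AE z in lborel. z \<notin> B - (\<Union>i\<in>I. A i)" by (simp only: AE_completion_iff)
    have "(\<integral>\<^sup>+z. ennreal ((\<phi> z)\<^sup>2) * indicator B z \<partial>lborel) \<le>
      (\<integral>\<^sup>+z. (\<Sum>i\<in>I. ennreal ((\<phi> z)\<^sup>2) * indicator (A i) z) \<partial>lborel)"
    proof (rule nn_integral_mono_AE, use ae in eventually_elim)
      fix z assume z: "z \<notin> B - (\<Union>i\<in>I. A i)"
      show "ennreal ((\<phi> z)\<^sup>2) * indicator B z \<le> (\<Sum>i\<in>I. ennreal ((\<phi> z)\<^sup>2) * indicator (A i) z)"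
      proof (cases "z \<in> B")
        case True
        then obtain i where "i \<in> I" "z \<in> A i" using z by blast
        then show ?thesis
          using member_le_sum[of i I "\<lambda>i. ennreal ((\<phi> z)\<^sup>2) * indicator (A i) z"] assms(1) True by simp
      qed simp
    qed
    also have "\<dots> = (\<Sum>i\<in>I. \<integral>\<^sup>+z. ennreal ((\<phi> z)\<^sup>2) * indicator (A i) z \<partial>lborel)"
      by (rule nn_integral_sum) measurable
    also have "\<dots> \<le> (\<Sum>i\<in>I. ennreal (C i) * ?E)" by (intro sum_mono C \<phi>)
    also have "\<dots> = (\<Sum>i\<in>I. ennreal (C i)) * ?E" by (simp only: sum_distrib_right)
    also have "\<dots> = ennreal (\<Sum>i\<in>I. C i) * ?E" using C(1) by (simp only: sum_ennreal)
    finally show "(\<integral>\<^sup>+z. ennreal ((\<phi> z)\<^sup>2) * indicator B z \<partial>lborel) \<le> \<dots>" .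
  qed (use C in \<open>auto intro: sum_nonneg\<close>)
qed

text \<open>Each point of \<open>R\<close> is reached by a vertical line starting on the segment at
  height \<open>y0\<close>; the sign \<open>c\<close> tells on which side of the segment the
  rectangle lies.\<close>

lemma controlled_rectangle:
  assumes c: "\<bar>c\<bar> = 1" and \<rho>: "0 < \<rho>" and J: "J \<in> sets borel" and \<Omega>: "\<Omega> \<in> sets borel"
    and R: "R = {z. fst z \<in> J \<and> 0 < c * (snd z - y0) \<and> c * (snd z - y0) < \<rho>}" "R \<subseteq> \<Omega>"
  shows "controlled \<Omega> J y0 R"
  unfolding controlled_def
\<comment> \<open>Integrating the line estimate over 0 < t < \<rho> multiplies both of its terms,
  with factors 2 and 2\<rho>, by \<rho>.\<close>
proof (intro exI[of _ "2 * \<rho> + 2 * \<rho>\<^sup>2"] conjI ballI)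
  fix \<phi> :: "pt \<Rightarrow> real" assume \<phi>: "\<phi> \<in> C_inf"
  have cc: "c * c = 1" using c by (metis abs_mult_self_eq mult_1)
  note [measurable] = C_inf_measurable[OF \<phi>] C_inf_pdiff_measurable[OF \<phi>] J \<Omega>
  have [measurable]: "R \<in> sets borel"
  proof -
    have "R = fst -` J \<inter> (\<lambda>z. c * (snd z - y0)) -` {0<..<\<rho>}" by (auto simp: R(1))
    moreover have "fst -` J \<in> sets (borel :: pt measure)" "(\<lambda>z. c * (snd z - y0)) -` {0<..<\<rho>} \<in> sets (borel :: pt measure)"
      using J by (auto intro!: measurable_sets_borel borel_measurable_continuous_onI continuous_intros)
    ultimately show ?thesis by auto
  qed
  have strip: "(\<integral>\<^sup>+z. f z * indicator R z \<partial>lborel) =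
      (\<integral>\<^sup>+x. (\<integral>\<^sup>+t. f (x, y0 + c * t) * indicator {0<..<\<rho>} t \<partial>lborel) * indicator J x \<partial>lborel)"
    if f: "f \<in> borel_measurable borel" for f :: "pt \<Rightarrow> ennreal"
  proof -
    note [measurable] = f
    have "(\<integral>\<^sup>+z. f z * indicator R z \<partial>lborel) = (\<integral>\<^sup>+x. \<integral>\<^sup>+y. f (x, y) * indicator R (x, y) \<partial>lborel \<partial>lborel)"
      unfolding lborel_prod[symmetric] by (intro lborel.nn_integral_fst[symmetric]) (simp add: lborel_prod)
    also have "\<dots> = (\<integral>\<^sup>+x. (\<integral>\<^sup>+t. f (x, y0 + c * t) * indicator {0<..<\<rho>} t \<partial>lborel) * indicator J x \<partial>lborel)"
    proof (rule nn_integral_cong)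
      fix x :: real
      have "(\<integral>\<^sup>+y. f (x, y) * indicator R (x, y) \<partial>lborel) =
        ennreal \<bar>c\<bar> * (\<integral>\<^sup>+t. f (x, y0 + c * t) * indicator R (x, y0 + c * t) \<partial>lborel)"
        using c by (intro nn_integral_real_affine) auto
      also have "\<dots> = (\<integral>\<^sup>+t. f (x, y0 + c * t) * indicator {0<..<\<rho>} t * indicator J x \<partial>lborel)"
        using c cc by (auto intro!: nn_integral_cong simp: R(1) indicator_def mult.assoc[symmetric])
      finally show "(\<integral>\<^sup>+y. f (x, y) * indicator R (x, y) \<partial>lborel) =
        (\<integral>\<^sup>+t. f (x, y0 + c * t) * indicator {0<..<\<rho>} t \<partial>lborel) * indicator J x"
        by (simp add: nn_integral_multc)
    qed
    finally show ?thesis .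
  qed
  define G where "G = (\<lambda>x. \<integral>\<^sup>+t. ennreal (grad_sq \<phi> (x, y0 + c * t)) * indicator {0<..<\<rho>} t \<partial>lborel)"
  have [measurable]: "G \<in> borel_measurable borel" unfolding G_def by measurable
  let ?E = "(\<integral>\<^sup>+z. ennreal (grad_sq \<phi> z) * indicator \<Omega> z \<partial>lborel)"
  let ?F = "(\<integral>\<^sup>+x. ennreal ((\<phi> (x, y0))\<^sup>2) * indicator J x \<partial>lborel)"
  have line: "ennreal ((\<phi> (x, y0 + c * t))\<^sup>2) \<le> 2 * ennreal ((\<phi> (x, y0))\<^sup>2) + ennreal (2 * \<rho>) * G x"
    if t: "0 < t" "t < \<rho>" for x t
  proof -
    have "ennreal ((\<phi> (x, y0 + c * t))\<^sup>2) \<le> 2 * ennreal ((\<phi> (x, y0))\<^sup>2) + ennreal (2 * t) *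
      (\<integral>\<^sup>+\<tau>. ennreal (grad_sq \<phi> (x, y0 + c * \<tau>)) * indicator {0..t} \<tau> \<partial>lborel)"
      using C_inf_square_le_on_line[OF \<phi> t(1), of "(x, y0)" "(0, c)"] c by (simp add: mult.commute)
    also have "\<dots> \<le> 2 * ennreal ((\<phi> (x, y0))\<^sup>2) + ennreal (2 * \<rho>) * G x"
    proof (intro add_left_mono mult_mono ennreal_leI)
      show "(\<integral>\<^sup>+\<tau>. ennreal (grad_sq \<phi> (x, y0 + c * \<tau>)) * indicator {0..t} \<tau> \<partial>lborel) \<le> G x"
        unfolding G_def
      proof (rule nn_integral_mono_AE)
        \<comment> \<open>The closed interval from the line estimate contains the endpoint 0, which
          the open interval in \<open>G\<close> misses.\<close>
        have "AE \<tau> in lborel. \<tau> \<noteq> (0::real)" by (rule AE_lborel_singleton)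
        then show "AE \<tau> in lborel. ennreal (grad_sq \<phi> (x, y0 + c * \<tau>)) * indicator {0..t} \<tau> \<le>
          ennreal (grad_sq \<phi> (x, y0 + c * \<tau>)) * indicator {0<..<\<rho>} \<tau>"
          by eventually_elim (use t in \<open>auto simp: indicator_def\<close>)
      qed
    qed (use t in auto)
    finally show ?thesis .
  qed
  have "(\<integral>\<^sup>+x. G x * indicator J x \<partial>lborel) = (\<integral>\<^sup>+z. ennreal (grad_sq \<phi> z) * indicator R z \<partial>lborel)"
    unfolding G_def by (rule strip[symmetric]) measurable
  also have "\<dots> \<le> ?E" using R(2) by (intro nn_integral_mono) (auto simp: indicator_def)
  finally have GE: "(\<integral>\<^sup>+x. G x * indicator J x \<partial>lborel) \<le> ?E" .
  have "(\<integral>\<^sup>+z. ennreal ((\<phi> z)\<^sup>2) * indicator R z \<partial>lborel) =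
     (\<integral>\<^sup>+x. (\<integral>\<^sup>+t. ennreal ((\<phi> (x, y0 + c * t))\<^sup>2) * indicator {0<..<\<rho>} t \<partial>lborel) * indicator J x \<partial>lborel)"
    by (rule strip) measurable
  also have "\<dots> \<le> (\<integral>\<^sup>+x. ennreal \<rho> * (2 * ennreal ((\<phi> (x, y0))\<^sup>2) + ennreal (2 * \<rho>) * G x) * indicator J x \<partial>lborel)"
  proof (intro nn_integral_mono mult_right_mono)
    fix x
    have "(\<integral>\<^sup>+t. ennreal ((\<phi> (x, y0 + c * t))\<^sup>2) * indicator {0<..<\<rho>} t \<partial>lborel) \<le>
      (\<integral>\<^sup>+t. (2 * ennreal ((\<phi> (x, y0))\<^sup>2) + ennreal (2 * \<rho>) * G x) * indicator {0<..<\<rho>} t \<partial>lborel)"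
      using line by (intro nn_integral_mono) (auto simp: indicator_def)
    also have "\<dots> = ennreal \<rho> * (2 * ennreal ((\<phi> (x, y0))\<^sup>2) + ennreal (2 * \<rho>) * G x)"
      using \<rho> by (subst nn_integral_cmult_indicator) (simp_all add: mult.commute)
    finally show "(\<integral>\<^sup>+t. ennreal ((\<phi> (x, y0 + c * t))\<^sup>2) * indicator {0<..<\<rho>} t \<partial>lborel) \<le> \<dots>" .
  qed simp
  also have "\<dots> = (\<integral>\<^sup>+x. ennreal (2 * \<rho>) * (ennreal ((\<phi> (x, y0))\<^sup>2) * indicator J x) +
      ennreal (2 * \<rho>\<^sup>2) * (G x * indicator J x) \<partial>lborel)"
    using \<rho> by (intro nn_integral_cong)
      (simp add: ennreal_mult distrib_left distrib_right power2_eq_square ac_simps)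
  also have "\<dots> = ennreal (2 * \<rho>) * ?F + ennreal (2 * \<rho>\<^sup>2) * (\<integral>\<^sup>+x. G x * indicator J x \<partial>lborel)"
    by (simp add: nn_integral_add nn_integral_cmult)
  also have "\<dots> \<le> ennreal (2 * \<rho>) * ?F + ennreal (2 * \<rho>\<^sup>2) * ?E"
    by (intro add_left_mono mult_left_mono GE) simp
  also have "\<dots> \<le> ennreal (2 * \<rho> + 2 * \<rho>\<^sup>2) * (?E + ?F)"
  proof -
    have "ennreal (2 * \<rho>) * ?F + ennreal (2 * \<rho>\<^sup>2) * ?E \<le>
       ennreal (2 * \<rho>) * (?E + ?F) + ennreal (2 * \<rho>\<^sup>2) * (?E + ?F)"
      by (intro add_mono mult_left_mono) auto
    also have "\<dots> = ennreal (2 * \<rho> + 2 * \<rho>\<^sup>2) * (?E + ?F)"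
      using \<rho> by (simp add: ennreal_plus distrib_right)
    finally show ?thesis .
  qed
  finally show "(\<integral>\<^sup>+z. ennreal ((\<phi> z)\<^sup>2) * indicator R z \<partial>lborel) \<le>
     ennreal (2 * \<rho> + 2 * \<rho>\<^sup>2) * (?E + ?F)" .
qed (use \<rho> in auto)

section \<open>Hausdorff measure of segments and uniqueness of normals\<close>

text \<open>A map with Lipschitz constant 1 sends each covering set into an interval no longer than
  its diameter. The outer measure appears on the right because \<open>B\<close> need not be known to
  be measurable.\<close>

lemma lborel_le_hausdorff_outer:
  fixes \<pi> :: "'a::metric_space \<Rightarrow> real"
  assumes lip: "\<And>u v. \<bar>\<pi> u - \<pi> v\<bar> \<le> dist u v" and A: "A \<in> sets borel" "A \<subseteq> \<pi> ` B"
  shows "emeasure lborel A \<le> hausdorff_outer B"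
proof -
  have "emeasure lborel A \<le> (\<Sum>i. ennreal (diameter (U i)))"
    if U: "B \<subseteq> (\<Union>i. U i)" "\<And>i. bounded (U i)" for U :: "nat \<Rightarrow> 'a set"
  proof -
    define a where "a = (\<lambda>i. Inf (\<pi> ` U i))"
    have ab: "\<pi> ` U i \<subseteq> {a i..a i + diameter (U i)}" for i
    proof
      fix y assume "y \<in> \<pi> ` U i"
      then obtain u where u: "u \<in> U i" "y = \<pi> u" by blast
      have *: "\<bar>\<pi> v - \<pi> v'\<bar> \<le> diameter (U i)" if "v \<in> U i" "v' \<in> U i" for v v'
        using lip[of v v'] diameter_bounded_bound[OF U(2) that] by linarith
      have low: "\<pi> u - diameter (U i) \<le> \<pi> v" if "v \<in> U i" for v
        using *[OF that u(1)] by linarith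
      then have "bdd_below (\<pi> ` U i)" by (intro bdd_belowI[of _ "\<pi> u - diameter (U i)"]) blast
      then have "a i \<le> y" unfolding a_def using u by (intro cInf_lower) auto
      moreover have "\<pi> u - diameter (U i) \<le> a i"
        unfolding a_def using u low by (intro cInf_greatest) auto
      ultimately show "y \<in> {a i..a i + diameter (U i)}" using u by simp
    qed
    have "A \<subseteq> (\<Union>i. {a i..a i + diameter (U i)})"    proof
      fix y assume "y \<in> A"
      then obtain u where u: "u \<in> B" "y = \<pi> u" using A(2) by blast
      then obtain i where "u \<in> U i" using U(1) by blast
      then show "y \<in> (\<Union>i. {a i..a i + diameter (U i)})" using ab[of i] u(2) by blast
    qed
    then have "emeasure lborel A \<le> emeasure lborel (\<Union>i. {a i..a i + diameter (U i)})" by (intro emeasure_mono) auto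
    also have "\<dots> \<le> (\<Sum>i. emeasure lborel {a i..a i + diameter (U i)})"
      by (intro emeasure_subadditive_countably) auto
    also have "\<dots> \<le> (\<Sum>i. ennreal (diameter (U i)))"
      using diameter_ge_0[OF U(2)] by (intro suminf_le allI summableI) simp
    finally show ?thesis .
  qed
  then have "emeasure lborel A \<le> hausdorff_pre 1 B"
    unfolding hausdorff_pre_def by (intro INF_greatest) auto
  then show ?thesis using hausdorff_pre_le_outer[of 1 B] by simp
qed

text \<open>Cutting the segment into \<open>N\<close> equal pieces yields covers by arbitrarily
  small sets whose diameters sum to at most its length.\<close>

lemma hausdorff_outer_segment:
  fixes a b :: "'a::real_normed_vector"
  shows "hausdorff_outer (closed_segment a b) \<le> ennreal (dist a b)"
  unfolding hausdorff_outer_def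
proof (rule SUP_least)
  fix \<epsilon> :: real assume "\<epsilon> \<in> {0<..}"
  then have \<epsilon>: "0 < \<epsilon>" by simp
  obtain N :: nat where N: "dist a b / \<epsilon> < real N" using reals_Archimedean2 by blast
  have N0: "0 < N" using N \<epsilon> by (metis divide_nonneg_pos gr0I not_le of_nat_0 zero_le_dist)
  define g where "g = (\<lambda>t. a + t *\<^sub>R (b - a))"
  define U where "U = (\<lambda>i. if i < N then g ` {real i / N..real (Suc i) / N} else {})"
  have dg: "dist (g s) (g t) = \<bar>s - t\<bar> * dist a b" for s t
    by (simp add: g_def dist_norm algebra_simps norm_minus_commute flip: scaleR_diff_left scaleR_diff_right)
  have bdd: "bounded (U i)" for i
  proof -
    have "compact (g ` {real i / N..real (Suc i) / N})"
      unfolding g_def by (intro compact_continuous_image continuous_intros) auto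
    then show ?thesis by (auto simp: U_def compact_imp_bounded)
  qed
  have diam: "diameter (U i) \<le> (if i < N then dist a b / N else 0)" for i
  proof (cases "i < N")
    case True
    have "diameter (U i) \<le> dist a b / N"
    proof (rule diameter_le)
      fix x y assume "x \<in> U i" "y \<in> U i"
      then obtain s t where st: "x = g s" "y = g t" "s \<in> {real i / N..real (Suc i) / N}" "t \<in> {real i / N..real (Suc i) / N}"
        using True by (auto simp: U_def)
      have "real (Suc i) / N = real i / N + 1 / N" by (simp add: add_divide_distrib)
      then have "\<bar>s - t\<bar> \<le> 1 / N" using st(3,4) by auto
      then have "\<bar>s - t\<bar> * dist a b \<le> 1 / N * dist a b" by (intro mult_right_mono) auto
      then show "norm (x - y) \<le> dist a b / N" using dg[of s t] st(1,2) by (simp add: dist_norm)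
    qed auto
    then show ?thesis using True by simp
  qed (simp add: U_def)
  have cov: "closed_segment a b \<subseteq> (\<Union>i. U i)"
  proof
    fix x assume "x \<in> closed_segment a b"
    then obtain t where t: "x = g t" "0 \<le> t" "t \<le> 1"
      by (auto simp: closed_segment_def g_def algebra_simps)
    show "x \<in> (\<Union>i. U i)"
    \<comment> \<open>At the endpoint the floor of \<open>t * N\<close> would be \<open>N\<close>,
      one past the last piece.\<close>
    proof (cases "t = 1")
      case True
      then have "x \<in> U (N - 1)" using N0 t by (auto simp: U_def divide_simps of_nat_diff)
      then show ?thesis by blast
    next
      case False
      define i where "i = nat \<lfloor>t * N\<rfloor>"
      have i: "real i \<le> t * N" "t * N < real i + 1" using t by (auto simp: i_def)
      have "t * real N < 1 * real N" using False t N0 by (intro mult_strict_right_mono) auto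
      then have "i < N" using i by simp
      moreover have "t \<in> {real i / N..real (Suc i) / N}" using i N0 by (auto simp: field_simps)
      ultimately have "x \<in> U i" using t by (auto simp: U_def)
      then show ?thesis by blast
    qed
  qed
  have "dist a b / N \<le> \<epsilon>" using N \<epsilon> N0 by (simp add: field_simps)
  then have "diameter (U i) \<le> \<epsilon>" for i using diam[of i] \<epsilon> by (auto split: if_splits)
  then have "hausdorff_pre \<epsilon> (closed_segment a b) \<le> (\<Sum>i. ennreal (diameter (U i)))"
    unfolding hausdorff_pre_def using cov bdd by (intro INF_lower) auto
  also have "\<dots> \<le> (\<Sum>i. ennreal (if i < N then dist a b / N else 0))"
    using diam by (intro suminf_le allI summableI ennreal_leI) auto
  also have "\<dots> = (\<Sum>i<N. ennreal (dist a b / N))"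
    by (subst suminf_finite[of "{..<N}"]) auto
  also have "\<dots> = ennreal (dist a b)" using N0 by (simp add: ennreal_of_nat_eq_real_of_nat ennreal_mult[symmetric])
  finally show "hausdorff_pre \<epsilon> (closed_segment a b) \<le> ennreal (dist a b)" .
qed

text \<open>Finite length of the boundary is what makes smooth functions square integrable on
  it.\<close>

lemma hausdorff_finite_segments:
  fixes S :: "'a::real_normed_vector set set"
  assumes "finite S" "\<forall>s\<in>S. \<exists>a b. s = closed_segment a b"
  shows "emeasure hausdorff (\<Union>S) < \<infinity>"
proof -
  have cl: "s \<in> sets hausdorff" if "s \<in> S" for s
  proof -
    have "closed s" using assms(2) that closed_segment by (metis compact_imp_closed compact_segment)
    then show ?thesis by (rule closed_hausdorff)
  qed
  have fin: "emeasure hausdorff s < \<infinity>" if s: "s \<in> S" for s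
  proof -
    obtain a b where "s = closed_segment a b" using assms(2) s by blast
    then show ?thesis using hausdorff_outer_segment[of a b] emeasure_hausdorff[OF cl[OF s]]
      by (simp add: le_less_trans)
  qed
  have "emeasure hausdorff (\<Union>s\<in>S. s) \<le> (\<Sum>s\<in>S. emeasure hausdorff s)"
    using assms(1) cl by (intro emeasure_subadditive_finite) auto
  also have "\<dots> < \<infinity>" using assms(1) fin by (simp add: ennreal_sum_less_top)
  finally show ?thesis by simp
qed

text \<open>Distinct unit vectors have inner product below 1, so a short step in direction
  \<open>n' - n\<close> goes inside according to \<open>n\<close> and outside according to
  \<open>n'\<close>.\<close>

lemma is_normal_unique:
  assumes "is_normal G z n" "is_normal G z n'"
  shows "n = n'"
proof (rule ccontr)
  assume ne: "n \<noteq> n'"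
  obtain r r' where r: "0 < r" "G \<inter> ball z r = {u\<in>ball z r. inner (u - z) n < 0}" "norm n = 1"
    and r': "0 < r'" "G \<inter> ball z r' = {u\<in>ball z r'. inner (u - z) n' < 0}" "norm n' = 1"
    using assms unfolding is_normal_def by blast
  \<comment> \<open>The vector \<open>n' - n\<close> has norm at most 2, so a step of
    \<open>e\<close> times it stays in both balls.\<close>
  define e where "e = min r r' / 4"
  have e: "0 < e" "2 * e < r" "2 * e < r'" using r(1) r'(1) by (auto simp: e_def min_def)
  have n: "inner n n = 1" "inner n' n' = 1" using r(3) r'(3) by (simp_all add: norm_eq_1)
  have "0 < inner (n - n') (n - n')" using ne by simp
  then have lt: "inner n n' < 1" using n by (simp add: inner_diff_left inner_diff_right inner_commute)
  define u where "u = z + e *\<^sub>R (n' - n)"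
  have "norm (n' - n) \<le> 2" using norm_triangle_ineq4[of n' n] r(3) r'(3) by simp
  then have "e * norm (n' - n) \<le> e * 2" using e(1) by (intro mult_left_mono) auto
  then have "e * norm (n' - n) < r" "e * norm (n' - n) < r'" using e by linarith+
  then have b: "u \<in> ball z r" "u \<in> ball z r'" using e by (simp_all add: u_def dist_norm)
  have "inner (u - z) n < 0" using e(1) lt n
    by (simp add: u_def inner_diff_left inner_diff_right inner_commute mult_pos_neg)
  then have "u \<in> G" using r(2) b(1) by blast
  then have "inner (u - z) n' < 0" using r'(2) b(2) by blast
  moreover have "inner (u - z) n' = e * (1 - inner n n')" using n
    by (simp add: u_def inner_diff_left inner_diff_right inner_commute)
  ultimately show False using e(1) lt by (simp add: mult_less_0_iff)
qed

lemma normal_at_eq: "is_normal G z n \<Longrightarrow> normal_at G z = n"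
  unfolding normal_at_def by (rule the_equality) (auto intro: is_normal_unique)

lemma regular_boundary_normal: "z \<in> regular_boundary G \<Longrightarrow> is_normal G z (normal_at G z)"
  using normal_at_eq unfolding regular_boundary_def by blast

text \<open>Where no normal exists, \<^const>\<open>normal_at\<close> is a fixed junk value; it only affects the
  constant.\<close>

definition normal_bound :: real where
  "normal_bound = max 1 (norm (THE n::pt. False))"

lemma norm_normal_at_le: "norm (normal_at G z) \<le> normal_bound"
proof (cases "\<exists>n. is_normal G z n")
  case True
  then have "norm (normal_at G z) = 1" using normal_at_eq is_normal_def by metis
  then show ?thesis by (simp add: normal_bound_def)
next
  case False
  then have "is_normal G z = (\<lambda>n. False)" by blast
  then show ?thesis by (simp add: normal_at_def normal_bound_def)
qed

section \<open>Normals of triangles\<close>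

text \<open>A 2-simplex has the affine dimension of the plane, so its interior is its relative
  interior: nonempty, and with closure the whole simplex.\<close>

lemma open_triangleE:
  assumes "open_triangle T"
  obtains K where "T = interior K" "closure T = K" "convex K" "compact K" "polyhedron K" "T \<noteq> {}"
proof -
  obtain K where K: "2 simplex K" "T = interior K" using assms unfolding open_triangle_def by blast
  have cK: "convex K" "compact K" "polyhedron K"
    using K(1) by (simp_all add: convex_simplex compact_simplex simplex_imp_polyhedron)
  have "aff_dim K = 2" using K(1) by (rule aff_dim_simplex)
  then have "interior K = rel_interior K" "K \<noteq> {}" by (auto simp: interior_rel_interior_gen)
  then have ne: "T \<noteq> {}" using K(2) cK(1) rel_interior_eq_empty by blast
  then have "closure T = K"
    using K(2) cK by (simp add: convex_closure_interior compact_imp_closed)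
  then show ?thesis using that K(2) cK ne by blast
qed

text \<open>For unit vectors the squares of the inner product and of the determinant
  \<open>D\<close> sum to 1. Hence \<open>D\<close> vanishes only for equal or opposite vectors;
  otherwise Cramer's rule gives the only possible common point.\<close>

lemma unit_lines_meet_once:
  fixes a a' :: pt
  assumes "norm a = 1" "norm a' = 1" "a' \<noteq> a" "a' \<noteq> - a"
  shows "finite {z. inner a z = b \<and> inner a' z = b'}"
proof -
  obtain a1 a2 a3 a4 where a: "a = (a1, a2)" "a' = (a3, a4)" by (cases a, cases a')
  define D where "D = a1 * a4 - a2 * a3"
  have 1: "a1\<^sup>2 + a2\<^sup>2 = 1" "a3\<^sup>2 + a4\<^sup>2 = 1" using assms(1,2) by (simp_all add: a norm_Pair)
  have "D \<noteq> 0"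
  proof
    assume D: "D = 0"
    have "(a1 * a3 + a2 * a4)\<^sup>2 + D\<^sup>2 = (a1\<^sup>2 + a2\<^sup>2) * (a3\<^sup>2 + a4\<^sup>2)"
      unfolding D_def by (simp add: power2_eq_square algebra_simps)
    then have "(a1 * a3 + a2 * a4)\<^sup>2 = 1" using D 1 by simp
    then have "a1 * a3 + a2 * a4 = 1 \<or> a1 * a3 + a2 * a4 = -1" by (simp add: power2_eq_1_iff)
    then show False
    proof
      assume "a1 * a3 + a2 * a4 = 1"
      then have "(a1 - a3)\<^sup>2 + (a2 - a4)\<^sup>2 = 0" using 1 by (simp add: power2_diff)
      then show False using assms(3) by (simp add: a sum_power2_eq_zero_iff)
    next
      assume "a1 * a3 + a2 * a4 = -1"
      then have "(a1 + a3)\<^sup>2 + (a2 + a4)\<^sup>2 = 0" using 1 by (simp add: power2_sum)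
      then have "a1 + a3 = 0 \<and> a2 + a4 = 0" by (simp only: sum_power2_eq_zero_iff)
      then show False using assms(4) by (simp add: a add_eq_0_iff)
    qed
  qed
  have "{z. inner a z = b \<and> inner a' z = b'} \<subseteq> {((b * a4 - b' * a2) / D, (a1 * b' - a3 * b) / D)}"
  proof
    fix z assume "z \<in> {z. inner a z = b \<and> inner a' z = b'}"
    moreover obtain x y where z: "z = (x, y)" by (cases z)
    ultimately have eq: "a1 * x + a2 * y = b" "a3 * x + a4 * y = b'" by (simp_all add: a)
    have "x * D = b * a4 - b' * a2" "y * D = a1 * b' - a3 * b"
      unfolding D_def eq[symmetric] by (simp_all add: algebra_simps)
    then show "z \<in> {((b * a4 - b' * a2) / D, (a1 * b' - a3 * b) / D)}"
      using \<open>D \<noteq> 0\<close> by (simp add: z field_simps)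
  qed
  then show ?thesis using finite_subset by blast
qed

text \<open>Write \<open>K\<close> as a finite intersection of half planes with unit normals. A
  boundary point whose active constraints all share one normal is regular; any other lies on two
  non-parallel bounding lines, and such pairs contribute finitely many points.\<close>

lemma finite_irregular_boundary:
  assumes K: "polyhedron K" and T: "T = interior K" "T \<noteq> {}"
  shows "finite (frontier T - regular_boundary T)"
proof -
  obtain F where F: "finite F" "K = \<Inter>F" "\<forall>h\<in>F. \<exists>a b. a \<noteq> 0 \<and> h = {x. inner a x \<le> b}"
    using K unfolding polyhedron_def by blast
  have "\<forall>h\<in>F. \<exists>p. norm (fst p) = 1 \<and> h = {x. inner (fst p) x \<le> snd p}"
  proof
    fix h assume "h \<in> F"
    then obtain a b where ab: "a \<noteq> 0" "h = {x. inner a x \<le> b}" using F(3) by blast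
    show "\<exists>p. norm (fst p) = 1 \<and> h = {x. inner (fst p) x \<le> snd p}"
      using ab by (intro exI[of _ "(inverse (norm a) *\<^sub>R a, b / norm a)"]) (auto simp: field_simps)
  qed
  from bchoice[OF this] obtain p where p: "\<forall>h\<in>F. norm (fst (p h)) = 1 \<and> h = {x. inner (fst (p h)) x \<le> snd (p h)}" ..
  define P where "P = p ` F"
  have P: "finite P" "\<And>q. q \<in> P \<Longrightarrow> norm (fst q) = 1" using F(1) p by (auto simp: P_def)
  have K_eq: "x \<in> K \<longleftrightarrow> (\<forall>q\<in>P. inner (fst q) x \<le> snd q)" for x
    using p unfolding F(2) P_def by blast
  have T_eq: "x \<in> T \<longleftrightarrow> (\<forall>q\<in>P. inner (fst q) x < snd q)" for x
  proof
    assume x: "x \<in> T"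
    show "\<forall>q\<in>P. inner (fst q) x < snd q"
    proof
      fix q assume q: "q \<in> P"
      then have "fst q \<noteq> 0" using P(2)[OF q] by auto
      moreover have "K \<subseteq> {x. inner (fst q) x \<le> snd q}" using K_eq q by blast
      ultimately have "T \<subseteq> {x. inner (fst q) x < snd q}"
        unfolding T(1) using interior_mono interior_halfspace_le by metis
      then show "inner (fst q) x < snd q" using x by blast
    qed
  next
    assume x: "\<forall>q\<in>P. inner (fst q) x < snd q"
    have "open (\<Inter>q\<in>P. {x. inner (fst q) x < snd q})"
      using P(1) by (intro open_INT) (auto intro: open_halfspace_lt)
    moreover have "(\<Inter>q\<in>P. {x. inner (fst q) x < snd q}) \<subseteq> K"
      using K_eq by (fastforce intro: less_imp_le)
    ultimately have "(\<Inter>q\<in>P. {x. inner (fst q) x < snd q}) \<subseteq> T" unfolding T(1) by (rule interior_maximal[rotated])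
    then show "x \<in> T" using x by blast
  qed
  have clK: "closure T \<subseteq> K"
    using K polyhedron_imp_closed unfolding T(1) by (metis closure_minimal interior_subset)
  have opT: "open T" unfolding T(1) by simp
  have "frontier T - regular_boundary T \<subseteq>
    (\<Union>q\<in>P. \<Union>q'\<in>{q'\<in>P. fst q' \<noteq> fst q \<and> fst q' \<noteq> - fst q}.
       {z. inner (fst q) z = snd q \<and> inner (fst q') z = snd q'})"
  proof
    fix z assume z: "z \<in> frontier T - regular_boundary T"
    then have "z \<in> closure T" and zT: "z \<notin> T"
      using opT unfolding frontier_def by (simp_all add: interior_open)
    then have "z \<in> K" using clK by blast
    then have zK: "\<forall>q\<in>P. inner (fst q) z \<le> snd q" using K_eq by blast
    obtain q where q0: "q \<in> P" "\<not> inner (fst q) z < snd q" using T_eq zT by blast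
    moreover have "inner (fst q) z \<le> snd q" using zK q0(1) by blast
    ultimately have q: "q \<in> P" "inner (fst q) z = snd q" by auto
    show "z \<in> (\<Union>q\<in>P. \<Union>q'\<in>{q'\<in>P. fst q' \<noteq> fst q \<and> fst q' \<noteq> - fst q}.
       {z. inner (fst q) z = snd q \<and> inner (fst q') z = snd q'})"
    proof (rule ccontr)
      assume neg: "\<not> ?thesis"
      have act: "fst q' = fst q" if q': "q' \<in> P" "inner (fst q') z = snd q'" for q'
      proof (rule ccontr)
        \<comment> \<open>The normals can then only be opposite. Both constraints being active at
          \<open>z\<close>, a point of \<open>T\<close> would lie strictly on both sides of the same
          line, although \<open>T\<close> is nonempty.\<close>
        assume "fst q' \<noteq> fst q"
        then have "fst q' = - fst q" using neg q q' by blast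
        moreover obtain u where "u \<in> T" using T(2) by blast
        moreover from this have "inner (fst q) u < snd q" "inner (fst q') u < snd q'"
          using T_eq q(1) q'(1) by blast+
        ultimately show False using q(2) q'(2) by (simp add: inner_minus_left)
      qed
      \<comment> \<open>Constraints inactive at \<open>z\<close> stay strict in a small ball, so
        there the single active normal describes \<open>T\<close>.\<close>
      have "open (\<Inter>q'\<in>{q'\<in>P. inner (fst q') z \<noteq> snd q'}. {x. inner (fst q') x < snd q'})"
        using P(1) by (intro open_INT) (auto intro: open_halfspace_lt)
      moreover have "z \<in> (\<Inter>q'\<in>{q'\<in>P. inner (fst q') z \<noteq> snd q'}. {x. inner (fst q') x < snd q'})"
        using zK by (auto simp del: split_paired_All intro: le_neq_trans)
      ultimately obtain r where r: "0 < r"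
        "ball z r \<subseteq> (\<Inter>q'\<in>{q'\<in>P. inner (fst q') z \<noteq> snd q'}. {x. inner (fst q') x < snd q'})"
        unfolding open_contains_ball by blast
      have eq: "inner (u - z) (fst q) = inner (fst q) u - inner (fst q) z" for u
        by (subst inner_commute) (rule inner_diff_right)
      have "T \<inter> ball z r = {u\<in>ball z r. inner (u - z) (fst q) < 0}"
      proof (intro set_eqI iffI)
        fix u assume "u \<in> T \<inter> ball z r"
        then show "u \<in> {u\<in>ball z r. inner (u - z) (fst q) < 0}"
          using T_eq[of u] q by (auto simp: eq)
      next
        fix u assume u: "u \<in> {u\<in>ball z r. inner (u - z) (fst q) < 0}"
        have "inner (fst q') u < snd q'" if q': "q' \<in> P" for q'
        proof (cases "inner (fst q') z = snd q'")
          case True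
          then show ?thesis using act[OF q' True] u by (simp add: eq)
        next
          case False
          then show ?thesis using r(2) u q' by blast
        qed
        then show "u \<in> T \<inter> ball z r" using T_eq u by blast
      qed
      then have "is_normal T z (fst q)" using r(1) P(2)[OF q(1)] unfolding is_normal_def by blast
      then show False using z unfolding regular_boundary_def by blast
    qed
  qed
  moreover have "finite (\<Union>q\<in>P. \<Union>q'\<in>{q'\<in>P. fst q' \<noteq> fst q \<and> fst q' \<noteq> - fst q}.
       {z. inner (fst q) z = snd q \<and> inner (fst q') z = snd q'})"
    using P by (auto intro!: finite_UN_I unit_lines_meet_once)
  ultimately show ?thesis by (rule finite_subset)
qed

text \<open>On the part of the boundary to the right of an inscribed ball, convexity forces the normal
  to have a horizontal component comparable to the ratio of the radius and the diameter.\<close>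

lemma convex_normal_lower_bound:
  assumes T: "convex T" "open T" "bounded T" and c: "ball c r \<subseteq> T" "0 < r"
    and z: "z \<in> frontier T" "is_normal T z n" "fst c < fst z" "\<bar>snd z - snd c\<bar> < r / 2"
  shows "r / 4 < diameter T * \<bar>fst n\<bar>"
proof -
  obtain \<rho> where \<rho>: "0 < \<rho>" "T \<inter> ball z \<rho> = {u\<in>ball z \<rho>. inner (u - z) n < 0}" "norm n = 1"
    using z(2) unfolding is_normal_def by blast
  have zc: "z \<in> closure T" using z(1) by (simp add: frontier_def)
  \<comment> \<open>Convexity makes the local half plane global: moving from \<open>z\<close> a
    little towards \<open>u\<close> stays in \<open>T\<close> and lands in the ball where the normal
    is known.\<close>
  have sup: "inner (u - z) n < 0" if u: "u \<in> T" for u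
  proof -
    have "z \<noteq> u" using z(1) T(2) u by (auto simp: frontier_def interior_open)
    define t where "t = min (1/2) (\<rho> / (2 * norm (u - z)))"
    have nz: "0 < norm (u - z)" using \<open>z \<noteq> u\<close> by simp
    have t: "0 < t" "t < 1" using \<rho>(1) nz by (auto simp: t_def)
    have "t * norm (u - z) \<le> \<rho> / (2 * norm (u - z)) * norm (u - z)"
      using nz by (intro mult_right_mono) (auto simp: t_def)
    then have t2: "t * norm (u - z) < \<rho>" using nz \<rho>(1) by simp
    define v where "v = z + t *\<^sub>R (u - z)"
    have "v \<in> open_segment u z"
      unfolding in_segment using t \<open>z \<noteq> u\<close>
      by (intro conjI exI[of _ "1 - t"]) (auto simp: v_def algebra_simps)
    then have "v \<in> T" using in_interior_closure_convex_segment[OF T(1) _ zc, of u] T(2) u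
      by (auto simp: interior_open)
    moreover have "v \<in> ball z \<rho>" using t t2 by (simp add: v_def dist_norm)
    ultimately have "inner (v - z) n < 0" using \<rho>(2) by blast
    then show ?thesis using t by (simp add: v_def mult_less_0_iff)
  qed
  \<comment> \<open>The point level with \<open>z\<close> and vertically aligned with
    \<open>c\<close> is within r/2 of \<open>c\<close>, so pushing it by r/4 along \<open>n\<close>
    stays in the ball. That it is still on the inner side of the boundary line is the lower
    bound.\<close>
  define u where "u = (fst c, snd z) + (r / 4) *\<^sub>R n"
  have "dist c u \<le> dist c (fst c, snd z) + dist (fst c, snd z) u" by (rule dist_triangle)
  also have "dist c (fst c, snd z) = \<bar>snd z - snd c\<bar>" by (cases c) (simp add: dist_Pair_Pair dist_real_def abs_minus_commute)
  also have "dist (fst c, snd z) u = r / 4" using \<rho>(3) c(2) by (simp add: u_def dist_norm)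
  finally have "u \<in> ball c r" using z(4) c(2) by simp
  then have "inner (u - z) n < 0" using c(1) sup by blast
  moreover have "inner (u - z) n = (fst c - fst z) * fst n + r / 4"
  proof -
    have "u - z = (fst c - fst z, 0) + (r / 4) *\<^sub>R n" by (simp add: u_def prod_eq_iff)
    moreover have "inner n n = 1" using \<rho>(3) by (simp add: norm_eq_1)
    ultimately show ?thesis by (simp add: inner_add_left) (simp add: inner_prod_def)
  qed
  ultimately have 1: "r / 4 < (fst z - fst c) * fst n" by (simp add: algebra_simps)
  have "(fst c, snd z) \<in> ball c r" using z(4) c(2)
    by (cases c) (simp add: dist_Pair_Pair dist_real_def abs_minus_commute)
  then have "(fst c, snd z) \<in> closure T" using c(1) closure_subset by blast
  then have "dist (fst c, snd z) z \<le> diameter (closure T)"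
    using zc T(3) by (intro diameter_bounded_bound) auto
  moreover have "dist (fst c, snd z) z = fst z - fst c"
    using z(3) by (cases z) (simp add: dist_Pair_Pair dist_real_def)
  ultimately have "fst z - fst c \<le> diameter T" using T(3) by (simp add: diameter_closure)
  then have "(fst z - fst c) * \<bar>fst n\<bar> \<le> diameter T * \<bar>fst n\<bar>" by (rule mult_right_mono) simp
  moreover have "(fst z - fst c) * fst n \<le> (fst z - fst c) * \<bar>fst n\<bar>"
    using z(3) by (intro mult_left_mono) auto
  ultimately show ?thesis using 1 by linarith
qed

lemma diameter_open_pos:
  fixes T :: "pt set"
  assumes "open T" "bounded T" "T \<noteq> {}"
  shows "0 < diameter T"
proof -
  obtain c where c: "c \<in> T" using assms(3) by blast
  obtain r where r: "0 < r" "ball c r \<subseteq> T" using assms(1) c open_contains_ball by blast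
  have "c + (r / 2, 0) \<in> T" using r by (intro subsetD[OF r(2)]) (simp add: dist_norm norm_Pair)
  then have "dist c (c + (r / 2, 0)) \<le> diameter T" using c assms(2) by (intro diameter_bounded_bound) auto
  then show ?thesis using r(1) by (simp add: dist_norm norm_Pair)
qed

text \<open>Horizontal rays to the right, started at heights within r/2 of the ball's centre, hit
  the frontier at regular points for all but finitely many heights, and there the horizontal normal
  component exceeds the bound. Were the essential supremum smaller, a null set would project onto
  almost all of an interval of length \<open>r\<close>, but projections do not increase
  length.\<close>

lemma Linf_norm_n1_lower_bound:
  assumes T: "convex T" "open T" "bounded T" "finite (frontier T - regular_boundary T)"
    and c: "ball c r \<subseteq> T" "0 < r"
  shows "r / (4 * diameter T) \<le> Linf_norm (arc (frontier T)) (n1 T)"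
  unfolding Linf_norm_def
proof (rule cInf_greatest)
  have "\<bar>n1 T z\<bar> \<le> normal_bound" for z
    using norm_fst_le[of "n1 T z" "n2 T z"] norm_normal_at_le[of T z] by simp
  then show "{C. 0 \<le> C \<and> (AE z in arc (frontier T). \<bar>n1 T z\<bar> \<le> C)} \<noteq> {}"
    by (auto simp: normal_bound_def intro!: exI[of _ normal_bound])
next
  fix C assume "C \<in> {C. 0 \<le> C \<and> (AE z in arc (frontier T). \<bar>n1 T z\<bar> \<le> C)}"
  then have C: "0 \<le> C" "AE z in arc (frontier T). \<bar>n1 T z\<bar> \<le> C" by auto
  show "r / (4 * diameter T) \<le> C"
  proof (rule ccontr)
    assume less: "\<not> r / (4 * diameter T) \<le> C"
    have cT: "c \<in> T" using c by auto
    then have dpos: "0 < diameter T" using diameter_open_pos[OF T(2,3)] by blast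
    have "AE z in hausdorff. z \<in> frontier T \<longrightarrow> \<bar>n1 T z\<bar> \<le> C"
      using C(2) by (subst (asm) AE_restrict_space_iff) (auto intro: closed_hausdorff)
    then obtain N where N: "{z. \<not> (z \<in> frontier T \<longrightarrow> \<bar>n1 T z\<bar> \<le> C)} \<subseteq> N"
      "emeasure hausdorff N = 0" "N \<in> sets hausdorff"
      by (auto elim!: AE_E)
    define E where "E = snd ` (frontier T - regular_boundary T)"
    define I where "I = {snd c - r / 2<..<snd c + r / 2}"
    define Z where "Z = {z\<in>frontier T \<inter> regular_boundary T. fst c < fst z \<and> \<bar>snd z - snd c\<bar> < r / 2}"
    have "I - E \<subseteq> snd ` Z"
    proof
      fix y assume y: "y \<in> I - E"
      then have "(fst c, y) \<in> ball c r" using c(2)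
        by (cases c) (auto simp: I_def dist_Pair_Pair dist_real_def)
      then have "(fst c, y) \<in> interior T" using c(1) T(2) by (auto simp: interior_open)
      moreover have "(1, 0) \<noteq> (0 :: pt)" by (simp add: zero_prod_def)
      ultimately obtain d where d: "0 < d" "(fst c, y) + d *\<^sub>R (1, 0) \<in> frontier T"
        using ray_to_frontier[OF T(3)] by blast
      then have fr: "(fst c + d, y) \<in> frontier T" by simp
      then have "(fst c + d, y) \<in> regular_boundary T" using y by (force simp: E_def)
      moreover have "snd c - r / 2 < y" "y < snd c + r / 2" using y by (auto simp: I_def)
      then have "\<bar>y - snd c\<bar> < r / 2" by linarith
      ultimately have "(fst c + d, y) \<in> Z" using fr d(1) by (simp add: Z_def)
      then show "y \<in> snd ` Z" by force
    qed
    moreover have "finite E" using T(4) by (simp add: E_def)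
    then have "I - E \<in> sets borel" by (auto simp: I_def finite_imp_closed)
    ultimately have "emeasure lborel (I - E) \<le> hausdorff_outer Z"
    proof (intro lborel_le_hausdorff_outer[where \<pi> = snd])
      show "\<bar>snd u - snd v\<bar> \<le> dist u v" for u v :: pt
        using dist_snd_le[of u v] by (simp add: dist_real_def)
    qed
    also have "hausdorff_outer Z \<le> hausdorff_outer N"
    proof (rule hausdorff_outer_mono, rule subsetI)
      fix z assume z: "z \<in> Z"
      then have "is_normal T z (normal_at T z)" by (auto simp: Z_def intro: regular_boundary_normal)
      then have "r / 4 < diameter T * \<bar>n1 T z\<bar>"
        using z by (intro convex_normal_lower_bound[OF T(1-3) c]) (auto simp: Z_def)
      then have "r / (4 * diameter T) < \<bar>n1 T z\<bar>" using dpos by (simp add: field_simps)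
      then show "z \<in> N" using less N(1) z by (force simp: Z_def)
    qed

    also have "\<dots> = 0" using N emeasure_hausdorff by metis
    finally have "emeasure lborel (I - E) = 0" by simp
    moreover have "E \<in> null_sets lborel" using \<open>finite E\<close> by (rule finite_imp_null_set_lborel)
    then have "emeasure lborel (I - E) = emeasure lborel I"
      by (intro emeasure_Diff_null_set) (auto simp: I_def)
    moreover have "emeasure lborel I = ennreal r" using c(2) by (simp add: I_def)
    ultimately show False using c(2) by simp
  qed
qed

section \<open>The inflow boundary and the mesh\<close>

lemma borel_measurable_hausdorff:
  "f \<in> borel_measurable borel \<Longrightarrow> f \<in> borel_measurable hausdorff"
  using borel_hausdorff by (auto simp: measurable_def)

text \<open>Lebesgue measure on \<open>J\<close> is dominated by the push-forward, under the first
  coordinate, of the length measure on the segment, because that projection is 1-Lipschitz.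
  Monotonicity of the integral in the measure does the rest.\<close>

lemma nn_integral_segment_le_hausdorff:
  fixes f :: "real \<Rightarrow> ennreal" and y0 :: real
  assumes [measurable]: "f \<in> borel_measurable borel" "J \<in> sets borel"
  shows "(\<integral>\<^sup>+x. f x * indicator J x \<partial>lborel) \<le>
    (\<integral>\<^sup>+z. f (fst z) * indicator (J \<times> {y0}) z \<partial>hausdorff)"
proof -
  have JS: "J \<times> {y0} \<in> sets (borel :: pt measure)" by (rule borel_Times) auto
  then have S: "J \<times> {y0} \<in> sets hausdorff" using borel_hausdorff by blast
  have fst_m: "fst \<in> borel_measurable (arc (J \<times> {y0}))"
    by (intro measurable_restrict_space1 borel_measurable_hausdorff) (auto intro!: borel_measurable_continuous_onI continuous_intros)
  let ?M = "density lborel (indicator J :: real \<Rightarrow> ennreal)" and ?N = "distr (arc (J \<times> {y0})) borel fst"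
  have "?M \<le> ?N"
  proof (subst le_measure, simp, intro ballI)
    fix A :: "real set" assume "A \<in> sets ?M"
    then have A[measurable]: "A \<in> sets borel" by simp
    have "fst -` A \<inter> (J \<times> {y0}) = (A \<inter> J) \<times> {y0}" by auto
    moreover have "(A \<inter> J) \<times> {y0} \<in> sets (borel :: pt measure)" by (rule borel_Times) auto
    then have "emeasure hausdorff ((A \<inter> J) \<times> {y0}) = hausdorff_outer ((A \<inter> J) \<times> {y0})"
      using borel_hausdorff emeasure_hausdorff by blast
    moreover have "emeasure (arc (J \<times> {y0})) ((A \<inter> J) \<times> {y0}) = emeasure hausdorff ((A \<inter> J) \<times> {y0})"
      using S by (intro emeasure_restrict_space) auto
    ultimately have N: "emeasure ?N A = hausdorff_outer ((A \<inter> J) \<times> {y0})"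
      using fst_m A by (simp add: emeasure_distr space_restrict_space)
    have "emeasure ?M A = (\<integral>\<^sup>+x. indicator J x * indicator A x \<partial>lborel)"
      by (rule emeasure_density) auto
    also have "\<dots> = (\<integral>\<^sup>+x. indicator (A \<inter> J) x \<partial>lborel)"
      by (intro nn_integral_cong) (simp split: split_indicator)
    also have "\<dots> = emeasure lborel (A \<inter> J)" by simp
    also have "\<dots> \<le> hausdorff_outer ((A \<inter> J) \<times> {y0})"
    proof (rule lborel_le_hausdorff_outer[where \<pi> = fst])
      show "\<bar>fst u - fst v\<bar> \<le> dist u v" for u v :: pt
        using dist_fst_le[of u v] by (simp add: dist_real_def)
    qed auto
    finally show "emeasure ?M A \<le> emeasure ?N A" using N by simp
  qed
  then have "nn_integral ?M f \<le> nn_integral ?N f" by (intro nn_integral_mono_measure) auto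
  moreover have "nn_integral ?M f = (\<integral>\<^sup>+x. f x * indicator J x \<partial>lborel)"
    by (simp add: nn_integral_density mult.commute)
  moreover have "nn_integral ?N f = (\<integral>\<^sup>+z. f (fst z) * indicator (J \<times> {y0}) z \<partial>hausdorff)"
    using fst_m S by (simp add: nn_integral_distr nn_integral_restrict_space)
  ultimately show ?thesis by simp
qed

text \<open>Inside an open ball, closure and openness depend only on the part of the set in that
  ball, and there \<open>G\<close> is a half plane.\<close>

lemma frontier_near_normal:
  fixes G :: "pt set"
  assumes G: "open G" "G \<inter> ball z r = {u\<in>ball z r. inner (u - z) n < 0}" "norm n = 1"
    and u: "u \<in> ball z r"
  shows "u \<in> frontier G \<longleftrightarrow> inner (u - z) n = 0"
proof -
  define H where "H = {v. inner n v < inner n z}"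
  have eq: "inner (v - z) n = inner n v - inner n z" for v
    by (subst inner_commute) (rule inner_diff_right)
  have n0: "n \<noteq> 0" using G(3) by auto
  have "v \<in> G \<longleftrightarrow> v \<in> H" if "v \<in> ball z r" for v
  proof -
    have "v \<in> G \<inter> ball z r \<longleftrightarrow> v \<in> {u\<in>ball z r. inner (u - z) n < 0}" by (simp only: G(2))
    then show ?thesis using that unfolding H_def eq by simp
  qed
  then have GH: "ball z r \<inter> G = ball z r \<inter> H" by blast
  have sub: "ball z r \<inter> closure A \<subseteq> closure B" if "ball z r \<inter> A \<subseteq> B" for A B
    using open_Int_closure_subset[OF open_ball, of z r A] closure_mono[OF that] by (rule order_trans)
  have "ball z r \<inter> closure G \<subseteq> closure H" using GH by (intro sub) auto
  moreover have "ball z r \<inter> closure H \<subseteq> closure G" unfolding H_def[symmetric] using GH by (intro sub) auto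
  ultimately have "u \<in> closure G \<longleftrightarrow> u \<in> closure H" using u by (meson IntI subsetD)
  moreover have "u \<in> G \<longleftrightarrow> u \<in> H" using u GH by blast
  moreover have "open H" unfolding H_def by (rule open_halfspace_lt)
  ultimately have "u \<in> frontier G \<longleftrightarrow> u \<in> frontier H"
    using G(1) by (simp add: frontier_def interior_open)
  also have "\<dots> \<longleftrightarrow> inner n u = inner n z" using n0 by (simp add: H_def frontier_halfspace_lt)
  finally show ?thesis by (simp add: eq)
qed

text \<open>On the inflow boundary the normal is vertical, so the boundary is locally a horizontal
  segment with constant normal. The last property makes the inflow part relatively open in the
  frontier.\<close>

lemma boundary_minus_local:
  assumes \<Omega>: "open \<Omega>" and z: "z \<in> boundary_minus \<Omega>"
  obtains \<rho> c where "0 < \<rho>" "\<bar>c\<bar> = 1"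
    "\<And>u. u \<in> ball z (2 * \<rho>) \<Longrightarrow> snd u = snd z \<Longrightarrow> u \<in> boundary_minus \<Omega>"
    "\<And>u. u \<in> ball z (2 * \<rho>) \<Longrightarrow> 0 < c * (snd u - snd z) \<Longrightarrow> u \<in> \<Omega>"
    "frontier \<Omega> \<inter> ball z \<rho> \<subseteq> boundary_minus \<Omega>"
proof -
  define n where "n = normal_at \<Omega> z"
  have n: "is_normal \<Omega> z n" "fst n = 0" "fst z * snd n < 0"
    using z regular_boundary_normal unfolding n_def boundary_minus_def boundary_zero_def by blast+
  obtain r where r: "0 < r" "\<Omega> \<inter> ball z r = {u\<in>ball z r. inner (u - z) n < 0}" "norm n = 1"
    using n(1) unfolding is_normal_def by blast
  have n2: "\<bar>snd n\<bar> = 1" using r(3) n(2) by (cases n) (simp add: norm_Pair abs_square_eq_1)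
  have inn: "inner (u - z) n = (snd u - snd z) * snd n" for u
    using n(2) by (simp add: inner_prod_def)
  \<comment> \<open>Within distance \<open>\<bar>fst z\<bar>\<close> of \<open>z\<close> the first
    coordinate keeps its sign, hence so does its product with the constant normal component.\<close>
  define \<rho> where "\<rho> = min r \<bar>fst z\<bar> / 2"
  have "fst z \<noteq> 0" using n(3) by auto
  then have \<rho>: "0 < \<rho>" "2 * \<rho> \<le> r" "2 * \<rho> \<le> \<bar>fst z\<bar>" using r(1) by (auto simp: \<rho>_def)
  have bm: "u \<in> boundary_minus \<Omega>" if u: "u \<in> ball z (2 * \<rho>)" "snd u = snd z" for u
  proof -
    have ur: "u \<in> ball z r" using u(1) \<rho>(2) by auto
    have inu: "inner (v - u) n = inner (v - z) n" for v
      using u(2) n(2) by (simp add: inner_prod_def)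
    have sub: "ball u (r - dist z u) \<subseteq> ball z r"
    proof
      fix v assume "v \<in> ball u (r - dist z u)"
      then show "v \<in> ball z r" using dist_triangle[of z v u] by simp
    qed
    have "u \<in> frontier \<Omega>"
      using frontier_near_normal[OF \<Omega> r(2,3) ur] u(2) by (simp add: inn)
    moreover have nu: "is_normal \<Omega> u n"
      unfolding is_normal_def
    proof (intro conjI exI[of _ "r - dist z u"])
      show "\<Omega> \<inter> ball u (r - dist z u) = {v\<in>ball u (r - dist z u). inner (v - u) n < 0}"
        using r(2) sub unfolding inu by blast
    qed (use r ur in auto)
    ultimately have "u \<in> regular_boundary \<Omega>" unfolding regular_boundary_def by blast
    moreover have "normal_at \<Omega> u = n" by (rule normal_at_eq[OF nu])
    moreover have "fst u * snd n < 0"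
    proof -
      have "\<bar>fst z - fst u\<bar> < \<bar>fst z\<bar>"
        using dist_fst_le[of z u] u(1) \<rho>(3) by (simp add: dist_real_def)
      then have "sgn (fst u) = sgn (fst z)" by (auto simp: sgn_if abs_if split: if_splits)
      then show ?thesis using n(3) by (simp add: mult_less_0_iff sgn_if split: if_splits)
    qed
    ultimately show ?thesis unfolding boundary_minus_def boundary_zero_def using n(2) by simp
  qed
  show ?thesis
  \<comment> \<open>The outward normal is (0, 1) or (0, -1), so \<open>- snd n\<close> is the
    vertical direction into the domain.\<close>
  proof (rule that[of \<rho> "- snd n"])
    show "u \<in> \<Omega>" if "u \<in> ball z (2 * \<rho>)" "0 < - snd n * (snd u - snd z)" for u
    proof -
      have "u \<in> ball z r" using that(1) \<rho>(2) by auto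
      moreover have "inner (u - z) n < 0" using that(2) by (simp add: inn mult.commute)
      ultimately show ?thesis using r(2) by blast
    qed
    show "frontier \<Omega> \<inter> ball z \<rho> \<subseteq> boundary_minus \<Omega>"
    proof
      fix u assume u: "u \<in> frontier \<Omega> \<inter> ball z \<rho>"
      then have ub: "u \<in> ball z r" "u \<in> ball z (2 * \<rho>)" using \<rho> by auto
      then have "inner (u - z) n = 0" using frontier_near_normal[OF \<Omega> r(2,3)] u by blast
      then have "snd u = snd z" using n2 by (auto simp: inn)
      then show "u \<in> boundary_minus \<Omega>" using bm ub(2) by blast
    qed
  qed (use \<rho> n2 bm in auto)
qed

text \<open>A relatively open part of the closed frontier is Borel. This permits reading statements
  almost everywhere on the inflow boundary as statements about \<open>hausdorff\<close>.\<close>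

lemma boundary_minus_sets:
  assumes "open \<Omega>"
  shows "boundary_minus \<Omega> \<in> sets hausdorff"
proof -
  let ?U = "\<Union>{ball z \<rho> | z \<rho>. frontier \<Omega> \<inter> ball z \<rho> \<subseteq> boundary_minus \<Omega>}"
  have "boundary_minus \<Omega> = frontier \<Omega> \<inter> ?U"
  proof
    show "boundary_minus \<Omega> \<subseteq> frontier \<Omega> \<inter> ?U"
    proof
      fix z assume z: "z \<in> boundary_minus \<Omega>"
      then obtain \<rho> where "0 < \<rho>" "frontier \<Omega> \<inter> ball z \<rho> \<subseteq> boundary_minus \<Omega>"
        using boundary_minus_local[OF assms] by metis
      then have "z \<in> ball z \<rho>" "ball z \<rho> \<in> {ball z \<rho> | z \<rho>. frontier \<Omega> \<inter> ball z \<rho> \<subseteq> boundary_minus \<Omega>}"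
        by (simp, blast)
      then have "z \<in> ?U" by blast
      then show "z \<in> frontier \<Omega> \<inter> ?U" using z by (auto simp: boundary_minus_def regular_boundary_def)
    qed
  qed blast
  moreover have "open ?U" by (rule open_Union) auto
  then have "frontier \<Omega> \<inter> ?U \<in> sets borel" by (intro sets.Int) auto
  ultimately show ?thesis using borel_hausdorff by auto
qed

section \<open>Mesh elements: inclusion in the domain, negligible skeleton, disjointness\<close>

lemma mesh_open: "mesh_of \<Omega> \<T> \<Longrightarrow> T \<in> \<T> \<Longrightarrow> open_triangle T"
  by (auto simp: mesh_of_def)

lemma open_triangle_props:
  assumes "open_triangle T"
  shows "open T" "convex T" "bounded T" "T \<noteq> {}"
proof -
  obtain K where "T = interior K" "closure T = K" "convex K" "compact K" "polyhedron K" "T \<noteq> {}"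
    using open_triangleE[OF assms] by blast
  then show "open T" "convex T" "bounded T" "T \<noteq> {}"
    by (auto simp: convex_interior compact_imp_bounded intro: bounded_interior)
qed

text \<open>An open subset of the closure lies in its interior, and a polygonal domain equals the
  interior of its closure, so it has no slits that a triangle could cross.\<close>

lemma mesh_subset:
  assumes "polygonal_domain \<Omega>" "mesh_of \<Omega> \<T>" "T \<in> \<T>"
  shows "T \<subseteq> \<Omega>"
proof -
  have "T \<subseteq> closure \<Omega>" using assms(2,3) closure_subset[of T] by (auto simp: mesh_of_def)
  then have "T \<subseteq> interior (closure \<Omega>)"
    using open_triangle_props(1)[OF mesh_open[OF assms(2,3)]] by (rule interior_maximal)
  then show ?thesis using assms(1) by (simp add: polygonal_domain_def)
qed

lemma mesh_skeleton_negligible: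
  assumes "mesh_of \<Omega> \<T>"
  shows "negligible (\<Omega> - \<Union>\<T>)"
proof (rule negligible_subset)
  show "negligible (\<Union>T\<in>\<T>. frontier T)"
    using assms open_triangle_props(2) mesh_open[OF assms]
    by (intro negligible_Union) (auto simp: mesh_of_def intro!: negligible_convex_frontier)
  show "\<Omega> - \<Union>\<T> \<subseteq> (\<Union>T\<in>\<T>. frontier T)"
  proof
    fix z assume z: "z \<in> \<Omega> - \<Union>\<T>"
    then have "z \<in> closure \<Omega>" using closure_subset by blast
    then obtain T where T: "T \<in> \<T>" "z \<in> closure T" using assms by (auto simp: mesh_of_def)
    then have "z \<notin> interior T" using z interior_subset by blast
    then show "z \<in> (\<Union>T\<in>\<T>. frontier T)" using T by (auto simp: frontier_def)
  qed
qed

text \<open>A face that meets the interior of a convex set is the whole set. A common point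
  therefore forces the common face to equal both closed triangles, and each open triangle is the
  interior of its closure.\<close>

lemma mesh_disjoint:
  assumes \<T>: "mesh_of \<Omega> \<T>" "T \<in> \<T>" "T' \<in> \<T>" and z: "z \<in> T" "z \<in> T'"
  shows "T = T'"
proof -
  have I: "interior (closure S) = S" if "S \<in> \<T>" for S
    using open_triangleE[OF mesh_open[OF \<T>(1) that]] by metis
  have face: "(closure T \<inter> closure T') face_of closure T" "(closure T' \<inter> closure T) face_of closure T'"
    using \<T> unfolding mesh_of_def triangulation_def by blast+
  have cz: "z \<in> closure T" "z \<in> closure T'" using z closure_subset by blast+
  have "closure T \<inter> closure T' = closure T"
    using face_of_disjoint_interior[OF face(1)] I[OF \<T>(2)] z cz by blast
  moreover have "closure T' \<inter> closure T = closure T'"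
    using face_of_disjoint_interior[OF face(2)] I[OF \<T>(3)] z cz by blast
  ultimately have "closure T = closure T'" by blast
  then show ?thesis using I \<T>(2,3) by metis
qed

text \<open>Start from a rectangle adjacent to the inflow boundary, propagate to a neighbourhood of every
  interior point by connectedness, and reach the boundary inside the convex mesh elements.\<close>

lemma controlled_domain:
  assumes \<Omega>: "polygonal_domain \<Omega>" and \<T>: "mesh_of \<Omega> \<T>" and bm: "boundary_minus \<Omega> \<noteq> {}"
  obtains J y0 where "J \<in> sets borel" "J \<times> {y0} \<subseteq> boundary_minus \<Omega>" "controlled \<Omega> J y0 \<Omega>"
proof -
  have op: "open \<Omega>" "connected \<Omega>" using \<Omega> by (auto simp: polygonal_domain_def)
  obtain z where z: "z \<in> boundary_minus \<Omega>" using bm by blast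
  obtain \<rho> c where \<rho>: "0 < \<rho>" and c: "\<bar>c\<bar> = 1"
    and seg: "\<And>u. u \<in> ball z (2 * \<rho>) \<Longrightarrow> snd u = snd z \<Longrightarrow> u \<in> boundary_minus \<Omega>"
    and ins: "\<And>u. u \<in> ball z (2 * \<rho>) \<Longrightarrow> 0 < c * (snd u - snd z) \<Longrightarrow> u \<in> \<Omega>"
    using boundary_minus_local[OF op(1) z] by metis
  define J where "J = {fst z - \<rho><..<fst z + \<rho>}"
  define R where "R = {u. fst u \<in> J \<and> 0 < c * (snd u - snd z) \<and> c * (snd u - snd z) < \<rho>}"
  \<comment> \<open>The rectangle has half sides \<rho>, and the distance is at most the sum of the
    coordinate differences; hence the radius 2\<rho>.\<close>
  have near: "u \<in> ball z (2 * \<rho>)" if "fst u \<in> J" "\<bar>snd u - snd z\<bar> < \<rho>" for u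
  proof -
    have "dist z u \<le> \<bar>fst z - fst u\<bar> + \<bar>snd z - snd u\<bar>"
      by (cases z, cases u) (simp add: dist_Pair_Pair dist_real_def sqrt_sum_squares_le_sum_abs[of "_ - _" "_ - _", simplified])
    then show ?thesis using that by (auto simp: J_def)
  qed
  have absc: "\<bar>snd u - snd z\<bar> = \<bar>c * (snd u - snd z)\<bar>" for u using c by (simp add: abs_mult)
  have R: "R \<subseteq> \<Omega>"
  proof
    fix u assume "u \<in> R"
    then have u: "fst u \<in> J" "0 < c * (snd u - snd z)" "c * (snd u - snd z) < \<rho>" by (auto simp: R_def)
    then have "\<bar>snd u - snd z\<bar> < \<rho>" using absc[of u] by linarith
    then show "u \<in> \<Omega>" using ins near u by blast
  qed
  have cR: "controlled \<Omega> J (snd z) R"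
    using op(1) R by (intro controlled_rectangle[OF c \<rho>]) (auto simp: J_def R_def)
  \<comment> \<open>At half the height of the rectangle a ball of radius \<rho>/2 fits, which starts
    the propagation.\<close>
  define a where "a = (fst z, snd z + c * (\<rho> / 2))"
  have cc: "c * c = 1" using c by (metis abs_mult_self_eq mult_1)
  have "ball a (\<rho> / 2) \<subseteq> R"
  proof
    fix u assume "u \<in> ball a (\<rho> / 2)"
    then have d: "\<bar>fst a - fst u\<bar> < \<rho> / 2" "\<bar>snd a - snd u\<bar> < \<rho> / 2"
      using dist_fst_le[of a u] dist_snd_le[of a u] by (simp_all add: dist_real_def)
    have "\<bar>c * (snd u - snd z) - \<rho> / 2\<bar> = \<bar>c * (snd u - snd a)\<bar>"
      using cc by (simp add: a_def algebra_simps)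
    also have "\<dots> < \<rho> / 2" using d(2) c by (simp add: abs_mult abs_minus_commute)
    finally have "0 < c * (snd u - snd z)" "c * (snd u - snd z) < \<rho>" by linarith+
    moreover have "fst z - fst u < \<rho> / 2" "- (fst z - fst u) < \<rho> / 2"
      using d(1) by (simp_all only: a_def abs_less_iff fst_conv)
    then have "fst u \<in> J" using \<rho> by (simp add: J_def)
    ultimately show "u \<in> R" by (simp add: R_def)
  qed
  moreover have "a \<in> ball a (\<rho> / 2)" using \<rho> by simp
  ultimately have ca: "controlled \<Omega> J (snd z) (ball a (\<rho> / 2))" "a \<in> \<Omega>"
    using controlled_mono[OF cR] R by (blast, blast)
  have cT: "controlled \<Omega> J (snd z) T" if T: "T \<in> \<T>" for T
  proof -
    note Tp = open_triangle_props[OF mesh_open[OF \<T> T]]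
    have TO: "T \<subseteq> \<Omega>" by (rule mesh_subset[OF \<Omega> \<T> T])
    obtain b where b: "b \<in> T" using Tp(4) by blast
    obtain s where "0 < s" "controlled \<Omega> J (snd z) (ball b s)"
      using controlled_connected[OF op ca(2) _ ca(1)] \<rho> TO b by (metis half_gt_zero subsetD)
    then show ?thesis using Tp TO b op(1) by (intro controlled_convex[of T \<Omega> b s]) auto
  qed
  have "controlled \<Omega> J (snd z) \<Omega>"
  proof (rule controlled_finite_UN[of \<T> _ _ _ "\<lambda>T. T"])
    show "finite \<T>" using \<T> by (simp add: mesh_of_def)
    show "negligible (\<Omega> - (\<Union>T\<in>\<T>. T))" using mesh_skeleton_negligible[OF \<T>] by simp
    show "T \<in> sets borel" if "T \<in> \<T>" for T
      using open_triangle_props(1)[OF mesh_open[OF \<T> that]] by simp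
  qed (rule cT)
  moreover have "J \<times> {snd z} \<subseteq> boundary_minus \<Omega>"
    using near seg \<rho> by auto
  moreover have "J \<in> sets borel" by (simp add: J_def)
  ultimately show ?thesis using that by blast
qed

section \<open>The Poincare-Friedrichs inequality\<close>

lemma L2I_bounded:
  assumes "f \<in> borel_measurable M" "emeasure M (space M) < \<infinity>" "\<And>z. z \<in> space M \<Longrightarrow> \<bar>f z\<bar> \<le> B"
  shows "f \<in> L2 M"
proof -
  interpret finite_measure M using assms(2) by (intro finite_measureI) auto
  have "norm ((f z)\<^sup>2) \<le> B\<^sup>2" if "z \<in> space M" for z
    using assms(3)[OF that] power_mono[of "\<bar>f z\<bar>" B 2] by simp
  then have "integrable M (\<lambda>z. (f z)\<^sup>2)"
    using assms(1) by (intro integrable_const_bound[where B = "B\<^sup>2"]) auto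
  then show ?thesis using assms(1) by (simp add: L2_def)
qed

lemma L2norm_add_square_le:
  assumes "f \<in> L2 M" "g \<in> L2 M"
  shows "(\<lambda>z. f z + g z) \<in> L2 M"
    and "(L2norm M (\<lambda>z. f z + g z))\<^sup>2 \<le> 2 * (L2norm M f)\<^sup>2 + 2 * (L2norm M g)\<^sup>2"
proof -
  have fg: "f \<in> borel_measurable M" "g \<in> borel_measurable M"
    "integrable M (\<lambda>z. (f z)\<^sup>2)" "integrable M (\<lambda>z. (g z)\<^sup>2)"
    using assms by (auto simp: L2_def)
  have le: "(f z + g z)\<^sup>2 \<le> 2 * (f z)\<^sup>2 + 2 * (g z)\<^sup>2" for z
    using zero_le_power2[of "f z - g z"] by (simp add: power2_eq_square algebra_simps)
  have int: "integrable M (\<lambda>z. 2 * (f z)\<^sup>2 + 2 * (g z)\<^sup>2)" using fg by simp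
  have int': "integrable M (\<lambda>z. (f z + g z)\<^sup>2)"
    by (rule Bochner_Integration.integrable_bound[OF int]) (use fg le in auto)
  then show "(\<lambda>z. f z + g z) \<in> L2 M" using fg by (simp add: L2_def)
  have "(LINT z|M. (f z + g z)\<^sup>2) \<le> (LINT z|M. 2 * (f z)\<^sup>2 + 2 * (g z)\<^sup>2)"
    by (rule integral_mono[OF int' int]) (rule le)
  also have "\<dots> = 2 * (LINT z|M. (f z)\<^sup>2) + 2 * (LINT z|M. (g z)\<^sup>2)" using fg by simp
  finally show "(L2norm M (\<lambda>z. f z + g z))\<^sup>2 \<le> 2 * (L2norm M f)\<^sup>2 + 2 * (L2norm M g)\<^sup>2"
    by (simp add: L2norm_def)
qed

lemma L2_diff: "f \<in> L2 M \<Longrightarrow> g \<in> L2 M \<Longrightarrow> (\<lambda>z. f z - g z) \<in> L2 M"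
  using L2norm_add_square_le(1)[of f M "\<lambda>z. - g z"] by (simp add: L2_def)

lemma ennreal_L2norm_square:
  "f \<in> L2 M \<Longrightarrow> ennreal ((L2norm M f)\<^sup>2) = (\<integral>\<^sup>+z. ennreal ((f z)\<^sup>2) \<partial>M)"
  by (simp add: L2norm_def L2_def nn_integral_eq_integral)

lemma continuous_bounded_on:
  fixes f :: "pt \<Rightarrow> real"
  assumes "continuous_on UNIV f" "bounded S"
  obtains B where "\<And>z. z \<in> S \<Longrightarrow> \<bar>f z\<bar> \<le> B"
proof -
  have "compact (f ` closure S)"
    using assms by (intro compact_continuous_image continuous_on_subset[OF assms(1)]) auto
  then have "bounded (f ` closure S)" by (rule compact_imp_bounded)
  then obtain B where "\<And>y. y \<in> f ` closure S \<Longrightarrow> norm y \<le> B" unfolding bounded_iff by blast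
  then show ?thesis using that[of B] closure_subset by fastforce
qed

lemma L2_lebesgue_continuous:
  fixes f :: "pt \<Rightarrow> real"
  assumes f: "continuous_on UNIV f" and \<Omega>: "open \<Omega>" "bounded \<Omega>"
  shows "f \<in> L2 (lebesgue_on \<Omega>)"
    and "ennreal ((L2norm (lebesgue_on \<Omega>) f)\<^sup>2) = (\<integral>\<^sup>+z. ennreal ((f z)\<^sup>2) * indicator \<Omega> z \<partial>lborel)"
proof -
  have m: "f \<in> borel_measurable borel" using f by (rule borel_measurable_continuous_onI)
  have L: "\<Omega> \<in> sets lebesgue" using \<Omega>(1) by simp
  obtain B where B: "\<And>z. z \<in> \<Omega> \<Longrightarrow> \<bar>f z\<bar> \<le> B" using continuous_bounded_on[OF f \<Omega>(2)] by blast
  have "emeasure lebesgue \<Omega> < \<infinity>"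
    using emeasure_bounded_finite[OF \<Omega>(2)] \<Omega>(1) by simp
  then have "emeasure (lebesgue_on \<Omega>) (space (lebesgue_on \<Omega>)) < \<infinity>"
    using L by (simp add: emeasure_restrict_space space_restrict_space)
  then show L2: "f \<in> L2 (lebesgue_on \<Omega>)"
    using B m by (intro L2I_bounded) (auto intro!: measurable_restrict_space1 measurable_completion simp: space_restrict_space)
  show "ennreal ((L2norm (lebesgue_on \<Omega>) f)\<^sup>2) = (\<integral>\<^sup>+z. ennreal ((f z)\<^sup>2) * indicator \<Omega> z \<partial>lborel)"
    unfolding ennreal_L2norm_square[OF L2] using L
    by (simp add: nn_integral_restrict_space nn_integral_completion)
qed

lemma emeasure_frontier_finite:
  assumes "polygonal_domain \<Omega>"
  shows "emeasure hausdorff (frontier \<Omega>) < \<infinity>"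
proof -
  obtain S where "finite S" "\<forall>s\<in>S. \<exists>a b. s = closed_segment a b" "frontier \<Omega> = \<Union>S"
    using assms unfolding polygonal_domain_def by blast
  then show ?thesis using hausdorff_finite_segments[of S] by metis
qed

text \<open>On the inflow boundary \<open>g\<close> vanishes almost everywhere, so there \<phi>
  equals its distance to the trace. When \<phi> runs through the approximating sequence, the right
  side tends to 0.\<close>

lemma segment_le_boundary_L2norm:
  assumes \<Omega>: "polygonal_domain \<Omega>" and J: "J \<in> sets borel" "J \<times> {y0} \<subseteq> boundary_minus \<Omega>"
    and \<phi>: "continuous_on UNIV \<phi>" and g: "g \<in> L2 (arc (frontier \<Omega>))" "AE z in arc (boundary_minus \<Omega>). g z = 0"
  shows "(\<integral>\<^sup>+x. ennreal ((\<phi> (x, y0))\<^sup>2) * indicator J x \<partial>lborel) \<le>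
    ennreal ((L2norm (arc (frontier \<Omega>)) (\<lambda>z. \<phi> z - g z))\<^sup>2)"
proof -
  have op: "open \<Omega>" "bounded \<Omega>" using \<Omega> by (auto simp: polygonal_domain_def)
  have fr: "frontier \<Omega> \<in> sets hausdorff" by (rule closed_hausdorff) simp
  have m: "\<phi> \<in> borel_measurable borel" using \<phi> by (rule borel_measurable_continuous_onI)
  obtain B where B: "\<And>z. z \<in> frontier \<Omega> \<Longrightarrow> \<bar>\<phi> z\<bar> \<le> B"
    using continuous_bounded_on[OF \<phi>, of "frontier \<Omega>"] compact_frontier_bounded[OF op(2)]
      compact_imp_bounded by blast
  have "\<phi> \<in> L2 (arc (frontier \<Omega>))"
  proof (rule L2I_bounded)
    show "\<phi> \<in> borel_measurable (arc (frontier \<Omega>))"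
      by (intro measurable_restrict_space1 borel_measurable_hausdorff m)
    show "emeasure (arc (frontier \<Omega>)) (space (arc (frontier \<Omega>))) < \<infinity>"
      using emeasure_frontier_finite[OF \<Omega>] fr by (simp add: emeasure_restrict_space space_restrict_space)
  qed (use B in \<open>auto simp: space_restrict_space\<close>)
  then have L2: "(\<lambda>z. \<phi> z - g z) \<in> L2 (arc (frontier \<Omega>))" using g(1) by (rule L2_diff)
  have ae: "AE z in hausdorff. z \<in> boundary_minus \<Omega> \<longrightarrow> g z = 0"
    using g(2) boundary_minus_sets[OF op(1)] by (subst (asm) AE_restrict_space_iff) auto
  have sub: "boundary_minus \<Omega> \<subseteq> frontier \<Omega>"
    by (auto simp: boundary_minus_def regular_boundary_def)
  have "(\<lambda>x. \<phi> (x, y0)) \<in> borel_measurable borel"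
    by (intro borel_measurable_continuous_onI continuous_on_compose2[OF \<phi>] continuous_intros) auto
  then have "(\<integral>\<^sup>+x. ennreal ((\<phi> (x, y0))\<^sup>2) * indicator J x \<partial>lborel) \<le>
     (\<integral>\<^sup>+z. ennreal ((\<phi> (fst z, y0))\<^sup>2) * indicator (J \<times> {y0}) z \<partial>hausdorff)"
    using J(1) by (intro nn_integral_segment_le_hausdorff) auto
  also have "\<dots> \<le> (\<integral>\<^sup>+z. ennreal ((\<phi> z - g z)\<^sup>2) * indicator (frontier \<Omega>) z \<partial>hausdorff)"
  proof (rule nn_integral_mono_AE, use ae in eventually_elim)
    fix z assume z: "z \<in> boundary_minus \<Omega> \<longrightarrow> g z = 0"
    show "ennreal ((\<phi> (fst z, y0))\<^sup>2) * indicator (J \<times> {y0}) z \<le>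
        ennreal ((\<phi> z - g z)\<^sup>2) * indicator (frontier \<Omega>) z"
    proof (cases "z \<in> J \<times> {y0}")
      case True
      then have "z \<in> boundary_minus \<Omega>" "(fst z, y0) = z" using J(2) by auto
      then show ?thesis using z sub True by auto
    qed simp
  qed
  also have "\<dots> = ennreal ((L2norm (arc (frontier \<Omega>)) (\<lambda>z. \<phi> z - g z))\<^sup>2)"
    unfolding ennreal_L2norm_square[OF L2] using fr by (simp add: nn_integral_restrict_space)
  finally show ?thesis .
qed

lemma wderiv_L2:
  assumes "w \<in> H1 G" "e \<in> Basis"
  shows "wderiv G e w \<in> L2 (lebesgue_on G)"
proof -
  have "\<exists>g. is_weak_deriv G e w g" using assms by (auto simp: H1_def)
  then have "is_weak_deriv G e w (wderiv G e w)" unfolding wderiv_def by (rule someI_ex)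
  then show ?thesis by (simp add: is_weak_deriv_def)
qed

text \<open>The trace definition supplies smooth functions converging to \<open>w\<close>, to its
  derivatives and, on the frontier, to a trace that vanishes at the inflow part. The smooth estimate
  survives the limit, in which its boundary term disappears.\<close>

lemma poincare_friedrichs:
  assumes \<Omega>: "polygonal_domain \<Omega>" and \<T>: "mesh_of \<Omega> \<T>" and bm: "boundary_minus \<Omega> \<noteq> {}"
  obtains C where "0 \<le> C" "\<And>w. w \<in> H1_minus \<Omega> \<Longrightarrow>
    (L2norm (lebesgue_on \<Omega>) w)\<^sup>2 \<le>
      C * ((L2norm (lebesgue_on \<Omega>) (wdx \<Omega> w))\<^sup>2 + (L2norm (lebesgue_on \<Omega>) (wdy \<Omega> w))\<^sup>2)"
proof -
  have op: "open \<Omega>" "bounded \<Omega>" using \<Omega> by (auto simp: polygonal_domain_def)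
  obtain J y0 where J: "J \<in> sets borel" "J \<times> {y0} \<subseteq> boundary_minus \<Omega>" "controlled \<Omega> J y0 \<Omega>"
    using controlled_domain[OF \<Omega> \<T> bm] by blast
  obtain C where C: "0 \<le> C" "\<And>\<phi>. \<phi> \<in> C_inf \<Longrightarrow>
     (\<integral>\<^sup>+z. ennreal ((\<phi> z)\<^sup>2) * indicator \<Omega> z \<partial>lborel) \<le>
       ennreal C * ((\<integral>\<^sup>+z. ennreal (grad_sq \<phi> z) * indicator \<Omega> z \<partial>lborel) +
         (\<integral>\<^sup>+x. ennreal ((\<phi> (x, y0))\<^sup>2) * indicator J x \<partial>lborel))"
    using J(3) unfolding controlled_def by blast
  let ?N = "\<lambda>f. (L2norm (lebesgue_on \<Omega>) f)\<^sup>2"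
  let ?F = "\<lambda>f. (L2norm (arc (frontier \<Omega>)) f)\<^sup>2"
  have smooth: "?N \<phi> \<le> C * (?N (pdiff (1, 0) \<phi>) + ?N (pdiff (0, 1) \<phi>) + ?F (\<lambda>z. \<phi> z - g z))"
    if \<phi>: "\<phi> \<in> C_inf" and g: "g \<in> L2 (arc (frontier \<Omega>))" "AE z in arc (boundary_minus \<Omega>). g z = 0" for \<phi> g
  proof -
    note cont = C_inf_continuous[OF \<phi>] C_inf_continuous_pdiff[OF \<phi> Basis_ptI(1)] C_inf_continuous_pdiff[OF \<phi> Basis_ptI(2)]
    note [measurable] = C_inf_pdiff_measurable[OF \<phi>]
    have [measurable]: "\<Omega> \<in> sets borel" using op(1) by simp
    have "ennreal (?N \<phi>) \<le> ennreal C * ((\<integral>\<^sup>+z. ennreal (grad_sq \<phi> z) * indicator \<Omega> z \<partial>lborel) +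
         (\<integral>\<^sup>+x. ennreal ((\<phi> (x, y0))\<^sup>2) * indicator J x \<partial>lborel))"
      using C(2)[OF \<phi>] L2_lebesgue_continuous(2)[OF cont(1) op] by simp
    also have "(\<integral>\<^sup>+z. ennreal (grad_sq \<phi> z) * indicator \<Omega> z \<partial>lborel) =
       (\<integral>\<^sup>+z. ennreal ((pdiff (1, 0) \<phi> z)\<^sup>2) * indicator \<Omega> z + ennreal ((pdiff (0, 1) \<phi> z)\<^sup>2) * indicator \<Omega> z \<partial>lborel)"
      by (intro nn_integral_cong) (simp add: distrib_right)
    also have "\<dots> = ennreal (?N (pdiff (1, 0) \<phi>)) + ennreal (?N (pdiff (0, 1) \<phi>))"
      unfolding L2_lebesgue_continuous(2)[OF cont(2) op] L2_lebesgue_continuous(2)[OF cont(3) op]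
      by (rule nn_integral_add) measurable
    also have "ennreal C * (ennreal (?N (pdiff (1, 0) \<phi>)) + ennreal (?N (pdiff (0, 1) \<phi>)) +
        (\<integral>\<^sup>+x. ennreal ((\<phi> (x, y0))\<^sup>2) * indicator J x \<partial>lborel)) \<le>
        ennreal C * (ennreal (?N (pdiff (1, 0) \<phi>)) + ennreal (?N (pdiff (0, 1) \<phi>)) + ennreal (?F (\<lambda>z. \<phi> z - g z)))"
      by (intro mult_left_mono add_left_mono segment_le_boundary_L2norm[OF \<Omega> J(1,2) cont(1) g]) simp
    also have "\<dots> = ennreal (C * (?N (pdiff (1, 0) \<phi>) + ?N (pdiff (0, 1) \<phi>) + ?F (\<lambda>z. \<phi> z - g z)))"
      using C(1) by (simp add: ennreal_mult)
    finally show ?thesis using C(1) by (subst (asm) ennreal_le_iff) auto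
  qed
  show ?thesis
  \<comment> \<open>One factor 2 is the price of replacing \<open>w\<close> by
    \<open>\<phi> k\<close>, another that of returning from the derivatives of
    \<open>\<phi> k\<close> to those of \<open>w\<close>.\<close>
  proof (rule that[of "4 * C"])
    fix w assume w: "w \<in> H1_minus \<Omega>"
    then obtain g where g: "is_trace \<Omega> w g" "AE z in arc (boundary_minus \<Omega>). g z = 0"
      by (auto simp: H1_minus_def)
    have wH: "w \<in> H1 \<Omega>" and gL: "g \<in> L2 (arc (frontier \<Omega>))" using g(1) by (auto simp: is_trace_def)
    have wL: "w \<in> L2 (lebesgue_on \<Omega>)" using wH by (simp add: H1_def)
    obtain \<phi> where \<phi>: "\<And>k::nat. \<phi> k \<in> C_inf"
      "(\<lambda>k. L2norm (lebesgue_on \<Omega>) (\<lambda>z. \<phi> k z - w z)) \<longlonglongrightarrow> 0"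
      "\<forall>e\<in>Basis. (\<lambda>k. L2norm (lebesgue_on \<Omega>) (\<lambda>z. pdiff e (\<phi> k) z - wderiv \<Omega> e w z)) \<longlonglongrightarrow> 0"
      "(\<lambda>k. L2norm (arc (frontier \<Omega>)) (\<lambda>z. \<phi> k z - g z)) \<longlonglongrightarrow> 0"
      using g(1) unfolding is_trace_def by blast
    have approx: "?N f \<le> 2 * ?N (\<lambda>z. f z - f' z) + 2 * ?N f'"
      if "f \<in> L2 (lebesgue_on \<Omega>)" "f' \<in> L2 (lebesgue_on \<Omega>)" for f f'
      using L2norm_add_square_le(2)[OF L2_diff[OF that] that(2)] by simp
    have sym: "?N (\<lambda>z. f z - f' z) = ?N (\<lambda>z. f' z - f z)" for f f' :: "pt \<Rightarrow> real"
      by (simp add: L2norm_def power2_commute)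
    let ?r = "\<lambda>k. 2 * ?N (\<lambda>z. \<phi> k z - w z) + 2 * C *
       (2 * ?N (\<lambda>z. pdiff (1, 0) (\<phi> k) z - wdx \<Omega> w z) + 2 * ?N (wdx \<Omega> w) +
       (2 * ?N (\<lambda>z. pdiff (0, 1) (\<phi> k) z - wdy \<Omega> w z) + 2 * ?N (wdy \<Omega> w)) + ?F (\<lambda>z. \<phi> k z - g z))"
    have "?N w \<le> ?r k" for k
    proof -
      note cont = C_inf_continuous[OF \<phi>(1)[of k]] C_inf_continuous_pdiff[OF \<phi>(1)[of k] Basis_ptI(1)]
        C_inf_continuous_pdiff[OF \<phi>(1)[of k] Basis_ptI(2)]
      have "?N w \<le> 2 * ?N (\<lambda>z. \<phi> k z - w z) + 2 * ?N (\<phi> k)"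
        using approx[OF wL L2_lebesgue_continuous(1)[OF cont(1) op]] by (simp only: sym[of w])
      also have "\<dots> \<le> 2 * ?N (\<lambda>z. \<phi> k z - w z) + 2 * (C * (?N (pdiff (1, 0) (\<phi> k)) + ?N (pdiff (0, 1) (\<phi> k)) + ?F (\<lambda>z. \<phi> k z - g z)))"
        using smooth[OF \<phi>(1) gL g(2)] by simp
      also have "\<dots> \<le> ?r k"
        using C(1)
          approx[OF L2_lebesgue_continuous(1)[OF cont(2) op] wderiv_L2[OF wH Basis_ptI(1)]]
          approx[OF L2_lebesgue_continuous(1)[OF cont(3) op] wderiv_L2[OF wH Basis_ptI(2)]]
        unfolding mult.assoc by (intro add_left_mono mult_left_mono add_mono) auto
      finally show ?thesis .
    qed
    moreover have "?r \<longlonglongrightarrow> 2 * 0\<^sup>2 + 2 * C * (2 * 0\<^sup>2 + 2 * ?N (wdx \<Omega> w) + (2 * 0\<^sup>2 + 2 * ?N (wdy \<Omega> w)) + 0\<^sup>2)"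
      by (intro tendsto_intros \<phi>(2,4) bspec[OF \<phi>(3)] Basis_ptI)
    ultimately have "?N w \<le> 2 * 0\<^sup>2 + 2 * C * (2 * 0\<^sup>2 + 2 * ?N (wdx \<Omega> w) + (2 * 0\<^sup>2 + 2 * ?N (wdy \<Omega> w)) + 0\<^sup>2)"
      by (intro LIMSEQ_le_const) blast+
    then show "?N w \<le> 4 * C * (?N (wdx \<Omega> w) + ?N (wdy \<Omega> w))" by (simp add: algebra_simps)
  qed (use C in auto)
qed

section \<open>Bounds for the parameters and the norms\<close>

text \<open>An inscribed ball with radius \<open>r\<close> above half the supremum satisfies
  diameter <= 4 \<open>max \<sigma> 1\<close> r, and the bound r / (4 diameter) then gives the
  factor 16. The maximum with 1 keeps the bound positive whatever the sign of \<sigma>.\<close>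

lemma shape_regular_n1_lower_bound:
  assumes T: "open_triangle T" "shape_regular \<sigma> T"
  shows "inverse (16 * max \<sigma> 1) \<le> Linf_norm (arc (frontier T)) (n1 T)"
proof -
  obtain K where K: "T = interior K" "polyhedron K" using open_triangleE[OF T(1)] by blast
  note Tp = open_triangle_props[OF T(1)]
  have fin: "finite (frontier T - regular_boundary T)"
    by (rule finite_irregular_boundary[OF K(2,1) Tp(4)])
  define R where "R = {r. 0 < r \<and> (\<exists>z. ball z r \<subseteq> T)}"
  have dpos: "0 < diameter T" by (rule diameter_open_pos[OF Tp(1,3,4)])
  have bdd: "bdd_above R"
  proof (rule bdd_aboveI)
    fix r assume "r \<in> R"
    then obtain z where z: "0 < r" "ball z r \<subseteq> T" by (auto simp: R_def)
    then show "r \<le> diameter T" using diameter_subset[OF z(2) Tp(3)] by simp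
  qed
  obtain z where "z \<in> T" using Tp(4) by blast
  then obtain r0 where r0: "r0 \<in> R" "0 < r0"
    using Tp(1) unfolding R_def open_contains_ball by blast
  have Spos: "0 < Sup R" using cSup_upper[OF r0(1) bdd] r0(2) by simp
  have "diameter T \<le> \<sigma> * (2 * Sup R)"
    using T(2) by (simp add: shape_regular_def incircle_diameter_def R_def)
  also have "\<dots> \<le> max \<sigma> 1 * (2 * Sup R)" using Spos by (intro mult_right_mono) auto
  finally have d: "diameter T \<le> max \<sigma> 1 * (2 * Sup R)" .
  have "\<exists>r\<in>R. Sup R / 2 < r" using Spos r0 by (intro less_cSupD) auto
  then obtain r c where r: "Sup R / 2 < r" "0 < r" "ball c r \<subseteq> T" by (auto simp: R_def)
  have "max \<sigma> 1 * (2 * Sup R) \<le> max \<sigma> 1 * (4 * r)" using r(1) by (intro mult_left_mono) auto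
  then have "diameter T \<le> max \<sigma> 1 * (4 * r)" using d by linarith
  then have "inverse (16 * max \<sigma> 1) \<le> r / (4 * diameter T)"
    using dpos by (simp add: field_simps max_def split: if_splits)
  also have "\<dots> \<le> Linf_norm (arc (frontier T)) (n1 T)"
    by (rule Linf_norm_n1_lower_bound[OF Tp(2,1,3) fin r(3,2)])
  finally show ?thesis .
qed

lemma Linf_norm_nonneg_le:
  assumes "0 \<le> B" "\<And>z. z \<in> S \<Longrightarrow> \<bar>f z\<bar> \<le> B"
  shows "0 \<le> Linf_norm (arc S) f" "Linf_norm (arc S) f \<le> B"
proof -
  have B: "B \<in> {C. 0 \<le> C \<and> (AE z in arc S. \<bar>f z\<bar> \<le> C)}"
    using assms by (auto intro!: AE_I2 simp: space_restrict_space)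
  show "0 \<le> Linf_norm (arc S) f" unfolding Linf_norm_def using B by (intro cInf_greatest) auto
  show "Linf_norm (arc S) f \<le> B"
    unfolding Linf_norm_def using B by (intro cInf_lower bdd_belowI[of _ 0]) auto
qed

text \<open>The bound comes from the second entry of the maximum, where shape regularity keeps the
  horizontal normal component away from 0. Since \<open>p\<close> is at least 1 and the diameter
  below 1, the factor p^4 / h^2 is at least 1.\<close>

lemma delta_lower_bound:
  assumes T: "open_triangle T" "shape_regular \<sigma> T" "diameter T < 1" and p: "1 \<le> p"
  shows "2 * (inverse (16 * max \<sigma> 1))\<^sup>2 * C_inv ^ 4 / 3 \<le> delta C_inv p T"
proof -
  let ?c = "inverse (16 * max \<sigma> 1)" and ?L = "Linf_norm (arc (frontier T)) (n1 T)"
  note Tp = open_triangle_props[OF T(1)]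
  have dpos: "0 < diameter T" by (rule diameter_open_pos[OF Tp(1,3,4)])
  have c: "0 < ?c" by auto
  have "?c\<^sup>2 \<le> ?L\<^sup>2" using shape_regular_n1_lower_bound[OF T(1,2)] c by (intro power_mono) auto
  then have "2 * ?c\<^sup>2 * C_inv ^ 4 \<le> 2 * ?L\<^sup>2 * C_inv ^ 4" by (intro mult_right_mono) auto
  also have "\<dots> \<le> 2 * ?L\<^sup>2 * C_inv ^ 4 * real p ^ 4"
    using p mult_left_mono[of 1 "real p ^ 4" "2 * ?L\<^sup>2 * C_inv ^ 4"] by (simp add: one_le_power)
  finally have 1: "2 * ?c\<^sup>2 * C_inv ^ 4 \<le> 2 * ?L\<^sup>2 * C_inv ^ 4 * real p ^ 4" .
  have "(diameter T)\<^sup>2 \<le> 1" using dpos T(3) by (simp add: power_le_one)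
  then have "2 * ?c\<^sup>2 * C_inv ^ 4 / 3 \<le> 2 * ?L\<^sup>2 * C_inv ^ 4 * real p ^ 4 / (3 * (diameter T)\<^sup>2)"
    using 1 dpos by (intro frac_le) auto
  then show ?thesis unfolding delta_def by (rule max.coboundedI2)
qed

text \<open>As \<open>h\<close> is below 1 and \<open>p\<close> at least 1, the first entry, of
  order p^2 / h, is dominated by the order p^4 / h^2 of the second.\<close>

lemma delta_upper_bound:
  assumes T: "open_triangle T" "diameter T < 1" and p: "1 \<le> p" and h: "0 < h" "h \<le> diameter T"
    and X: "0 \<le> X" "\<And>z. z \<in> frontier T \<Longrightarrow> \<bar>fst z\<bar> \<le> X"
  shows "delta C_inv p T \<le> (C_inv\<^sup>2 * (X * normal_bound) + normal_bound\<^sup>2 * C_inv ^ 4) * real p ^ 4 / h\<^sup>2"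
    (is "_ \<le> (?a + ?b) * _ / _")
proof -
  have nb: "1 \<le> normal_bound" by (simp add: normal_bound_def)
  have n: "\<bar>n1 T z\<bar> \<le> normal_bound" "\<bar>n2 T z\<bar> \<le> normal_bound" for z
    using norm_fst_le[of "n1 T z" "n2 T z"] norm_snd_le[of "n2 T z" "n1 T z"] norm_normal_at_le[of T z] by simp_all
  have L1: "0 \<le> Linf_norm (arc (elem_minus T)) (\<lambda>z. fst z * n2 T z)"
    "Linf_norm (arc (elem_minus T)) (\<lambda>z. fst z * n2 T z) \<le> X * normal_bound"
  proof -
    have "\<bar>fst z * n2 T z\<bar> \<le> X * normal_bound" if "z \<in> elem_minus T" for z
      unfolding abs_mult using X n(2)[of z] that
      by (intro mult_mono) (auto simp: elem_minus_def regular_boundary_def)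
    moreover have "0 \<le> X * normal_bound" using X nb by simp
    ultimately show "0 \<le> Linf_norm (arc (elem_minus T)) (\<lambda>z. fst z * n2 T z)"
      "Linf_norm (arc (elem_minus T)) (\<lambda>z. fst z * n2 T z) \<le> X * normal_bound"
      by (blast intro: Linf_norm_nonneg_le)+
  qed
  have L2: "0 \<le> Linf_norm (arc (frontier T)) (n1 T)" "Linf_norm (arc (frontier T)) (n1 T) \<le> normal_bound"
    using Linf_norm_nonneg_le[of normal_bound "frontier T" "n1 T"] n(1) nb by simp_all
  have hh: "h\<^sup>2 \<le> (diameter T)\<^sup>2" using h by (intro power_mono) auto
  have "h\<^sup>2 \<le> h" using h T(2) by (simp add: power2_eq_square mult_left_le_one_le)
  then have h2: "h\<^sup>2 \<le> diameter T" using h by simp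
  have p24: "real p ^ 2 \<le> real p ^ 4" using p by (intro power_increasing) auto
  have "C_inv\<^sup>2 * (real p)\<^sup>2 * Linf_norm (arc (elem_minus T)) (\<lambda>z. fst z * n2 T z) / diameter T \<le>
      C_inv\<^sup>2 * real p ^ 4 * (X * normal_bound) / h\<^sup>2"
    using h h2 p24 L1 X nb by (intro frac_le mult_mono) auto
  also have "\<dots> = ?a * real p ^ 4 / h\<^sup>2" by simp
  also have "\<dots> \<le> (?a + ?b) * real p ^ 4 / h\<^sup>2"
    using h by (intro divide_right_mono mult_right_mono) auto
  finally have A: "C_inv\<^sup>2 * (real p)\<^sup>2 * Linf_norm (arc (elem_minus T)) (\<lambda>z. fst z * n2 T z) / diameter T \<le>
      (?a + ?b) * real p ^ 4 / h\<^sup>2" .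
  have "2 * (Linf_norm (arc (frontier T)) (n1 T))\<^sup>2 * C_inv ^ 4 * real p ^ 4 / (3 * (diameter T)\<^sup>2) \<le>
     2 * normal_bound\<^sup>2 * C_inv ^ 4 * real p ^ 4 / (3 * h\<^sup>2)"
    using h hh L2 by (intro frac_le mult_right_mono mult_left_mono power_mono) auto
  also have "\<dots> \<le> ?b * real p ^ 4 / h\<^sup>2"
    using h by (simp add: field_simps)
  also have "\<dots> \<le> (?a + ?b) * real p ^ 4 / h\<^sup>2"
    using h X nb by (intro divide_right_mono mult_right_mono) auto
  finally show ?thesis using A unfolding delta_def by simp
qed

lemma delta_nonneg: "0 \<le> delta C_inv p T"
  unfolding delta_def by (rule max.coboundedI2) simp

section \<open>The quadratic form of A: positivity and upper bound\<close>

lemma inner_A_mat: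
  "inner \<xi> (A_mat d \<xi>) = alpha d * (fst \<xi>)\<^sup>2 + 2 * beta d * fst \<xi> * snd \<xi> + gamma d * (snd \<xi>)\<^sup>2"
  by (simp add: A_mat_def inner_prod_def power2_eq_square algebra_simps)

text \<open>For positive \<open>d\<close> this holds because \<beta>^2 = 1/(576 d^4) is below
  \<alpha>\<gamma> = 1/(512 d^4). The absolute value serves both the nonnegativity of the form and
  its upper bound. The case \<open>d = 0\<close> arises on the mesh skeleton, where mesh functions
  vanish; there all entries are 0, since \<open>inverse 0\<close> is 0.\<close>

lemma A_mat_cross_term:
  assumes "0 \<le> d"
  shows "\<bar>2 * beta d * x * y\<bar> \<le> alpha d * x\<^sup>2 + gamma d * y\<^sup>2"
proof (cases "d = 0")
  case False
  then have d: "0 < d" using assms by simp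
  \<comment> \<open>Multiplied by 64 d^3, the claim bounds 16/3 d |x||y| by 8 d^2 x^2 + y^2. The
    square yields it with 64/9 in place of 8.\<close>
  have "0 \<le> (8/3 * d * \<bar>x\<bar> - \<bar>y\<bar>)\<^sup>2" by simp
  then have "16/3 * d * (\<bar>x\<bar> * \<bar>y\<bar>) \<le> 64/9 * (d\<^sup>2 * x\<^sup>2) + y\<^sup>2"
    by (simp add: power2_diff power_mult_distrib algebra_simps power2_eq_square)
  moreover have "0 \<le> d\<^sup>2 * x\<^sup>2" by simp
  ultimately have "16/3 * d * (\<bar>x\<bar> * \<bar>y\<bar>) \<le> 8 * (d\<^sup>2 * x\<^sup>2) + y\<^sup>2" by linarith
  then have "16/3 * d * (\<bar>x\<bar> * \<bar>y\<bar>) / (64 * d ^ 3) \<le> (8 * (d\<^sup>2 * x\<^sup>2) + y\<^sup>2) / (64 * d ^ 3)"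
    using d by (intro divide_right_mono) auto
  then show ?thesis using d
    by (simp add: alpha_def beta_def gamma_def abs_mult field_simps power2_eq_square power3_eq_cube)
qed (simp add: alpha_def beta_def gamma_def)

lemma inner_A_mat_nonneg: "0 \<le> d \<Longrightarrow> 0 \<le> inner \<xi> (A_mat d \<xi>)"
  using A_mat_cross_term[of d "fst \<xi>" "snd \<xi>"] unfolding inner_A_mat by linarith

text \<open>The cross term at most doubles the diagonal part, and \<alpha> and \<gamma> decrease in
  \<open>d\<close>.\<close>

lemma inner_A_mat_le:
  assumes "0 < d0" "d0 \<le> d"
  shows "inner \<xi> (A_mat d \<xi>) \<le> 2 * (alpha d0 + gamma d0) * ((fst \<xi>)\<^sup>2 + (snd \<xi>)\<^sup>2)"
proof -
  have pos: "0 \<le> alpha d" "0 \<le> gamma d" "0 \<le> alpha d0" "0 \<le> gamma d0"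
    using assms by (auto simp: alpha_def gamma_def)
  have "alpha d \<le> alpha d0" "gamma d \<le> gamma d0"
    using assms by (auto simp: alpha_def gamma_def intro!: le_imp_inverse_le power_mono)
  then have "alpha d * (fst \<xi>)\<^sup>2 \<le> (alpha d0 + gamma d0) * (fst \<xi>)\<^sup>2"
    "gamma d * (snd \<xi>)\<^sup>2 \<le> (alpha d0 + gamma d0) * (snd \<xi>)\<^sup>2"
    using pos by (intro mult_right_mono; simp)+
  then show ?thesis
    using A_mat_cross_term[of d "fst \<xi>" "snd \<xi>"] assms unfolding inner_A_mat
    by (simp add: algebra_simps)
qed

text \<open>Off the negligible skeleton a point lies in exactly one triangle, so the defining sum
  has a single nonzero term.\<close>

lemma AE_mesh_fun:
  assumes \<T>: "mesh_of \<Omega> \<T>" and \<Omega>: "open \<Omega>"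
  shows "AE z in lebesgue_on \<Omega>. \<exists>T\<in>\<T>. \<forall>f. mesh_fun \<T> f z = f T"
proof -
  have "AE z in lebesgue. z \<notin> \<Omega> - \<Union>\<T>"
    using mesh_skeleton_negligible[OF \<T>] unfolding negligible_iff_null_sets by (rule AE_not_in)
  then have "AE z in lebesgue_on \<Omega>. z \<in> \<Union>\<T>"
    using \<Omega> by (subst AE_restrict_space_iff) auto
  then show ?thesis
  proof eventually_elim
    fix z assume "z \<in> \<Union>\<T>"
    then obtain T where T: "T \<in> \<T>" "z \<in> T" by blast
    have "mesh_fun \<T> f z = f T" for f
    proof -
      have "mesh_fun \<T> f z = (\<Sum>T'\<in>{T}. indicator T' z * f T')"
        unfolding mesh_fun_def
      proof (rule sum.mono_neutral_right)
        show "finite \<T>" using \<T> by (simp add: mesh_of_def)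
        show "\<forall>T'\<in>\<T> - {T}. indicator T' z * f T' = 0"
        proof
          fix T' assume T': "T' \<in> \<T> - {T}"
          then have "z \<notin> T'" using mesh_disjoint[OF \<T> T(1) _ T(2)] by blast
          then show "indicator T' z * f T' = 0" by simp
        qed
      qed (use T(1) in simp)
      then show ?thesis using T(2) by simp
    qed
    then show "\<exists>T\<in>\<T>. \<forall>f. mesh_fun \<T> f z = f T" using T(1) by blast
  qed
qed

lemma mesh_fun_measurable:
  assumes "mesh_of \<Omega> \<T>"
  shows "mesh_fun \<T> f \<in> borel_measurable (lebesgue_on \<Omega>)"
proof -
  have [measurable]: "T \<in> sets borel" if "T \<in> \<T>" for T
    using open_triangle_props(1)[OF mesh_open[OF assms that]] by simp
  have "(\<lambda>z. \<Sum>T\<in>\<T>. indicator T z * f T) \<in> borel_measurable borel" by measurable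
  then show ?thesis unfolding mesh_fun_def[abs_def]
    by (auto intro!: measurable_restrict_space1 measurable_completion)
qed

text \<open>The first two terms are kept. The others are nonnegative: they are squares, integrals of
  the semidefinite form, or such integrals weighted by \<open>fst z * n2 T z\<close>, which is
  nonnegative on \<open>elem_plus T\<close>.\<close>

lemma triple_norm_sq_ge:
  assumes \<Omega>: "open \<Omega>" and \<T>: "mesh_of \<Omega> \<T>" and w: "w \<in> H1 \<Omega>"
    and d: "0 < d0" "\<And>T. T \<in> \<T> \<Longrightarrow> d0 \<le> delta C_inv p T" "\<And>T. T \<in> \<T> \<Longrightarrow> delta C_inv p T \<le> D"
  shows "1/2 * (L2norm (lebesgue_on \<Omega>) (wdx \<Omega> w))\<^sup>2 +
      inverse (64 * D\<^sup>2) * (L2norm (lebesgue_on \<Omega>) (wdy \<Omega> w))\<^sup>2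
    \<le> triple_norm_sq \<Omega> \<T> C_INV C_inv p w w_t"
proof -
  let ?\<delta> = "mesh_fun \<T> (delta C_inv p)"
  have dnn: "0 \<le> ?\<delta> z" for z
    unfolding mesh_fun_def by (intro sum_nonneg mult_nonneg_nonneg) (auto simp: delta_nonneg)
  have wy: "wdy \<Omega> w \<in> borel_measurable (lebesgue_on \<Omega>)" "integrable (lebesgue_on \<Omega>) (\<lambda>z. (wdy \<Omega> w z)\<^sup>2)"
    using wderiv_L2[OF w Basis_ptI(2)] by (auto simp: L2_def)
  have ae: "AE z in lebesgue_on \<Omega>. d0 \<le> ?\<delta> z \<and> ?\<delta> z \<le> D"
    using AE_mesh_fun[OF \<T> \<Omega>] by eventually_elim (use d(2,3) in fastforce)
  have gd: "gamma t * t = inverse (64 * t\<^sup>2)" if "0 < t" for t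
    using that by (simp add: gamma_def field_simps power2_eq_square power3_eq_cube)
  have sq: "(sqrt (gamma (?\<delta> z) * ?\<delta> z) * wdy \<Omega> w z)\<^sup>2 = gamma (?\<delta> z) * ?\<delta> z * (wdy \<Omega> w z)\<^sup>2" for z
    using dnn[of z] by (simp add: power_mult_distrib gamma_def)
  \<comment> \<open>A nonintegrable function has integral 0, so the comparison below needs this
    larger integrand to be integrable; the lower bound \<open>d0\<close> supplies a
    majorant.\<close>
  have int: "integrable (lebesgue_on \<Omega>) (\<lambda>z. gamma (?\<delta> z) * ?\<delta> z * (wdy \<Omega> w z)\<^sup>2)"
  proof (rule Bochner_Integration.integrable_bound)
    show "integrable (lebesgue_on \<Omega>) (\<lambda>z. inverse (64 * d0\<^sup>2) * (wdy \<Omega> w z)\<^sup>2)"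
      using wy(2) by simp
    show "(\<lambda>z. gamma (?\<delta> z) * ?\<delta> z * (wdy \<Omega> w z)\<^sup>2) \<in> borel_measurable (lebesgue_on \<Omega>)"
      using wy(1) mesh_fun_measurable[OF \<T>, of "delta C_inv p"] unfolding gamma_def by measurable
    show "AE z in lebesgue_on \<Omega>. norm (gamma (?\<delta> z) * ?\<delta> z * (wdy \<Omega> w z)\<^sup>2) \<le>
        norm (inverse (64 * d0\<^sup>2) * (wdy \<Omega> w z)\<^sup>2)"
      using ae
    proof eventually_elim
      case (elim z)
      then have "inverse (64 * (?\<delta> z)\<^sup>2) \<le> inverse (64 * d0\<^sup>2)"
        using d(1) by (intro le_imp_inverse_le mult_left_mono power_mono) auto
      then have "norm (inverse (64 * (?\<delta> z)\<^sup>2) * (wdy \<Omega> w z)\<^sup>2) \<le>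
          norm (inverse (64 * d0\<^sup>2) * (wdy \<Omega> w z)\<^sup>2)"
        by (simp add: abs_mult mult_right_mono)
      moreover have "gamma (?\<delta> z) * ?\<delta> z = inverse (64 * (?\<delta> z)\<^sup>2)"
        using elim d(1) by (intro gd) simp
      ultimately show ?case by (simp only:)
    qed
  qed
  have "inverse (64 * D\<^sup>2) * (L2norm (lebesgue_on \<Omega>) (wdy \<Omega> w))\<^sup>2 =
      (LINT z|lebesgue_on \<Omega>. inverse (64 * D\<^sup>2) * (wdy \<Omega> w z)\<^sup>2)"
    by (simp add: L2norm_def)
  also have "\<dots> \<le> (LINT z|lebesgue_on \<Omega>. gamma (?\<delta> z) * ?\<delta> z * (wdy \<Omega> w z)\<^sup>2)"
  proof (rule integral_mono_AE[OF _ int])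
    show "integrable (lebesgue_on \<Omega>) (\<lambda>z. inverse (64 * D\<^sup>2) * (wdy \<Omega> w z)\<^sup>2)" using wy(2) by simp
    show "AE z in lebesgue_on \<Omega>. inverse (64 * D\<^sup>2) * (wdy \<Omega> w z)\<^sup>2 \<le> gamma (?\<delta> z) * ?\<delta> z * (wdy \<Omega> w z)\<^sup>2"
      using ae
    proof eventually_elim
      case (elim z)
      then have "inverse (64 * D\<^sup>2) \<le> inverse (64 * (?\<delta> z)\<^sup>2)"
        using d(1) by (intro le_imp_inverse_le mult_left_mono power_mono) auto
      moreover have "gamma (?\<delta> z) * ?\<delta> z = inverse (64 * (?\<delta> z)\<^sup>2)"
        using elim d(1) by (intro gd) simp
      ultimately show ?case by (intro mult_right_mono) simp_all
    qed
  qed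
  also have "\<dots> = (L2norm (lebesgue_on \<Omega>) (\<lambda>z. sqrt (gamma (?\<delta> z) * ?\<delta> z) * wdy \<Omega> w z))\<^sup>2"
    unfolding L2norm_def sq using dnn by (subst real_sqrt_pow2) (auto intro!: Bochner_Integration.integral_nonneg simp: gamma_def)
  finally have Y: "inverse (64 * D\<^sup>2) * (L2norm (lebesgue_on \<Omega>) (wdy \<Omega> w))\<^sup>2 \<le> \<dots>" .
  \<comment> \<open>Pointwise nonnegativity suffices here, because a nonintegrable function has
    integral 0.\<close>
  have A: "0 \<le> (LINT z|lebesgue_on \<Omega>. inner (broken_grad \<T> (wdx \<Omega> w) z)
           (A_mat (?\<delta> z) (broken_grad \<T> (wdx \<Omega> w) z)))"
    using dnn by (intro Bochner_Integration.integral_nonneg inner_A_mat_nonneg)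
  have B: "0 \<le> (\<Sum>T\<in>\<T>. LINT z|arc (elem_plus T). fst z * n2 T z *
           inner (grad_trace T w z) (A_mat (delta C_inv p T) (grad_trace T w z)))"
  proof (intro sum_nonneg Bochner_Integration.integral_nonneg)
    fix T z assume "z \<in> space (arc (elem_plus T))"
    then have "0 \<le> fst z * n2 T z" by (simp add: space_restrict_space elem_plus_def)
    then show "0 \<le> fst z * n2 T z * inner (grad_trace T w z) (A_mat (delta C_inv p T) (grad_trace T w z))"
      by (rule mult_nonneg_nonneg) (intro inner_A_mat_nonneg delta_nonneg)
  qed
  have tn: "a + b \<le> a + b' + 1/2 * c\<^sup>2 + e + f\<^sup>2 + g" if "b \<le> b'" "0 \<le> e" "0 \<le> g" for a b b' c e f g :: real
  proof -
    have "0 \<le> c\<^sup>2" "0 \<le> f\<^sup>2" by simp_all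
    then show ?thesis using that by linarith
  qed
  show ?thesis unfolding triple_norm_sq_def Let_def by (rule tn[OF Y A B])
qed

lemma norm_A_sq_le:
  assumes \<Omega>: "open \<Omega>" and \<T>: "mesh_of \<Omega> \<T>" and w: "w \<in> H1 \<Omega>"
    and d: "0 < d0" "\<And>T. T \<in> \<T> \<Longrightarrow> d0 \<le> delta C_inv p T"
  shows "norm_A_sq \<Omega> \<T> C_inv p w \<le> (L2norm (lebesgue_on \<Omega>) w)\<^sup>2 + 2 * (alpha d0 + gamma d0) *
    ((L2norm (lebesgue_on \<Omega>) (wdx \<Omega> w))\<^sup>2 + (L2norm (lebesgue_on \<Omega>) (wdy \<Omega> w))\<^sup>2)"
proof -
  let ?\<delta> = "mesh_fun \<T> (delta C_inv p)" and ?K = "2 * (alpha d0 + gamma d0)"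
  have int: "integrable (lebesgue_on \<Omega>) (\<lambda>z. (wdx \<Omega> w z)\<^sup>2)" "integrable (lebesgue_on \<Omega>) (\<lambda>z. (wdy \<Omega> w z)\<^sup>2)"
    using wderiv_L2[OF w Basis_ptI(1)] wderiv_L2[OF w Basis_ptI(2)] by (auto simp: L2_def)
  have K: "0 \<le> ?K" using d(1) by (simp add: alpha_def gamma_def)
  have "(LINT z|lebesgue_on \<Omega>. inner (grad \<Omega> w z) (A_mat (?\<delta> z) (grad \<Omega> w z)))
     \<le> (LINT z|lebesgue_on \<Omega>. ?K * ((wdx \<Omega> w z)\<^sup>2 + (wdy \<Omega> w z)\<^sup>2))"
  \<comment> \<open>The majorant is integrable and nonnegative, so the bound also covers the default
    value 0 of the left integral.\<close>
  proof (rule integral_mono_AE')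
    show "AE z in lebesgue_on \<Omega>. inner (grad \<Omega> w z) (A_mat (?\<delta> z) (grad \<Omega> w z)) \<le>
        ?K * ((wdx \<Omega> w z)\<^sup>2 + (wdy \<Omega> w z)\<^sup>2)"
      using AE_mesh_fun[OF \<T> \<Omega>]
    proof eventually_elim
      case (elim z)
      then have "d0 \<le> ?\<delta> z" using d(2) by fastforce
      then show ?case using inner_A_mat_le[OF d(1), of "?\<delta> z" "grad \<Omega> w z"] by (simp add: grad_def)
    qed
  qed (use int K in auto)
  also have "\<dots> = ?K * ((L2norm (lebesgue_on \<Omega>) (wdx \<Omega> w))\<^sup>2 + (L2norm (lebesgue_on \<Omega>) (wdy \<Omega> w))\<^sup>2)"
    using int by (simp add: L2norm_def)
  finally show ?thesis by (simp add: norm_A_sq_def)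
qed

lemma h_min_mesh:
  assumes "polygonal_domain \<Omega>" "mesh_of \<Omega> \<T>" "h_max \<T> < 1"
  shows "0 < h_min \<T>" "h_min \<T> < 1" "\<And>T. T \<in> \<T> \<Longrightarrow> h_min \<T> \<le> diameter T" "\<And>T. T \<in> \<T> \<Longrightarrow> diameter T < 1"
proof -
  have fin: "finite (diameter ` \<T>)" using assms(2) by (simp add: mesh_of_def)
  have "\<Omega> \<noteq> {}" using assms(1) by (simp add: polygonal_domain_def)
  moreover have "\<Omega> \<subseteq> (\<Union>T\<in>\<T>. closure T)" using assms(2) closure_subset by (simp add: mesh_of_def)
  ultimately have ne: "diameter ` \<T> \<noteq> {}" by auto
  show 1: "h_min \<T> \<le> diameter T" if "T \<in> \<T>" for T unfolding h_min_def using fin that by (intro Min_le) auto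
  show 2: "diameter T < 1" if "T \<in> \<T>" for T
    using Max_ge[OF fin, of "diameter T"] that assms(3) unfolding h_max_def by auto
  have pos: "0 < diameter T" if "T \<in> \<T>" for T
    using open_triangle_props[OF mesh_open[OF assms(2) that]] diameter_open_pos by blast
  have "h_min \<T> \<in> diameter ` \<T>" unfolding h_min_def using fin ne by (rule Min_in)
  then show "0 < h_min \<T>" "h_min \<T> < 1" using pos 2 by auto
qed

theorem lemma4p4:
  fixes \<Omega> :: "(real \<times> real) set" and tf \<sigma> \<mu> C_INV C_inv :: real
  assumes "polygonal_domain \<Omega>"
    and "0 < tf"
    and "0 < emeasure hausdorff (boundary_minus \<Omega>)"
    and "0 < C_INV" and "0 < C_inv"
    and "inverse_estimates \<sigma> C_INV C_inv"
  shows "\<exists>c_hc::real. 0 < c_hc \<and> c_hc < 1 \<and>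
    (\<forall>(\<T> :: (real \<times> real) set set) (p::nat)
        (w :: real \<Rightarrow> real \<times> real \<Rightarrow> real) (w_t :: real \<Rightarrow> real \<times> real \<Rightarrow> real).
       mesh_of \<Omega> \<T> \<and> (\<forall>T\<in>\<T>. shape_regular \<sigma> T) \<and> locally_quasi_uniform \<mu> \<T> \<and>
       h_max \<T> < 1 \<and> 1 \<le> p \<and>
       bochner_H1 {0<..tf} (X_space \<Omega> \<T>) (X_norm \<Omega> \<T>) w w_t \<longrightarrow>
       (AE t in lebesgue_on {0<..tf}.
          triple_norm_sq \<Omega> \<T> C_INV C_inv p (w t) (w_t t)
            \<ge> (c_hc * h_min \<T> ^ 4 * inverse (real p ^ 8)) * norm_A_sq \<Omega> \<T> C_inv p (w t)))"
proof (cases "\<exists>\<T>. mesh_of \<Omega> \<T>")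
  case False
  then show ?thesis by (intro exI[of _ "1/2"]) auto
next
  case True
  note \<Omega> = assms(1)
  have op: "open \<Omega>" "bounded \<Omega>" using \<Omega> by (auto simp: polygonal_domain_def)
  have bm: "boundary_minus \<Omega> \<noteq> {}" using assms(3) by auto
  obtain C where C: "0 \<le> C" "\<And>w. w \<in> H1_minus \<Omega> \<Longrightarrow>
    (L2norm (lebesgue_on \<Omega>) w)\<^sup>2 \<le>
      C * ((L2norm (lebesgue_on \<Omega>) (wdx \<Omega> w))\<^sup>2 + (L2norm (lebesgue_on \<Omega>) (wdy \<Omega> w))\<^sup>2)"
    using True poincare_friedrichs[OF \<Omega> _ bm] by metis
  obtain X0 where X0: "\<And>z. z \<in> closure \<Omega> \<Longrightarrow> norm z \<le> X0"
    using bounded_closure[OF op(2)] unfolding bounded_iff by blast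
  define X where "X = max X0 0"
  have X: "0 \<le> X" "\<And>z. z \<in> closure \<Omega> \<Longrightarrow> \<bar>fst z\<bar> \<le> X"
  proof -
    fix z assume "z \<in> closure \<Omega>"
    then have "norm z \<le> X0" by (rule X0)
    then show "\<bar>fst z\<bar> \<le> X" using norm_fst_le[of "fst z" "snd z"] by (simp add: X_def)
  qed (simp add: X_def)
  define d0 where "d0 = 2 * (inverse (16 * max \<sigma> 1))\<^sup>2 * C_inv ^ 4 / 3"
  have d0: "0 < d0" using assms(5) by (simp add: d0_def)
  define M where "M = C_inv\<^sup>2 * (X * normal_bound) + normal_bound\<^sup>2 * C_inv ^ 4"
  have nb: "1 \<le> normal_bound" by (simp add: normal_bound_def)
  have M: "0 < M" using assms(5) X(1) nb by (simp add: M_def add_nonneg_pos)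
  \<comment> \<open>The Poincare-Friedrichs constant bounds \<open>w\<close> itself, the second
    summand the A-weighted gradient.\<close>
  define K where "K = C + 2 * (alpha d0 + gamma d0)"
  have K: "0 < K" using C(1) d0 by (simp add: K_def alpha_def gamma_def add_nonneg_pos)
  \<comment> \<open>This makes \<open>c * K\<close> at most 1/2, the weight of the x-derivative, and
    at most 1/(64 M^2), the weight of the y-derivative without its mesh factor. The outer 1/2
    ensures \<open>c < 1\<close>.\<close>
  define c where "c = min (1/2) (min (1/2) (inverse (64 * M\<^sup>2)) / K)"
  have c: "0 < c" "c < 1" using K M by (auto simp: c_def)
  have cK: "c * K \<le> 1/2" "c * K \<le> inverse (64 * M\<^sup>2)"
  proof -
    have "c * K \<le> min (1/2) (inverse (64 * M\<^sup>2)) / K * K" using K by (intro mult_right_mono) (auto simp: c_def)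
    then have "c * K \<le> min (1/2) (inverse (64 * M\<^sup>2))" using K by simp
    then show "c * K \<le> 1/2" "c * K \<le> inverse (64 * M\<^sup>2)" by auto
  qed
  show ?thesis
  proof (intro exI[of _ c] conjI c allI impI)
    fix \<T> :: "pt set set" and p :: nat and w w_t :: "real \<Rightarrow> pt \<Rightarrow> real"
    assume H: "mesh_of \<Omega> \<T> \<and> (\<forall>T\<in>\<T>. shape_regular \<sigma> T) \<and> locally_quasi_uniform \<mu> \<T> \<and>
       h_max \<T> < 1 \<and> 1 \<le> p \<and> bochner_H1 {0<..tf} (X_space \<Omega> \<T>) (X_norm \<Omega> \<T>) w w_t"
    then have \<T>: "mesh_of \<Omega> \<T>" and sr: "\<And>T. T \<in> \<T> \<Longrightarrow> shape_regular \<sigma> T"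
      and hm: "h_max \<T> < 1" and p: "1 \<le> p" by auto
    note h = h_min_mesh[OF \<Omega> \<T> hm]
    have "AE t in lebesgue_on {0<..tf}. w t \<in> X_space \<Omega> \<T>"
      using H by (simp add: bochner_H1_def bochner_L2_def strongly_measurable_def)
    then show "AE t in lebesgue_on {0<..tf}. triple_norm_sq \<Omega> \<T> C_INV C_inv p (w t) (w_t t)
            \<ge> (c * h_min \<T> ^ 4 * inverse (real p ^ 8)) * norm_A_sq \<Omega> \<T> C_inv p (w t)"
    proof eventually_elim
      case (elim t)
      then have wm: "w t \<in> H1_minus \<Omega>" and w1: "w t \<in> H1 \<Omega>" by (auto simp: X_space_def H1_minus_def)
      define D where "D = M * real p ^ 4 / (h_min \<T>)\<^sup>2"
      define \<theta> where "\<theta> = h_min \<T> ^ 4 * inverse (real p ^ 8)"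
      have dl: "d0 \<le> delta C_inv p T" if T: "T \<in> \<T>" for T
        unfolding d0_def by (rule delta_lower_bound[OF mesh_open[OF \<T> T] sr[OF T] h(4)[OF T] p])
      have du: "delta C_inv p T \<le> D" if T: "T \<in> \<T>" for T
        unfolding D_def M_def
      proof (rule delta_upper_bound[OF mesh_open[OF \<T> T] h(4)[OF T] p h(1) h(3)[OF T] X(1)])
        fix z assume "z \<in> frontier T"
        then have "z \<in> closure \<Omega>"
          using closure_mono[OF mesh_subset[OF \<Omega> \<T> T]] by (auto simp: frontier_def)
        then show "\<bar>fst z\<bar> \<le> X" by (rule X(2))
      qed
      let ?x = "(L2norm (lebesgue_on \<Omega>) (wdx \<Omega> (w t)))\<^sup>2" and ?y = "(L2norm (lebesgue_on \<Omega>) (wdy \<Omega> (w t)))\<^sup>2"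
      have \<theta>: "0 \<le> \<theta>" "\<theta> \<le> 1"
      proof -
        have "h_min \<T> ^ 4 \<le> 1" using h by (intro power_le_one) auto
        moreover have "inverse (real p ^ 8) \<le> 1" using p by (simp add: inverse_le_1_iff one_le_power)
        ultimately show "\<theta> \<le> 1" unfolding \<theta>_def using h(1) by (intro mult_le_one) auto
      qed (use h(1) in \<open>simp add: \<theta>_def\<close>)
      \<comment> \<open>Squaring \<open>D\<close> produces p^8 / h_min^4, so \<theta> is exactly the
        mesh and degree dependence of the y-weight.\<close>
      have D: "inverse (64 * D\<^sup>2) = inverse (64 * M\<^sup>2) * \<theta>"
        using h(1) p M by (simp add: D_def \<theta>_def power_divide power_mult_distrib field_simps flip: power_mult)
      have "norm_A_sq \<Omega> \<T> C_inv p (w t) \<le> C * (?x + ?y) + 2 * (alpha d0 + gamma d0) * (?x + ?y)"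
        using norm_A_sq_le[OF op(1) \<T> w1 d0 dl] C(2)[OF wm] by simp
      then have "norm_A_sq \<Omega> \<T> C_inv p (w t) \<le> K * (?x + ?y)" by (simp add: K_def algebra_simps)
      then have "c * \<theta> * norm_A_sq \<Omega> \<T> C_inv p (w t) \<le> c * \<theta> * (K * (?x + ?y))"
        using c \<theta> by (intro mult_left_mono) auto
      also have "\<dots> = (c * K * \<theta>) * ?x + (c * K * \<theta>) * ?y" by (simp add: algebra_simps)
      also have "\<dots> \<le> 1/2 * ?x + inverse (64 * D\<^sup>2) * ?y"
      proof (intro add_mono mult_right_mono)
        have "c * K * \<theta> \<le> 1/2 * 1" using cK(1) \<theta> by (intro mult_mono) auto
        then show "c * K * \<theta> \<le> 1/2" by simp
        show "c * K * \<theta> \<le> inverse (64 * D\<^sup>2)" unfolding D using cK(2) \<theta>(1) by (rule mult_right_mono)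
      qed auto
      also have "\<dots> \<le> triple_norm_sq \<Omega> \<T> C_INV C_inv p (w t) (w_t t)"
        by (rule triple_norm_sq_ge[OF op(1) \<T> w1 d0 dl du])
      finally show ?case by (simp add: \<theta>_def mult.assoc)
    qed
  qed
qed

end
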